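(* Let $A\in\mathcal A_{\$}(\mathbf X)$ be a rich band-dominated operator on $\mathbf X=l^p(\mathbb Z^N,X)$, let $c\ge\|A\|$ (with $c>0$), and suppose that the sequence $(A_n)_{n\in\mathbb N}$ of finite sections $A_n:=P_nAP_n:\mathrm{im}\,P_n\to\mathrm{im}\,P_n$ is stable. Then $$\limsup_{n\to\infty}\|A_n^{-1}\|=\max_{S\in S(A,c)}\|S^{-1}\|,$$ where $S(A,c)$ is the stability spectrum of $A$.
   Context: Let $N\in\mathbb N$, $p\in\{0\}\cup[1,\infty]$, and let $X\ne\{0\}$ be a complex Banach space. $\mathbf X=l^p(\mathbb Z^N,X)$ is the space of sequences $x=(x_i)_{i\in\mathbb Z^N}$, $x_i\in X$, with the usual $p$-norm for $1\le p\le\infty$; $l^0(\mathbb Z^N,X)$ denotes the closure in $l^\infty(\mathbb Z^N,X)$ of the finitely supported sequences. $P_n:=\chi_{\{-n,\dots,n\}^N}I$ (multiplication by the characteristic function), $Q_n:=I-P_n$ ($n\in\mathbb N$), $\mathcal P:=(P_n)$. $\mathcal K(\mathbf X,\mathcal P):=\{K\in\mathcal L(\mathbf X):\|Q_nK\|+\|KQ_n\|\to0\}$; $\mathcal L(\mathbf X,\mathcal P):=\{A\in\mathcal L(\mathbf X): AK,KA\in\mathcal K(\mathbf X,\mathcal P)\ \forall K\in\mathcal K(\mathbf X,\mathcal P)\}$. $(B_n)\subset\mathcal L(\mathbf X)$ converges $\mathcal P$-strongly to $B$ if $\|K(B_n-B)\|+\|(B_n-B)K\|\to0$ for every $K\in\mathcal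 K(\mathbf X,\mathcal P)$. Shifts: $(V_kx)_i=x_{i-k}$ for $k\in\mathbb Z^N$. For $A\in\mathcal L(\mathbf X,\mathcal P)$ and $h=(h_n)\subset\mathbb Z^N$ with $|h_n|\to\infty$, the limit operator $A_h$ is the $\mathcal P$-strong limit of $V_{-h_n}AV_{h_n}$, if it exists. $A$ is rich if every $h\subset\mathbb Z^N$ tending to infinity has a subsequence $g$ such that $A_g$ exists. A band operator is a finite sum $\sum_\alpha a_\alpha V_\alpha$ with $a_\alpha\in l^\infty(\mathbb Z^N,\mathcal L(X))$ acting by $(a_\alpha x)_i=a_\alpha(i)x_i$; $\mathcal A(\mathbf X)\subset\mathcal L(\mathbf X,\mathcal P)$ is the norm closure in $\mathcal L(\mathbf X)$ of the set of band operators; $\mathcal A_{\$}(\mathbf X)$ is the set of rich operators in $\mathcal A(\mathbf X)$. $(A_n)$ is stable if there is $n_0$ such that all $A_n:\mathrm{im}\,P_n\to\mathrm{im}\,P_n$ with $n\ge n_0$ are invertible and $\sup_{n\ge n_0}\|A_n^{-1}\|<\infty$. For $c>0$ put $A_{n,c}:=P_nAP_n+cQ_n\in\mathcal L(\mathbf X)$. The stability spectrum $S(A,c)$ consists of the operator $A$ itself together with all truncated limit operators of $A$ extended by $c$ times the identity, that is, all $\mathcal P$-strong limits of sequences $V_{-h_k}A_{m_k,c}V_{h_k}$ as $k\to\infty$, where $m_k\in\mathbb N$, $m_k\to\infty$, and $h_k\in\mathbb Z^N$ with $|h_k|_\infty=m_k$ (these limits have the form $\chi_UA_h\chi_UI+c\,\chi_{\mathbb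 Z^N\setminus U}I$, with $A_h$ a limit operator of $A$ and $U\subset\mathbb Z^N$ the limit of the shifted cubes $\{-m_k,\dots,m_k\}^N-h_k$). *)

theory Defs
  imports "HOL-Analysis.Analysis"
begin

class complex_banach = banach +
  fixes scaleC :: "complex \<Rightarrow> 'a \<Rightarrow> 'a" (infixr "*\<^sub>C" 75)
  assumes scaleC_add_right: "a *\<^sub>C (x + y) = a *\<^sub>C x + a *\<^sub>C y"
    and scaleC_add_left: "(a + b) *\<^sub>C x = a *\<^sub>C x + b *\<^sub>C x"
    and scaleC_scaleC: "a *\<^sub>C (b *\<^sub>C x) = (a * b) *\<^sub>C x"
    and scaleC_of_real: "complex_of_real r *\<^sub>C x = r *\<^sub>R x"
    and norm_scaleC: "norm (a *\<^sub>C x) = cmod a * norm x"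

instantiation complex :: complex_banach
begin
definition scaleC_complex :: "complex \<Rightarrow> complex \<Rightarrow> complex"
  where "scaleC_complex a x = a * x"
instance
  by standard (simp_all add: scaleC_complex_def algebra_simps norm_mult scaleR_conv_of_real)
end

text \<open>The exponent 0 selects the closure of the finitely supported sequences in the
  space of bounded sequences, with the supremum norm. The norm is meaningful only on
  the corresponding space.\<close>

definition lp_norm :: "ereal \<Rightarrow> ('i \<Rightarrow> 'a::real_normed_vector) \<Rightarrow> real" where
  "lp_norm p x =
     (if p = 0 \<or> p = \<infinity> then SUP i. norm (x i)
      else (\<Sum>\<^sub>\<infinity>i. norm (x i) powr real_of_ereal p) powr (1 / real_of_ereal p))"

definition lp_space :: "ereal \<Rightarrow> ('i \<Rightarrow> 'a::real_normed_vector) set" where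
  "lp_space p =
     (if p = \<infinity> then {x. bounded (range x)}
      else if p = 0 then
        {x. bounded (range x) \<and>
            (\<forall>e>0. \<exists>y. finite {i. y i \<noteq> 0} \<and> lp_norm \<infinity> (\<lambda>i. x i - y i) < e)}
      else {x. (\<lambda>i. norm (x i) powr real_of_ereal p) summable_on UNIV})"

type_synonym ('n, 'a) seqs = "int ^ 'n \<Rightarrow> 'a"
type_synonym ('n, 'a) seq_op = "('n, 'a) seqs \<Rightarrow> ('n, 'a) seqs"

text \<open>Since the exponent is a term, the sequence space is a carrier set \<open>E\<close>, and an
  operator on \<open>E\<close> is a total function of which only the values on \<open>E\<close> matter: two
  functions that agree on \<open>E\<close> represent the same operator.\<close>

definition bounded_ops :: "ereal \<Rightarrow> ('n::finite, 'a::complex_banach) seqs set \<Rightarrow> ('n, 'a) seq_op set"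
  where
  "bounded_ops p E =
     {T. (\<forall>x\<in>E. T x \<in> E) \<and>
         (\<forall>x\<in>E. \<forall>y\<in>E. T (\<lambda>i. x i + y i) = (\<lambda>i. T x i + T y i)) \<and>
         (\<forall>a. \<forall>x\<in>E. T (\<lambda>i. a *\<^sub>C x i) = (\<lambda>i. a *\<^sub>C T x i)) \<and>
         (\<exists>C. \<forall>x\<in>E. lp_norm p (T x) \<le> C * lp_norm p x)}"

definition op_norm :: "ereal \<Rightarrow> ('n::finite, 'a::complex_banach) seqs set \<Rightarrow> ('n, 'a) seq_op \<Rightarrow> real"
  where
  "op_norm p E T = (SUP x\<in>{x\<in>E. lp_norm p x \<le> 1}. lp_norm p (T x))"

definition op_diff :: "('n::finite, 'a::complex_banach) seq_op \<Rightarrow> ('n, 'a) seq_op \<Rightarrow> ('n, 'a) seq_op"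
  where
  "op_diff S T = (\<lambda>x i. S x i - T x i)"

definition invertible_op :: "ereal \<Rightarrow> ('n::finite, 'a::complex_banach) seqs set \<Rightarrow> ('n, 'a) seq_op \<Rightarrow> bool"
  where
  "invertible_op p E T \<longleftrightarrow>
     T \<in> bounded_ops p E \<and>
     (\<exists>R\<in>bounded_ops p E. \<forall>x\<in>E. R (T x) = x \<and> T (R x) = x)"

text \<open>For an operator that is invertible on \<open>E\<close>, its inverse is \<open>inv_into E T\<close>.\<close>

definition inv_norm :: "ereal \<Rightarrow> ('n::finite, 'a::complex_banach) seqs set \<Rightarrow> ('n, 'a) seq_op \<Rightarrow> real"
  where
  "inv_norm p E T = op_norm p E (inv_into E T)"

definition cube :: "nat \<Rightarrow> (int ^ 'n::finite) set" where
  "cube n = {k. \<forall>j. k $ j \<in> {- int n..int n}}"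

definition P_proj :: "nat \<Rightarrow> ('n::finite, 'a::complex_banach) seq_op" where
  "P_proj n x = (\<lambda>i. if i \<in> cube n then x i else 0)"

definition Q_proj :: "nat \<Rightarrow> ('n::finite, 'a::complex_banach) seq_op" where
  "Q_proj n x = (\<lambda>i. x i - P_proj n x i)"

definition P_compact :: "ereal \<Rightarrow> ('n::finite, 'a::complex_banach) seq_op set" where
  "P_compact p =
     {K \<in> bounded_ops p (lp_space p).
        (\<lambda>n. op_norm p (lp_space p) (Q_proj n \<circ> K) + op_norm p (lp_space p) (K \<circ> Q_proj n))
          \<longlonglongrightarrow> 0}"

definition P_ops :: "ereal \<Rightarrow> ('n::finite, 'a::complex_banach) seq_op set" where
  "P_ops p =
     {A \<in> bounded_ops p (lp_space p).
        \<forall>K\<in>P_compact p. A \<circ> K \<in> P_compact p \<and> K \<circ> A \<in> P_compact p}"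

definition P_strong_limit ::
    "ereal \<Rightarrow> (nat \<Rightarrow> ('n::finite, 'a::complex_banach) seq_op) \<Rightarrow> ('n, 'a) seq_op \<Rightarrow> bool" where
  "P_strong_limit p B L \<longleftrightarrow>
     (\<forall>n. B n \<in> bounded_ops p (lp_space p)) \<and> L \<in> bounded_ops p (lp_space p) \<and>
     (\<forall>K\<in>P_compact p.
        (\<lambda>n. op_norm p (lp_space p) (K \<circ> op_diff (B n) L)
           + op_norm p (lp_space p) (op_diff (B n) L \<circ> K)) \<longlonglongrightarrow> 0)"

definition shift :: "int ^ 'n::finite \<Rightarrow> ('n, 'a::complex_banach) seq_op" where
  "shift k x = (\<lambda>i. x (i - k))"

definition sup_abs :: "int ^ 'n::finite \<Rightarrow> int" where
  "sup_abs k = Max (range (\<lambda>j. \<bar>k $ j\<bar>))"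

definition to_infinity :: "(nat \<Rightarrow> int ^ 'n::finite) \<Rightarrow> bool" where
  "to_infinity h \<longleftrightarrow> filterlim (\<lambda>n. sup_abs (h n)) at_top sequentially"

definition limit_op ::
    "ereal \<Rightarrow> ('n::finite, 'a::complex_banach) seq_op \<Rightarrow> (nat \<Rightarrow> int ^ 'n) \<Rightarrow> ('n, 'a) seq_op \<Rightarrow> bool"
  where
  "limit_op p A h L \<longleftrightarrow>
     to_infinity h \<and> P_strong_limit p (\<lambda>n. shift (- h n) \<circ> A \<circ> shift (h n)) L"

definition rich :: "ereal \<Rightarrow> ('n::finite, 'a::complex_banach) seq_op \<Rightarrow> bool" where
  "rich p A \<longleftrightarrow>
     A \<in> P_ops p \<and>
     (\<forall>h. to_infinity h \<longrightarrow> (\<exists>r L. strict_mono r \<and> limit_op p A (h \<circ> r) L))"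

text \<open>The type of \<open>blinfun\<close> only provides real-linear operators, so the complex
  homogeneity of the coefficients is a separate condition.\<close>

definition band_coeff :: "(int ^ 'n::finite \<Rightarrow> 'a::complex_banach \<Rightarrow>\<^sub>L 'a) \<Rightarrow> bool" where
  "band_coeff a \<longleftrightarrow>
     bounded (range a) \<and>
     (\<forall>i z v. blinfun_apply (a i) (z *\<^sub>C v) = z *\<^sub>C blinfun_apply (a i) v)"

definition mult_op :: "(int ^ 'n::finite \<Rightarrow> 'a::complex_banach \<Rightarrow>\<^sub>L 'a) \<Rightarrow> ('n, 'a) seq_op" where
  "mult_op a x = (\<lambda>i. blinfun_apply (a i) (x i))"

definition band_ops :: "('n::finite, 'a::complex_banach) seq_op set" where
  "band_ops =
     {B. \<exists>F a. finite F \<and> (\<forall>\<alpha>\<in>F. band_coeff (a \<alpha>)) \<and>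
         B = (\<lambda>x i. \<Sum>\<alpha>\<in>F. mult_op (a \<alpha>) (shift \<alpha> x) i)}"

definition band_dominated :: "ereal \<Rightarrow> ('n::finite, 'a::complex_banach) seq_op set" where
  "band_dominated p =
     {A \<in> bounded_ops p (lp_space p).
        \<forall>e>0. \<exists>B\<in>band_ops. op_norm p (lp_space p) (op_diff A B) < e}"

definition rich_band_dominated :: "ereal \<Rightarrow> ('n::finite, 'a::complex_banach) seq_op set" where
  "rich_band_dominated p = {A \<in> band_dominated p. rich p A}"

definition im_P :: "ereal \<Rightarrow> nat \<Rightarrow> ('n::finite, 'a::complex_banach) seqs set" where
  "im_P p n = P_proj n ` lp_space p"

definition fin_sec :: "('n::finite, 'a::complex_banach) seq_op \<Rightarrow> nat \<Rightarrow> ('n, 'a) seq_op" where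
  "fin_sec A n = P_proj n \<circ> A \<circ> P_proj n"

definition stable_seq :: "ereal \<Rightarrow> (nat \<Rightarrow> ('n::finite, 'a::complex_banach) seq_op) \<Rightarrow> bool" where
  "stable_seq p B \<longleftrightarrow>
     (\<exists>n0. (\<forall>n\<ge>n0. invertible_op p (im_P p n) (B n)) \<and>
           bdd_above ((\<lambda>n. inv_norm p (im_P p n) (B n)) ` {n0..}))"

definition fin_sec_ext ::
    "('n::finite, 'a::complex_banach) seq_op \<Rightarrow> real \<Rightarrow> nat \<Rightarrow> ('n, 'a) seq_op" where
  "fin_sec_ext A c n = (\<lambda>x i. fin_sec A n x i + c *\<^sub>R Q_proj n x i)"

definition stab_spectrum ::
    "ereal \<Rightarrow> ('n::finite, 'a::complex_banach) seq_op \<Rightarrow> real \<Rightarrow> ('n, 'a) seq_op set" where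
  "stab_spectrum p A c =
     {A} \<union>
     {S. \<exists>m h. filterlim m at_top sequentially \<and> (\<forall>k. sup_abs (h k) = int (m k)) \<and>
           P_strong_limit p (\<lambda>k. shift (- h k) \<circ> fin_sec_ext A c (m k) \<circ> shift (h k)) S}"

end

theory Submission
  imports Defs "HOL-Library.Diagonal_Subsequence"
begin

text \<open>The argument works with lower bounds: for an invertible operator \<open>T\<close>, the number \<open>1 / inv_norm T\<close> is
  the infimum of \<open>nrm (T x) / nrm x\<close>. Let \<open>L\<close> be the limit superior of the norms of the inverses of the
  finite sections. Everything rests on one property of band-dominated operators: they almost
  commute with multiplication by slowly varying weights, uniformly in the centre of the weight, and
  this property survives translation and truncation. The weights used here are
  \<open>exp (- ell1 (i - j) / t)\<close>, whose variation is small relative to their own value when \<open>t\<close> is large.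

  No member of the stability spectrum has an inverse of norm greater than \<open>L\<close>. Every member is a
  limit of extended and translated finite sections \<open>B k\<close>, in the sense that the rows converge in
  norm. Multiplying by a weight makes row convergence as good as norm convergence, and the weight
  can be moved past \<open>B k\<close> at small cost. So a common lower bound of the \<open>B k\<close> passes to the limit
  (lemma \<open>limit_lower_bound\<close>), and the solutions of \<open>B k x = y\<close> converge coordinatewise to a solution
  of the limit equation (lemma \<open>limit_surjective\<close>). The extension by \<open>c\<close> on the complement of the cube
  does not spoil the lower bounds, because \<open>c\<close> is at least the norm of \<open>A\<close> and hence at least \<open>1 / L\<close>.

  Some member attains \<open>L\<close>. A minimiser of a finite section can be cut down to a cube of bounded size
  without losing much (lemma \<open>localize_minimiser\<close>); for finite exponents a good centre is found by
  averaging over all translates of the weight. Doing so repeatedly, with coarser and coarser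
  accuracy inside the support of the previous minimiser, yields one centre \<open>g k\<close> in the cube of size
  \<open>n k\<close> that is good for all accuracies at once (lemmas \<open>nested_localization\<close> and \<open>centred_witnesses\<close>).
  If the distance of \<open>g k\<close> to the boundary of the cube tends to infinity, the minimisers do not feel
  the truncation and \<open>A\<close> itself has lower bound at most \<open>1 / L\<close>. Otherwise a subsequence of the \<open>g k\<close>
  stays within a fixed distance of boundary points \<open>h k\<close>. Richness gives a limit operator along a
  further subsequence, a diagonal argument makes the shifted cubes converge to a set, and together
  these produce a truncated limit operator to which the minimisers are transported by translation
  (lemma \<open>boundary_limit_with_witnesses\<close>).\<close>

section \<open>The sequence spaces\<close>

definition restr :: "'i set \<Rightarrow> ('i \<Rightarrow> 'a::real_normed_vector) \<Rightarrow> 'i \<Rightarrow> 'a" where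
  "restr U x = (\<lambda>i. if i \<in> U then x i else 0)"

lemma powr_convex_combination:
  fixes a b \<theta> q :: real
  assumes "1 \<le> q" "0 \<le> a" "0 \<le> b" "0 \<le> \<theta>" "\<theta> \<le> 1"
  shows "(\<theta> * a + (1 - \<theta>) * b) powr q \<le> \<theta> * a powr q + (1 - \<theta>) * b powr q"
proof -
  have shrink: "(s * u) powr q \<le> s * u powr q" if "0 \<le> s" "s \<le> 1" "0 \<le> u" for s u :: real
  proof -
    have "s powr q \<le> s powr 1"
      using that assms(1) by (cases "s = 0") (auto intro: order_trans[OF powr_mono'[OF assms(1)]])
    then show ?thesis
      using that by (simp add: powr_mult mult_right_mono)
  qed
  consider "a = 0" | "b = 0" | "0 < a" "0 < b"
    using assms by linarith
  then show ?thesis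
  proof cases
    case 1
    then show ?thesis using shrink[of "1 - \<theta>" b] assms by simp
  next
    case 2
    then show ?thesis using shrink[of \<theta> a] assms by simp
  next
    case 3
    then show ?thesis
      using convex_onD[OF powr_convex[OF assms(1)], of "1 - \<theta>" a b] assms
      by (simp add: algebra_simps)
  qed
qed

lemma lp_space_0_iff:
  fixes x :: "'i \<Rightarrow> 'a::real_normed_vector"
  shows "x \<in> lp_space 0 \<longleftrightarrow> bounded (range x) \<and> (\<forall>e>0. finite {i. e \<le> norm (x i)})"
proof (intro iffI conjI allI impI)
  assume x: "x \<in> lp_space 0"
  then show bx: "bounded (range x)"
    by (simp add: lp_space_def)
  fix e :: real assume "0 < e"
  with x obtain y where y: "finite {i. y i \<noteq> 0}" "lp_norm \<infinity> (\<lambda>i. x i - y i) < e"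
    by (auto simp: lp_space_def)
  have "finite (y ` {i. y i \<noteq> 0} \<union> {0})"
    using y(1) by simp
  moreover have "range y \<subseteq> y ` {i. y i \<noteq> 0} \<union> {0}"
    by auto
  ultimately have "bounded (range y)"
    using finite_imp_bounded finite_subset by blast
  then obtain C D where C: "\<forall>i. norm (x i) \<le> C" and D: "\<forall>i. norm (y i) \<le> D"
    using bx by (auto simp: bounded_iff)
  have "norm (x i - y i) \<le> C + D" for i
    using C D norm_triangle_ineq4[of "x i" "y i"] by (meson add_mono order_trans)
  then have "bdd_above (range (\<lambda>i. norm (x i - y i)))"
    by (auto intro!: bdd_aboveI)
  then have lt: "norm (x i - y i) < e" for i
    using cSUP_upper[of i UNIV "\<lambda>i. norm (x i - y i)"] y(2) by (simp add: lp_norm_def)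
  have "y i \<noteq> 0" if "e \<le> norm (x i)" for i
  proof (rule notI)
    assume "y i = 0"
    then show False using that lt[of i] by simp
  qed
  then show "finite {i. e \<le> norm (x i)}"
    by (auto intro: finite_subset[OF _ y(1)])
next
  assume x: "bounded (range x) \<and> (\<forall>e>0. finite {i. e \<le> norm (x i)})"
  show "x \<in> lp_space 0"
    unfolding lp_space_def
  proof (clarsimp simp: x, intro exI conjI)
    fix e :: real assume e: "0 < e"
    let ?y = "restr {i. e / 2 \<le> norm (x i)} x"
    have "finite {i. e / 2 \<le> norm (x i)}"
      using x e by (meson half_gt_zero)
    then show "finite {i. ?y i \<noteq> 0}"
      by (rule rev_finite_subset) (auto simp: restr_def)
    have "lp_norm \<infinity> (\<lambda>i. x i - ?y i) \<le> e / 2"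
    proof -
      have "norm (x i - ?y i) \<le> e / 2" for i
        using e by (simp add: restr_def)
      then show ?thesis
        by (simp add: lp_norm_def cSUP_least del: le_divide_eq_numeral1)
    qed
    then show "lp_norm \<infinity> (\<lambda>i. x i - ?y i) < e"
      using e by simp
  qed
qed

locale lp_exponent =
  fixes p :: ereal
  assumes p_range: "p = 0 \<or> 1 \<le> p"
begin

abbreviation nrm :: "('i \<Rightarrow> 'a::real_normed_vector) \<Rightarrow> real" where
  "nrm \<equiv> lp_norm p"

abbreviation E :: "('i \<Rightarrow> 'a::real_normed_vector) set" where
  "E \<equiv> lp_space p"

lemma exponent_cases:
  obtains (sup) "p = 0 \<or> p = \<infinity>" | (pow) q where "p = ereal q" "1 \<le> q"
  using p_range by (cases p) auto

lemma nrm_sup: "p = 0 \<or> p = \<infinity> \<Longrightarrow> nrm x = (SUP i. norm (x i))"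
  by (simp add: lp_norm_def)

lemma nrm_pow:
  "p = ereal q \<Longrightarrow> 1 \<le> q \<Longrightarrow> nrm x = (\<Sum>\<^sub>\<infinity>i. norm (x i) powr q) powr (1 / q)"
  by (auto simp: lp_norm_def)

lemma E_pow:
  "p = ereal q \<Longrightarrow> 1 \<le> q \<Longrightarrow> x \<in> E \<longleftrightarrow> (\<lambda>i. norm (x i) powr q) summable_on UNIV"
  by (auto simp: lp_space_def)

lemma in_E_supI:
  assumes "p = 0 \<or> p = \<infinity>" "bounded (range x)" "\<And>e. p = 0 \<Longrightarrow> 0 < e \<Longrightarrow> finite {i. e \<le> norm (x i)}"
  shows "x \<in> E"
proof (cases "p = 0")
  case True
  then show ?thesis using assms(2,3) unfolding True lp_space_0_iff by blast
next
  case False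
  then show ?thesis using assms(1,2) by (simp add: lp_space_def)
qed

lemma E_sup_bdd:
  assumes "p = 0 \<or> p = \<infinity>" "x \<in> E"
  shows "bdd_above (range (\<lambda>i. norm (x i)))"
proof -
  have "bounded (range x)"
    using assms by (auto simp: lp_space_def)
  then show ?thesis
    unfolding bounded_iff bdd_above_def by auto
qed

lemma nrm_powr:
  assumes "p = ereal q" "1 \<le> q"
  shows "nrm x powr q = (\<Sum>\<^sub>\<infinity>i. norm (x i) powr q)"
  unfolding nrm_pow[OF assms] using assms(2) by (simp add: powr_powr infsum_nonneg)

lemma nrm_nonneg:
  assumes "x \<in> E"
  shows "0 \<le> nrm x"
proof (cases rule: exponent_cases)
  case sup
  have "0 \<le> norm (x undefined)" by simp
  also have "\<dots> \<le> nrm x"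
    unfolding nrm_sup[OF sup] by (intro cSUP_upper E_sup_bdd[OF sup assms]) simp
  finally show ?thesis .
next
  case (pow q)
  show ?thesis by (simp add: nrm_pow[OF pow])
qed

lemma nrm_le_iff_pow:
  assumes "p = ereal q" "1 \<le> q" "x \<in> E" "0 \<le> b"
  shows "nrm x \<le> b \<longleftrightarrow> (\<Sum>\<^sub>\<infinity>i. norm (x i) powr q) \<le> b powr q"
  unfolding nrm_powr[OF assms(1,2), symmetric]
proof
  show "nrm x \<le> b \<Longrightarrow> nrm x powr q \<le> b powr q"
    using assms nrm_nonneg[OF assms(3)] by (intro powr_mono2) auto
  show "nrm x powr q \<le> b powr q \<Longrightarrow> nrm x \<le> b"
    using assms powr_less_mono2[of q b "nrm x"] by (force simp: not_le[symmetric])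
qed

lemma nrm_cong:
  assumes "\<And>i. norm (y i) = norm (x i)"
  shows "nrm y = nrm x"
  using assms by (simp add: lp_norm_def)

lemma dominated:
  fixes x :: "'i \<Rightarrow> 'a::real_normed_vector" and y :: "'i \<Rightarrow> 'b::real_normed_vector"
  assumes x: "x \<in> E" and le: "\<And>i. norm (y i) \<le> norm (x i)"
  shows dominated_in_E: "y \<in> E" and dominated_nrm: "nrm y \<le> nrm x"
proof -
  have "y \<in> E \<and> nrm y \<le> nrm x"
  proof (cases rule: exponent_cases)
    case sup
    have "bounded (range x)"
      using x sup by (auto simp: lp_space_def)
    then obtain C where "\<forall>i. norm (x i) \<le> C"
      by (auto simp: bounded_iff)
    then have by': "bounded (range y)"
      using le by (auto simp: bounded_iff intro: order_trans)
    have "finite {i. e \<le> norm (y i)}" if "p = 0" "e > 0" for e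
    proof -
      have "finite {i. e \<le> norm (x i)}"
        using x that by (simp add: lp_space_0_iff)
      then show ?thesis
        by (rule rev_finite_subset) (use le in \<open>auto intro: order_trans\<close>)
    qed
    then have "y \<in> E"
      by (intro in_E_supI[OF sup by'])
    moreover have "nrm y \<le> nrm x"
      unfolding nrm_sup[OF sup]
      by (rule cSUP_mono) (use le E_sup_bdd[OF sup x] in auto)
    ultimately show ?thesis ..
  next
    case (pow q)
    have le': "norm (y i) powr q \<le> norm (x i) powr q" for i
      using le pow(2) by (intro powr_mono2) auto
    have sx: "(\<lambda>i. norm (x i) powr q) summable_on UNIV"
      using x pow(2) by (simp add: E_pow[OF pow])
    then have sy: "(\<lambda>i. norm (y i) powr q) summable_on UNIV"
      by (rule summable_on_comparison_test) (use le' in auto)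
    have "(\<Sum>\<^sub>\<infinity>i. norm (y i) powr q) \<le> (\<Sum>\<^sub>\<infinity>i. norm (x i) powr q)"
      by (rule infsum_mono[OF sy sx le'])
    then have "nrm y \<le> nrm x"
      unfolding nrm_pow[OF pow] using pow(2) by (intro powr_mono2) (auto intro!: infsum_nonneg)
    then show ?thesis
      using sy pow(2) by (simp add: E_pow[OF pow])
  qed
  then show "y \<in> E" "nrm y \<le> nrm x" by auto
qed

lemma nrm_coord:
  assumes "x \<in> E"
  shows "norm (x i) \<le> nrm x"
proof (cases rule: exponent_cases)
  case sup
  then show ?thesis
    unfolding nrm_sup[OF sup] by (intro cSUP_upper E_sup_bdd[OF sup assms]) simp
next
  case (pow q)
  have "(\<Sum>j\<in>{i}. norm (x j) powr q) \<le> (\<Sum>\<^sub>\<infinity>j. norm (x j) powr q)"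
    using assms pow(2) by (intro finite_sum_le_infsum) (auto simp: E_pow[OF pow])
  then have "(norm (x i) powr q) powr (1 / q) \<le> nrm x"
    unfolding nrm_pow[OF pow] using pow(2) by (intro powr_mono2) auto
  then show ?thesis using pow(2) by (simp add: powr_powr)
qed

lemma nrm_zero: "nrm (\<lambda>_. 0) = 0"
  by (simp add: lp_norm_def)

lemma zero_in_E: "(\<lambda>_. 0) \<in> E"
proof (cases rule: exponent_cases)
  case sup
  show ?thesis by (rule in_E_supI[OF sup]) auto
next
  case (pow q)
  show ?thesis by (simp add: E_pow[OF pow])
qed

lemma nrm_eq_0_imp:
  assumes "x \<in> E" "nrm x \<le> 0"
  shows "x = (\<lambda>_. 0)"
proof
  fix i
  have "norm (x i) \<le> 0" using nrm_coord[OF assms(1), of i] assms(2) by linarith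
  then show "x i = 0" by simp
qed

lemma scaleR_closed:
  assumes "x \<in> E"
  shows scaleR_in_E: "(\<lambda>i. a *\<^sub>R x i) \<in> E" and nrm_scaleR: "nrm (\<lambda>i. a *\<^sub>R x i) = \<bar>a\<bar> * nrm x"
proof -
  have "(\<lambda>i. a *\<^sub>R x i) \<in> E \<and> nrm (\<lambda>i. a *\<^sub>R x i) = \<bar>a\<bar> * nrm x"
  proof (cases rule: exponent_cases)
    case sup
    have "bounded (range x)" using assms sup by (auto simp: lp_space_def)
    then have "bounded (range (\<lambda>i. a *\<^sub>R x i))"
      using bounded_scaling[of "range x" a] by (simp add: image_image)
    moreover have "finite {i. e \<le> norm (a *\<^sub>R x i)}" if "p = 0" "e > 0" for e
    proof (cases "a = 0")
      case False
      then have "{i. e \<le> norm (a *\<^sub>R x i)} = {i. e / \<bar>a\<bar> \<le> norm (x i)}"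
        by (auto simp: field_simps)
      moreover have "e / \<bar>a\<bar> > 0" using False that by simp
      ultimately show ?thesis using assms that by (simp add: lp_space_0_iff)
    qed (use that in auto)
    ultimately have "(\<lambda>i. a *\<^sub>R x i) \<in> E"
      by (intro in_E_supI[OF sup]) auto
    moreover have "nrm (\<lambda>i. a *\<^sub>R x i) = \<bar>a\<bar> * nrm x"
    proof (rule antisym)
      show "nrm (\<lambda>i. a *\<^sub>R x i) \<le> \<bar>a\<bar> * nrm x"
        unfolding nrm_sup[OF sup, of "\<lambda>i. a *\<^sub>R x i"]
        by (rule cSUP_least) (auto intro!: mult_left_mono nrm_coord assms)
      show "\<bar>a\<bar> * nrm x \<le> nrm (\<lambda>i. a *\<^sub>R x i)"
      proof (cases "a = 0")
        case False
        have "nrm x \<le> nrm (\<lambda>i. a *\<^sub>R x i) / \<bar>a\<bar>"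
          unfolding nrm_sup[OF sup, of x]
        proof (rule cSUP_least)
          fix i
          show "norm (x i) \<le> nrm (\<lambda>i. a *\<^sub>R x i) / \<bar>a\<bar>"
            using nrm_coord[OF \<open>(\<lambda>i. a *\<^sub>R x i) \<in> E\<close>, of i] False by (simp add: field_simps)
        qed simp
        then show ?thesis using False by (simp add: field_simps)
      qed (simp add: nrm_zero)
    qed
    ultimately show ?thesis ..
  next
    case (pow q)
    have *: "norm (a *\<^sub>R x i) powr q = \<bar>a\<bar> powr q * norm (x i) powr q" for i
      by (simp add: powr_mult)
    have "(\<lambda>i. norm (a *\<^sub>R x i) powr q) summable_on UNIV"
      unfolding * using assms pow(2) by (intro summable_on_cmult_right) (simp add: E_pow[OF pow])
    moreover have "nrm (\<lambda>i. a *\<^sub>R x i) = \<bar>a\<bar> * nrm x"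
      unfolding nrm_pow[OF pow] * using pow(2)
      by (simp add: infsum_cmult_right' powr_mult powr_powr infsum_nonneg)
    ultimately show ?thesis using pow(2) by (simp add: E_pow[OF pow])
  qed
  then show "(\<lambda>i. a *\<^sub>R x i) \<in> E" "nrm (\<lambda>i. a *\<^sub>R x i) = \<bar>a\<bar> * nrm x" by auto
qed

text \<open>Minkowski's inequality for infinite sums is the convexity of the power function,
  applied to the normalised sequences and summed over the coordinates.\<close>

lemma add_closed:
  fixes x y :: "'i \<Rightarrow> 'a::real_normed_vector"
  assumes x: "x \<in> E" and y: "y \<in> E"
  shows add_in_E: "(\<lambda>i. x i + y i) \<in> E" and nrm_triangle: "nrm (\<lambda>i. x i + y i) \<le> nrm x + nrm y"
proof -
  have "(\<lambda>i. x i + y i) \<in> E \<and> nrm (\<lambda>i. x i + y i) \<le> nrm x + nrm y"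
  proof (cases rule: exponent_cases)
    case sup
    have le: "norm (x i + y i) \<le> nrm x + nrm y" for i
      using nrm_coord[OF x, of i] nrm_coord[OF y, of i] norm_triangle_ineq[of "x i" "y i"]
      by linarith
    then have "bounded (range (\<lambda>i. x i + y i))"
      unfolding bounded_iff by auto
    moreover have "finite {i. e \<le> norm (x i + y i)}" if "p = 0" "e > 0" for e
    proof -
      have "finite ({i. e / 2 \<le> norm (x i)} \<union> {i. e / 2 \<le> norm (y i)})"
        using x y that half_gt_zero[OF that(2)] unfolding lp_space_0_iff \<open>p = 0\<close> by blast
      moreover have "{i. e \<le> norm (x i + y i)} \<subseteq> {i. e / 2 \<le> norm (x i)} \<union> {i. e / 2 \<le> norm (y i)}"
      proof
        fix i assume "i \<in> {i. e \<le> norm (x i + y i)}"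
        then show "i \<in> {i. e / 2 \<le> norm (x i)} \<union> {i. e / 2 \<le> norm (y i)}"
          using norm_triangle_ineq[of "x i" "y i"] by auto
      qed
      ultimately show ?thesis by (rule rev_finite_subset)
    qed
    ultimately have "(\<lambda>i. x i + y i) \<in> E"
      by (intro in_E_supI[OF sup]) auto
    moreover have "nrm (\<lambda>i. x i + y i) \<le> nrm x + nrm y"
      unfolding nrm_sup[OF sup, of "\<lambda>i. x i + y i"] by (rule cSUP_least) (use le in auto)
    ultimately show ?thesis ..
  next
    case (pow q)
    define a b where "a = nrm x" and "b = nrm y"
    have ab: "0 \<le> a" "0 \<le> b" using nrm_nonneg x y by (auto simp: a_def b_def)
    show ?thesis
    proof (cases "a = 0 \<or> b = 0")
      case True
      then have "x = (\<lambda>_. 0) \<or> y = (\<lambda>_. 0)"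
        using nrm_eq_0_imp[OF x] nrm_eq_0_imp[OF y] by (auto simp: a_def b_def)
      then show ?thesis using x y by (auto simp: nrm_zero)
    next
      case False
      with ab have pos: "0 < a" "0 < b" by auto
      define \<theta> where "\<theta> = a / (a + b)"
      have \<theta>: "0 \<le> \<theta>" "\<theta> \<le> 1" "1 - \<theta> = b / (a + b)"
        using pos by (auto simp: \<theta>_def field_simps)
      have sx: "(\<lambda>i. norm (x i) powr q) summable_on UNIV"
        and sy: "(\<lambda>i. norm (y i) powr q) summable_on UNIV"
        using x y pow(2) by (auto simp: E_pow[OF pow])
      define f where "f i = (a + b) powr q *
          (\<theta> * (1 / a powr q * norm (x i) powr q) + (1 - \<theta>) * (1 / b powr q * norm (y i) powr q))" for i
      have sf: "f summable_on UNIV"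
        unfolding f_def by (intro summable_on_cmult_right summable_on_add sx sy)
      have "infsum f UNIV = (a + b) powr q *
          (\<theta> * (1 / a powr q * (\<Sum>\<^sub>\<infinity>i. norm (x i) powr q)) + (1 - \<theta>) * (1 / b powr q * (\<Sum>\<^sub>\<infinity>i. norm (y i) powr q)))"
        unfolding f_def
        by (simp only: infsum_cmult_right' infsum_add summable_on_cmult_right summable_on_add sx sy)
      also have "\<dots> = (a + b) powr q"
        using pos by (simp add: nrm_powr[OF pow, symmetric] a_def[symmetric] b_def[symmetric])
      finally have infsum_f: "infsum f UNIV = (a + b) powr q" .
      have le: "norm (x i + y i) powr q \<le> f i" for i
      proof -
        have "norm (x i + y i) \<le> (a + b) * (\<theta> * (norm (x i) / a) + (1 - \<theta>) * (norm (y i) / b))"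
        proof -
          have "(a + b) * (\<theta> * (norm (x i) / a) + (1 - \<theta>) * (norm (y i) / b))
              = ((a + b) * \<theta>) * (norm (x i) / a) + ((a + b) * (1 - \<theta>)) * (norm (y i) / b)"
            by (simp only: distrib_left mult.assoc)
          also have "\<dots> = norm (x i) + norm (y i)"
            using pos unfolding \<theta>(3) by (simp add: \<theta>_def)
          finally show ?thesis
            using norm_triangle_ineq[of "x i" "y i"] by simp
        qed
        then have "norm (x i + y i) powr q
            \<le> ((a + b) * (\<theta> * (norm (x i) / a) + (1 - \<theta>) * (norm (y i) / b))) powr q"
          using pow(2) by (intro powr_mono2) auto
        also have "\<dots> = (a + b) powr q * (\<theta> * (norm (x i) / a) + (1 - \<theta>) * (norm (y i) / b)) powr q"
          using pos \<theta> by (simp add: powr_mult)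
        also have "\<dots> \<le> (a + b) powr q * (\<theta> * (norm (x i) / a) powr q + (1 - \<theta>) * (norm (y i) / b) powr q)"
          using pos \<theta> pow(2) by (intro mult_left_mono powr_convex_combination) auto
        also have "\<dots> = f i"
          using pos by (simp add: f_def powr_divide)
        finally show ?thesis .
      qed
      have s: "(\<lambda>i. norm (x i + y i) powr q) summable_on UNIV"
        by (rule summable_on_comparison_test[OF sf]) (use le in auto)
      then have mem: "(\<lambda>i. x i + y i) \<in> E" using pow(2) by (simp add: E_pow[OF pow])
      have "(\<Sum>\<^sub>\<infinity>i. norm (x i + y i) powr q) \<le> (a + b) powr q"
        using infsum_mono[OF s sf le] infsum_f by simp
      then show ?thesis
        using mem nrm_le_iff_pow[OF pow mem, of "a + b"] pos by (simp add: a_def b_def)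
    qed
  qed
  then show "(\<lambda>i. x i + y i) \<in> E" "nrm (\<lambda>i. x i + y i) \<le> nrm x + nrm y" by auto
qed

lemma diff_closed:
  fixes x y :: "'i \<Rightarrow> 'a::real_normed_vector"
  assumes x: "x \<in> E" and y: "y \<in> E"
  shows diff_in_E: "(\<lambda>i. x i - y i) \<in> E" and nrm_diff: "nrm (\<lambda>i. x i - y i) \<le> nrm x + nrm y"
  using add_closed[OF x scaleR_in_E[OF y, of "-1"]] nrm_scaleR[OF y, of "-1"] by auto

lemma nrm_minus_commute: "nrm (\<lambda>i. x i - y i) = nrm (\<lambda>i. y i - x i)"
  by (rule nrm_cong) (rule norm_minus_commute)

lemma nrm_diff_triangle:
  fixes x y z :: "'i \<Rightarrow> 'a::real_normed_vector"
  assumes "x \<in> E" "y \<in> E" "z \<in> E"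
  shows "nrm (\<lambda>i. x i - z i) \<le> nrm (\<lambda>i. x i - y i) + nrm (\<lambda>i. y i - z i)"
  using nrm_triangle[OF diff_in_E[OF assms(1,2)] diff_in_E[OF assms(2,3)]] by simp

lemma nrm_le_diff:
  fixes x y :: "'i \<Rightarrow> 'a::real_normed_vector"
  assumes "x \<in> E" "y \<in> E"
  shows "nrm x \<le> nrm y + nrm (\<lambda>i. x i - y i)"
  using nrm_triangle[OF assms(2) diff_in_E[OF assms]] by simp

lemma reindex_closed:
  fixes x :: "'i \<Rightarrow> 'a::real_normed_vector" and f :: "'j \<Rightarrow> 'i"
  assumes "bij f"
  shows reindex_in_E: "(\<lambda>j. x (f j)) \<in> E \<longleftrightarrow> x \<in> E" and nrm_reindex: "nrm (\<lambda>j. x (f j)) = nrm x"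
proof -
  have r: "range (\<lambda>j. g (f j)) = range g" for g :: "'i \<Rightarrow> 'b"
  proof -
    have "range (\<lambda>j. g (f j)) = g ` range f" by auto
    then show ?thesis using bij_is_surj[OF assms] by simp
  qed
  have fin: "finite {j. P (f j)} \<longleftrightarrow> finite {i. P i}" for P
  proof -
    have "{j. P (f j)} = f -` {i. P i}" by auto
    then show ?thesis
      using finite_vimage_iff[OF assms, of "{i. P i}"] by simp
  qed
  show "(\<lambda>j. x (f j)) \<in> E \<longleftrightarrow> x \<in> E"
  proof (cases rule: exponent_cases)
    case sup
    then show ?thesis
    proof
      assume "p = 0"
      then show ?thesis using r[of x] fin[of "\<lambda>i. _ \<le> norm (x i)"] by (simp add: lp_space_0_iff)
    next
      assume "p = \<infinity>"
      then show ?thesis using r[of x] by (simp add: lp_space_def)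
    qed
  next
    case (pow q)
    show ?thesis
      using summable_on_reindex_bij_betw[OF assms, of "\<lambda>i. norm (x i) powr q"]
      by (simp add: E_pow[OF pow])
  qed
  show "nrm (\<lambda>j. x (f j)) = nrm x"
  proof (cases rule: exponent_cases)
    case sup
    then show ?thesis using r[of "\<lambda>i. norm (x i)"] by (simp add: nrm_sup)
  next
    case (pow q)
    show ?thesis
      using infsum_reindex_bij_betw[OF assms, of "\<lambda>i. norm (x i) powr q"]
      by (simp add: nrm_pow[OF pow])
  qed
qed

lemma finite_support_in_E:
  fixes x :: "'i \<Rightarrow> 'a::real_normed_vector"
  assumes "finite {i. x i \<noteq> 0}"
  shows "x \<in> E"
proof (cases rule: exponent_cases)
  case sup
  have "range x \<subseteq> x ` {i. x i \<noteq> 0} \<union> {0}" by auto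
  then have "bounded (range x)"
    using assms finite_subset[of "range x" "x ` {i. x i \<noteq> 0} \<union> {0}"] by (intro finite_imp_bounded) simp
  moreover have "finite {i. e \<le> norm (x i)}" if "e > 0" for e
    by (rule finite_subset[OF _ assms]) (use that in auto)
  ultimately show ?thesis
    by (intro in_E_supI[OF sup]) auto
next
  case (pow q)
  have "finite {i. norm (x i) powr q \<noteq> 0}"
    by (rule finite_subset[OF _ assms]) auto
  then have "(\<lambda>i. norm (x i) powr q) summable_on UNIV"
    by (intro finite_nonzero_values_imp_summable_on) simp
  then show ?thesis using pow(2) by (simp add: E_pow[OF pow])
qed

lemma restr_closed:
  assumes "x \<in> E"
  shows restr_in_E: "restr U x \<in> E" and nrm_restr: "nrm (restr U x) \<le> nrm x"
  by (rule dominated[OF assms], simp add: restr_def)+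

text \<open>The norm is the supremum of the norms of the finite parts. For exponent 0 a bound on the finite
  parts does not give membership, as constant sequences on an infinite index set show.\<close>

lemma nrm_Fatou:
  fixes x :: "'i \<Rightarrow> 'a::real_normed_vector"
  assumes le: "\<And>F. finite F \<Longrightarrow> nrm (restr F x) \<le> b"
  shows nrm_le_finite_restr: "nrm x \<le> b" and in_E_finite_restr: "p \<noteq> 0 \<Longrightarrow> x \<in> E"
proof -
  have fin: "restr F x \<in> E" if "finite F" for F
    by (rule finite_support_in_E, rule finite_subset[OF _ that]) (auto simp: restr_def)
  have b: "0 \<le> b"
    using le[of "{}"] by (simp add: restr_def nrm_zero)
  have "nrm x \<le> b \<and> (p \<noteq> 0 \<longrightarrow> x \<in> E)"
  proof (cases rule: exponent_cases)
    case sup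
    have le1: "norm (x i) \<le> b" for i
      using nrm_coord[OF fin[of "{i}"], of i] le[of "{i}"] by (simp add: restr_def)
    then have "nrm x \<le> b"
      unfolding nrm_sup[OF sup] by (auto intro!: cSUP_least)
    moreover have "bounded (range x)"
      using le1 by (auto simp: bounded_iff)
    ultimately show ?thesis
      using sup by (auto simp: lp_space_def)
  next
    case (pow q)
    have part: "(\<Sum>i\<in>F. norm (x i) powr q) \<le> b powr q" if F: "finite F" for F
    proof -
      have "(\<Sum>\<^sub>\<infinity>i. norm (restr F x i) powr q) = (\<Sum>\<^sub>\<infinity>i\<in>F. norm (x i) powr q)"
        by (rule infsum_cong_neutral) (auto simp: restr_def)
      then have "(\<Sum>i\<in>F. norm (x i) powr q) = (\<Sum>\<^sub>\<infinity>i. norm (restr F x i) powr q)"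
        using F by simp
      also have "\<dots> \<le> b powr q"
        using nrm_le_iff_pow[OF pow fin[OF F] b] le[OF F] by simp
      finally show ?thesis .
    qed
    have s: "(\<lambda>i. norm (x i) powr q) summable_on UNIV"
      by (rule nonneg_bdd_above_summable_on) (auto intro!: bdd_aboveI2 part)
    then have mem: "x \<in> E" using pow(2) by (simp add: E_pow[OF pow])
    have "(\<Sum>\<^sub>\<infinity>i. norm (x i) powr q) \<le> b powr q"
      by (rule infsum_le_finite_sums[OF s]) (use part in auto)
    then show ?thesis
      using nrm_le_iff_pow[OF pow mem b] mem by simp
  qed
  then show "nrm x \<le> b" "p \<noteq> 0 \<Longrightarrow> x \<in> E" by auto
qed

text \<open>The norm of a sequence is determined monotonically by the norms of its parts on
  complementary index sets; this is what makes lower bounds of a direct sum of operators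
  the minimum of the lower bounds.\<close>

lemma lower_bound_split:
  fixes x y :: "'i \<Rightarrow> 'a::real_normed_vector"
  assumes x: "x \<in> E" and y: "y \<in> E" and \<delta>: "0 \<le> \<delta>"
    and U: "\<delta> * nrm (restr U x) \<le> nrm (restr U y)"
    and V: "\<delta> * nrm (restr (- U) x) \<le> nrm (restr (- U) y)"
  shows "\<delta> * nrm x \<le> nrm y"
proof (cases "\<delta> = 0")
  case True
  then show ?thesis using nrm_nonneg[OF y] by simp
next
  case False
  with \<delta> have pos: "0 < \<delta>" by simp
  show ?thesis
  proof (cases rule: exponent_cases)
    case sup
    have "nrm x \<le> nrm y / \<delta>"
      unfolding nrm_sup[OF sup, of x]
    proof (rule cSUP_least)
      fix i
      obtain W where W: "W = U \<or> W = - U" "i \<in> W" by blast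
      have "\<delta> * norm (x i) = \<delta> * norm (restr W x i)"
        using W by (simp add: restr_def)
      also have "\<dots> \<le> \<delta> * nrm (restr W x)"
        using \<delta> by (intro mult_left_mono nrm_coord restr_in_E x)
      also have "\<dots> \<le> nrm (restr W y)" using W U V by auto
      also have "\<dots> \<le> nrm y" by (rule nrm_restr[OF y])
      finally show "norm (x i) \<le> nrm y / \<delta>" using pos by (simp add: field_simps)
    qed simp
    then show ?thesis using pos by (simp add: field_simps)
  next
    case (pow q)
    have split: "nrm z powr q = nrm (restr U z) powr q + nrm (restr (- U) z) powr q"
      if z: "z \<in> E" for z :: "'i \<Rightarrow> 'a"
    proof -
      have "nrm z powr q = (\<Sum>\<^sub>\<infinity>i. norm (restr U z i) powr q + norm (restr (- U) z i) powr q)"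
        unfolding nrm_powr[OF pow] by (rule infsum_cong) (simp add: restr_def)
      also have "\<dots> = nrm (restr U z) powr q + nrm (restr (- U) z) powr q"
        unfolding nrm_powr[OF pow] using restr_in_E[OF z] pow(2) by (intro infsum_add) (auto simp: E_pow[OF pow])
      finally show ?thesis .
    qed
    have "(\<delta> * nrm x) powr q = (\<delta> * nrm (restr U x)) powr q + (\<delta> * nrm (restr (- U) x)) powr q"
      using \<delta> nrm_nonneg[OF x] restr_in_E[OF x] nrm_nonneg
      by (simp add: powr_mult split[OF x] algebra_simps)
    also have "\<dots> \<le> nrm (restr U y) powr q + nrm (restr (- U) y) powr q"
      using U V pow(2) \<delta> restr_in_E[OF x] nrm_nonneg by (intro add_mono powr_mono2 mult_nonneg_nonneg) auto
    also have "\<dots> = nrm y powr q" by (rule split[OF y, symmetric])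
    finally have "(\<delta> * nrm x) powr q \<le> nrm y powr q" .
    then show ?thesis
      using pow(2) nrm_nonneg[OF y] powr_less_mono2[of q "nrm y" "\<delta> * nrm x"]
      by (force simp: not_le[symmetric])
  qed
qed

end

section \<open>Bounded operators on subspaces\<close>

context lp_exponent
begin

text \<open>The carriers of operators are the whole sequence space and the images of the projections; their
  common properties allow one treatment of norms and inverses.\<close>

definition seq_subspace :: "('n::finite, 'a::complex_banach) seqs set \<Rightarrow> bool" where
  "seq_subspace F \<longleftrightarrow> F \<subseteq> E \<and> (\<lambda>_. 0) \<in> F \<and> (\<forall>x\<in>F. \<forall>y\<in>F. (\<lambda>i. x i + y i) \<in> F) \<and>
     (\<forall>a. \<forall>x\<in>F. (\<lambda>i. a *\<^sub>C x i) \<in> F)"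

lemma scaleC_in_E:
  fixes x :: "'i \<Rightarrow> 'a::complex_banach"
  assumes "x \<in> E"
  shows "(\<lambda>i. a *\<^sub>C x i) \<in> E"
proof -
  have *: "norm (a *\<^sub>C x i) = norm (cmod a *\<^sub>R x i)" for i
    by (simp add: norm_scaleC)
  show ?thesis
    using dominated_in_E[OF scaleR_in_E[OF assms, of "cmod a"], of "\<lambda>i. a *\<^sub>C x i"] * by simp
qed

lemma seq_subspace_E: "seq_subspace E"
  unfolding seq_subspace_def using zero_in_E add_in_E scaleC_in_E by blast

lemma seq_subspaceD:
  assumes "seq_subspace F"
  shows "F \<subseteq> E" "(\<lambda>_. 0) \<in> F" "x \<in> F \<Longrightarrow> y \<in> F \<Longrightarrow> (\<lambda>i. x i + y i) \<in> F"
    "x \<in> F \<Longrightarrow> (\<lambda>i. a *\<^sub>C x i) \<in> F"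
  using assms unfolding seq_subspace_def by auto

lemma seq_subspace_scaleR:
  assumes "seq_subspace F" "x \<in> F"
  shows "(\<lambda>i. r *\<^sub>R x i) \<in> F"
  using seq_subspaceD(4)[OF assms, of "complex_of_real r"] by (simp add: scaleC_of_real)

lemma seq_subspace_diff:
  assumes "seq_subspace F" "x \<in> F" "y \<in> F"
  shows "(\<lambda>i. x i - y i) \<in> F"
  using seq_subspaceD(3)[OF assms(1,2) seq_subspace_scaleR[OF assms(1,3), of "-1"]] by simp

lemma bounded_opsD:
  assumes "T \<in> bounded_ops p F"
  shows "x \<in> F \<Longrightarrow> T x \<in> F"
    "x \<in> F \<Longrightarrow> y \<in> F \<Longrightarrow> T (\<lambda>i. x i + y i) = (\<lambda>i. T x i + T y i)"
    "x \<in> F \<Longrightarrow> T (\<lambda>i. a *\<^sub>C x i) = (\<lambda>i. a *\<^sub>C T x i)"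
  using assms unfolding bounded_ops_def by auto

lemma bounded_ops_scaleR:
  assumes "T \<in> bounded_ops p F" "x \<in> F"
  shows "T (\<lambda>i. r *\<^sub>R x i) = (\<lambda>i. r *\<^sub>R T x i)"
  using bounded_opsD(3)[OF assms, of "complex_of_real r"] by (simp add: scaleC_of_real)

lemma bounded_ops_diff:
  assumes "seq_subspace F" "T \<in> bounded_ops p F" "x \<in> F" "y \<in> F"
  shows "T (\<lambda>i. x i - y i) = (\<lambda>i. T x i - T y i)"
  using bounded_opsD(2)[OF assms(2,3) seq_subspace_scaleR[OF assms(1,4), of "-1"]]
    bounded_ops_scaleR[OF assms(2,4), of "-1"] by simp

lemma bounded_ops_zero:
  assumes "seq_subspace F" "T \<in> bounded_ops p F"
  shows "T (\<lambda>_. 0) = (\<lambda>_. 0)"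
  using bounded_ops_scaleR[OF assms(2) seq_subspaceD(2)[OF assms(1)], of 0] by simp

lemma bounded_ops_bound:
  assumes "seq_subspace F" "T \<in> bounded_ops p F"
  obtains C where "0 \<le> C" "\<And>x. x \<in> F \<Longrightarrow> nrm (T x) \<le> C * nrm x"
proof -
  obtain C where C: "\<And>x. x \<in> F \<Longrightarrow> nrm (T x) \<le> C * nrm x"
    using assms(2) unfolding bounded_ops_def by blast
  have "nrm (T x) \<le> max 0 C * nrm x" if "x \<in> F" for x
    using C[OF that] mult_right_mono[of C "max 0 C" "nrm x"] nrm_nonneg[of x] that seq_subspaceD(1)[OF assms(1)]
    by (auto intro: order_trans)
  then show ?thesis using that[of "max 0 C"] by simp
qed

lemma bounded_opsI:
  assumes "\<And>x. x \<in> F \<Longrightarrow> T x \<in> F"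
    "\<And>x y. x \<in> F \<Longrightarrow> y \<in> F \<Longrightarrow> T (\<lambda>i. x i + y i) = (\<lambda>i. T x i + T y i)"
    "\<And>a x. x \<in> F \<Longrightarrow> T (\<lambda>i. a *\<^sub>C x i) = (\<lambda>i. a *\<^sub>C T x i)"
    "\<And>x. x \<in> F \<Longrightarrow> nrm (T x) \<le> C * nrm x"
  shows "T \<in> bounded_ops p F"
  using assms unfolding bounded_ops_def by blast

text \<open>A supremum of a set of reals means something only if the set is bounded; this is where the
  boundedness of the operator enters.\<close>

lemma op_norm_bound:
  assumes F: "seq_subspace F" and T: "T \<in> bounded_ops p F" and x: "x \<in> F"
  shows "nrm (T x) \<le> op_norm p F T * nrm x"
proof (cases "nrm x = 0")
  case True
  then have "x = (\<lambda>_. 0)"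
    using nrm_eq_0_imp[of x] x seq_subspaceD(1)[OF F] by auto
  then show ?thesis
    using bounded_ops_zero[OF F T] by (simp add: nrm_zero)
next
  case False
  have xE: "x \<in> E" using x seq_subspaceD(1)[OF F] by auto
  with False have pos: "0 < nrm x" using nrm_nonneg[OF xE] by simp
  obtain C where C: "0 \<le> C" "\<And>y. y \<in> F \<Longrightarrow> nrm (T y) \<le> C * nrm y"
    using bounded_ops_bound[OF F T] by blast
  have "nrm (T y) \<le> C" if "y \<in> F" "nrm y \<le> 1" for y
    using C(2)[OF that(1)] mult_left_mono[OF that(2) C(1)] by simp
  then have bdd: "bdd_above ((\<lambda>y. nrm (T y)) ` {y \<in> F. nrm y \<le> 1})"
    by (auto intro!: bdd_aboveI)
  let ?y = "\<lambda>i. (1 / nrm x) *\<^sub>R x i"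
  have y: "?y \<in> F" by (rule seq_subspace_scaleR[OF F x])
  have ny: "nrm ?y = 1"
    using nrm_scaleR[OF xE, of "1 / nrm x"] pos by simp
  have TxE: "T x \<in> E"
    using bounded_opsD(1)[OF T x] seq_subspaceD(1)[OF F] by auto
  have "nrm (T x) / nrm x = nrm (T ?y)"
    using bounded_ops_scaleR[OF T x, of "1 / nrm x"] nrm_scaleR[OF TxE, of "1 / nrm x"] pos by simp
  also have "\<dots> \<le> op_norm p F T"
    unfolding op_norm_def by (rule cSUP_upper[OF _ bdd]) (use y ny in simp)
  finally show ?thesis using pos by (simp add: field_simps)
qed

lemma op_norm_le:
  assumes "seq_subspace F" "0 \<le> C" "\<And>x. x \<in> F \<Longrightarrow> nrm (T x) \<le> C * nrm x"
  shows "op_norm p F T \<le> C"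
  unfolding op_norm_def
proof (rule cSUP_least)
  show "{x \<in> F. nrm x \<le> 1} \<noteq> {}"
    using seq_subspaceD(2)[OF assms(1)] by (auto simp: nrm_zero intro!: exI[of _ "\<lambda>_. 0"])
next
  fix x assume "x \<in> {x \<in> F. nrm x \<le> 1}"
  then show "nrm (T x) \<le> C"
    using assms(3)[of x] mult_left_mono[of "nrm x" 1 C] assms(2) by simp
qed

lemma op_norm_nonneg:
  assumes F: "seq_subspace F" and T: "T \<in> bounded_ops p F"
  shows "0 \<le> op_norm p F T"
proof -
  obtain C where C: "0 \<le> C" "\<And>y. y \<in> F \<Longrightarrow> nrm (T y) \<le> C * nrm y"
    using bounded_ops_bound[OF F T] by blast
  have "nrm (T y) \<le> C" if "y \<in> F" "nrm y \<le> 1" for y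
    using C(2)[OF that(1)] mult_left_mono[OF that(2) C(1)] by simp
  then have bdd: "bdd_above ((\<lambda>y. nrm (T y)) ` {y \<in> F. nrm y \<le> 1})"
    by (auto intro!: bdd_aboveI)
  have "nrm (T (\<lambda>_. 0)) \<le> op_norm p F T"
    unfolding op_norm_def by (rule cSUP_upper[OF _ bdd]) (simp add: seq_subspaceD(2)[OF F] nrm_zero)
  then show ?thesis by (simp add: bounded_ops_zero[OF F T] nrm_zero)
qed

lemma op_norm_approx:
  assumes F: "seq_subspace F" and r: "r < op_norm p F T"
  obtains x where "x \<in> F" "nrm x \<le> 1" "r < nrm (T x)"
proof -
  have ne: "{x \<in> F. nrm x \<le> 1} \<noteq> {}"
    using seq_subspaceD(2)[OF F] by (auto simp: nrm_zero intro!: exI[of _ "\<lambda>_. 0"])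
  have "\<exists>x\<in>{x \<in> F. nrm x \<le> 1}. r < nrm (T x)"
  proof (rule ccontr)
    assume "\<not> ?thesis"
    then have "op_norm p F T \<le> r"
      unfolding op_norm_def by (intro cSUP_least[OF ne]) (auto simp: not_less)
    then show False using r by simp
  qed
  then show ?thesis using that by auto
qed

lemma compose_bounded:
  assumes "seq_subspace F" "S \<in> bounded_ops p F" "T \<in> bounded_ops p F"
  shows "S \<circ> T \<in> bounded_ops p F"
proof -
  obtain C where C: "0 \<le> C" "\<And>x. x \<in> F \<Longrightarrow> nrm (S x) \<le> C * nrm x"
    using bounded_ops_bound[OF assms(1,2)] by blast
  obtain D where D: "0 \<le> D" "\<And>x. x \<in> F \<Longrightarrow> nrm (T x) \<le> D * nrm x"
    using bounded_ops_bound[OF assms(1,3)] by blast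
  have "nrm (S (T x)) \<le> (C * D) * nrm x" if "x \<in> F" for x
    using C(2)[OF bounded_opsD(1)[OF assms(3) that]] mult_left_mono[OF D(2)[OF that] C(1)] by simp
  then show ?thesis
    using bounded_opsD[OF assms(2)] bounded_opsD[OF assms(3)] by (intro bounded_opsI) auto
qed

lemma op_diff_bounded:
  assumes S: "S \<in> bounded_ops p E" and T: "T \<in> bounded_ops p E"
  shows "op_diff S T \<in> bounded_ops p E"
proof -
  obtain C where C: "0 \<le> C" "\<And>x. x \<in> E \<Longrightarrow> nrm (S x) \<le> C * nrm x"
    using bounded_ops_bound[OF seq_subspace_E S] by blast
  obtain D where D: "0 \<le> D" "\<And>x. x \<in> E \<Longrightarrow> nrm (T x) \<le> D * nrm x"
    using bounded_ops_bound[OF seq_subspace_E T] by blast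
  have neg: "a *\<^sub>C v - a *\<^sub>C w = a *\<^sub>C (v - w)" for a and v w :: 'b
    using scaleC_add_right[of a "v - w" w] by (simp add: algebra_simps)
  show ?thesis
  proof (rule bounded_opsI)
    show "op_diff S T x \<in> E" if "x \<in> E" for x
      unfolding op_diff_def using that by (intro diff_in_E bounded_opsD(1)[OF S] bounded_opsD(1)[OF T])
    show "nrm (op_diff S T x) \<le> (C + D) * nrm x" if "x \<in> E" for x
      unfolding op_diff_def
      using nrm_diff[OF bounded_opsD(1)[OF S that] bounded_opsD(1)[OF T that]] C(2)[OF that] D(2)[OF that]
      by (simp add: algebra_simps)
    show "op_diff S T (\<lambda>i. x i + y i) = (\<lambda>i. op_diff S T x i + op_diff S T y i)"
      if "x \<in> E" "y \<in> E" for x y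
      unfolding op_diff_def using that bounded_opsD(2)[OF S] bounded_opsD(2)[OF T] by (simp add: algebra_simps)
    show "op_diff S T (\<lambda>i. a *\<^sub>C x i) = (\<lambda>i. a *\<^sub>C op_diff S T x i)" if "x \<in> E" for a x
      unfolding op_diff_def using that bounded_opsD(3)[OF S] bounded_opsD(3)[OF T] by (simp add: neg)
  qed
qed

lemma invertible_op_by_lower_bound:
  assumes F: "seq_subspace F" and T: "T \<in> bounded_ops p F" and \<delta>: "0 < \<delta>"
    and lower: "\<And>x. x \<in> F \<Longrightarrow> \<delta> * nrm x \<le> nrm (T x)"
    and surj: "\<And>y. y \<in> F \<Longrightarrow> \<exists>x\<in>F. T x = y"
  shows "invertible_op p F T" and "inv_norm p F T \<le> 1 / \<delta>"
proof -
  have inj: "inj_on T F"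
  proof (rule inj_onI)
    fix x y assume xy: "x \<in> F" "y \<in> F" "T x = T y"
    let ?d = "\<lambda>i. x i - y i"
    have d: "?d \<in> F" by (rule seq_subspace_diff[OF F xy(1,2)])
    have "\<delta> * nrm ?d \<le> 0"
      using lower[OF d] bounded_ops_diff[OF F T xy(1,2)] xy(3) by (simp add: nrm_zero)
    then have "nrm ?d \<le> 0" using \<delta> by (simp add: mult_le_0_iff)
    then have "?d = (\<lambda>_. 0)"
      using nrm_eq_0_imp[of ?d] d seq_subspaceD(1)[OF F] by blast
    then show "x = y" by (metis eq_iff_diff_eq_0 ext)
  qed
  define R where "R = inv_into F T"
  have img: "T ` F = F" using surj bounded_opsD(1)[OF T] by force
  have RF: "R y \<in> F" and TR: "T (R y) = y" if "y \<in> F" for y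
    using inv_into_into[of y T F] f_inv_into_f[of y T F] that unfolding R_def img by auto
  have RT: "R (T x) = x" if "x \<in> F" for x
    unfolding R_def by (rule inv_into_f_f[OF inj that])
  have bound: "nrm (R y) \<le> 1 / \<delta> * nrm y" if "y \<in> F" for y
    using lower[OF RF[OF that]] TR[OF that] \<delta> by (simp add: field_simps)
  have "R \<in> bounded_ops p F"
  proof (rule bounded_opsI[OF RF _ _ bound])
    show "R (\<lambda>i. x i + y i) = (\<lambda>i. R x i + R y i)" if "x \<in> F" "y \<in> F" for x y
      using RT[OF seq_subspaceD(3)[OF F RF[OF that(1)] RF[OF that(2)]]]
        bounded_opsD(2)[OF T RF[OF that(1)] RF[OF that(2)]] TR that by simp
    show "R (\<lambda>i. a *\<^sub>C x i) = (\<lambda>i. a *\<^sub>C R x i)" if "x \<in> F" for a x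
      using RT[OF seq_subspaceD(4)[OF F RF[OF that]]] bounded_opsD(3)[OF T RF[OF that]] TR that by simp
  qed auto
  then show "invertible_op p F T"
    unfolding invertible_op_def using T RT TR by blast
  show "inv_norm p F T \<le> 1 / \<delta>"
    unfolding inv_norm_def R_def[symmetric] using \<delta> by (intro op_norm_le[OF F] bound) auto
qed

lemma invertible_op_inverse:
  assumes F: "seq_subspace F" and inv: "invertible_op p F T"
  shows "inv_into F T \<in> bounded_ops p F"
    and "x \<in> F \<Longrightarrow> inv_into F T (T x) = x" and "x \<in> F \<Longrightarrow> T (inv_into F T x) = x"
    and "x \<in> F \<Longrightarrow> inv_into F T x \<in> F"
proof -
  obtain R where T: "T \<in> bounded_ops p F" and R: "R \<in> bounded_ops p F"
    and RT: "\<And>x. x \<in> F \<Longrightarrow> R (T x) = x" and TR: "\<And>x. x \<in> F \<Longrightarrow> T (R x) = x"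
    using inv unfolding invertible_op_def by blast
  have inj: "inj_on T F" using RT by (metis inj_onI)
  have eq: "inv_into F T x = R x" if "x \<in> F" for x
    using inv_into_f_f[OF inj bounded_opsD(1)[OF R that]] TR[OF that] by simp
  show *: "inv_into F T x \<in> F" if "x \<in> F" for x
    using eq[OF that] bounded_opsD(1)[OF R that] by simp
  show "x \<in> F \<Longrightarrow> inv_into F T (T x) = x"
    by (rule inv_into_f_f[OF inj])
  show "x \<in> F \<Longrightarrow> T (inv_into F T x) = x"
    using eq TR by simp
  show "inv_into F T \<in> bounded_ops p F"
  proof -
    obtain C where C: "\<forall>x\<in>F. nrm (R x) \<le> C * nrm x"
      using R unfolding bounded_ops_def by blast
    let ?S = "inv_into F T"
    show ?thesis
    proof (rule bounded_opsI[OF *])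
      show "?S (\<lambda>i. x i + y i) = (\<lambda>i. ?S x i + ?S y i)" if "x \<in> F" "y \<in> F" for x y
        using bounded_opsD(2)[OF R that] eq[OF that(1)] eq[OF that(2)] eq[OF seq_subspaceD(3)[OF F that]] by simp
      show "?S (\<lambda>i. a *\<^sub>C x i) = (\<lambda>i. a *\<^sub>C ?S x i)" if "x \<in> F" for a x
        using bounded_opsD(3)[OF R that] eq[OF that] eq[OF seq_subspaceD(4)[OF F that]] by simp
      show "nrm (?S x) \<le> C * nrm x" if "x \<in> F" for x
        using C eq that by simp
    qed
  qed
qed

lemma inv_norm_lower_bound:
  assumes "seq_subspace F" "invertible_op p F T" "x \<in> F"
  shows "nrm x \<le> inv_norm p F T * nrm (T x)"
proof -
  have "T x \<in> F"
    using assms(2,3) bounded_opsD(1) unfolding invertible_op_def by blast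
  then have "nrm (inv_into F T (T x)) \<le> inv_norm p F T * nrm (T x)"
    unfolding inv_norm_def by (rule op_norm_bound[OF assms(1) invertible_op_inverse(1)[OF assms(1,2)]])
  then show ?thesis using invertible_op_inverse(2)[OF assms] by simp
qed

end

section \<open>Cubes and exponential weights\<close>

lemma cube_iff: "i \<in> cube r \<longleftrightarrow> (\<forall>j. \<bar>i $ j\<bar> \<le> int r)"
  by (auto simp: cube_def abs_le_iff minus_le_iff)

lemma cube_add: "i \<in> cube a \<Longrightarrow> k \<in> cube b \<Longrightarrow> i + k \<in> cube (a + b)"
  unfolding cube_iff by (auto intro: order_trans[OF abs_triangle_ineq] add_mono)

lemma cube_uminus: "- i \<in> cube r \<longleftrightarrow> i \<in> cube r"
  by (simp add: cube_iff)

lemma cube_diff: "i \<in> cube a \<Longrightarrow> k \<in> cube b \<Longrightarrow> i - k \<in> cube (a + b)"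
  using cube_add[of i a "- k" b] by (simp add: cube_uminus)

lemma cube_mono: "a \<le> b \<Longrightarrow> i \<in> cube a \<Longrightarrow> i \<in> cube b"
  unfolding cube_iff by (meson of_nat_mono order_trans)

lemma zero_in_cube: "0 \<in> cube r"
  by (simp add: cube_iff)

lemma finite_cube: "finite (cube r :: (int ^ 'n::finite) set)"
proof -
  have "cube r \<subseteq> vec_lambda ` (PiE (UNIV :: 'n set) (\<lambda>_. {- int r..int r}))"
  proof
    fix k :: "int ^ 'n" assume "k \<in> cube r"
    then have "vec_nth k \<in> PiE UNIV (\<lambda>_. {- int r..int r})"
      by (auto simp: cube_def PiE_def minus_le_iff)
    then show "k \<in> vec_lambda ` (PiE UNIV (\<lambda>_. {- int r..int r}))"
      by (metis image_eqI vec_nth_inverse)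
  qed
  then show ?thesis
    by (rule finite_subset) (intro finite_imageI finite_PiE, auto)
qed

lemma cube_iff_sup_abs: "i \<in> cube r \<longleftrightarrow> sup_abs i \<le> int r"
  unfolding cube_iff sup_abs_def by (subst Max_le_iff) auto

lemma sup_abs_nonneg: "0 \<le> sup_abs i"
proof -
  have "\<bar>i $ undefined\<bar> \<le> sup_abs i"
    unfolding sup_abs_def by (rule Max_ge) auto
  then show ?thesis using abs_ge_zero order_trans by blast
qed

lemma in_cube_sup_abs: "i \<in> cube (nat (sup_abs i))"
  using sup_abs_nonneg[of i] by (simp add: cube_iff_sup_abs)

lemma finite_subset_cube:
  fixes F :: "(int ^ 'n::finite) set"
  assumes "finite F"
  obtains r where "F \<subseteq> cube r"
  using assms
proof (induction F arbitrary: thesis rule: finite_induct)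
  case empty
  then show ?case by simp
next
  case (insert i F)
  obtain r where "F \<subseteq> cube r" using insert.IH by blast
  then have "insert i F \<subseteq> cube (max r (nat (sup_abs i)))"
    using in_cube_sup_abs[of i] cube_mono[of r "max r (nat (sup_abs i))"]
      cube_mono[of "nat (sup_abs i)" "max r (nat (sup_abs i))"] by auto
  then show ?case by (rule insert.prems)
qed

definition ell1 :: "int ^ 'n::finite \<Rightarrow> real" where
  "ell1 k = (\<Sum>j\<in>UNIV. real_of_int \<bar>k $ j\<bar>)"

lemma ell1_nonneg: "0 \<le> ell1 k"
  by (simp add: ell1_def sum_nonneg)

lemma ell1_zero: "ell1 0 = 0"
  by (simp add: ell1_def)

lemma ell1_triangle: "ell1 (a + b) \<le> ell1 a + ell1 b"
  unfolding ell1_def sum.distrib[symmetric]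
  by (rule sum_mono) (simp add: abs_triangle_ineq)

lemma ell1_uminus: "ell1 (- a) = ell1 a"
  by (simp add: ell1_def)

lemma ell1_outside_cube:
  assumes "i \<notin> cube r"
  shows "real r \<le> ell1 i"
proof -
  obtain j where "int r < \<bar>i $ j\<bar>" using assms by (auto simp: cube_iff not_le)
  then have "real r \<le> real_of_int \<bar>i $ j\<bar>" by linarith
  also have "\<dots> \<le> ell1 i"
    unfolding ell1_def by (rule member_le_sum) auto
  finally show ?thesis .
qed

text \<open>The sum norm on the index group makes the weight a product of weights in one variable each,
  which reduces its summability to geometric series.\<close>

definition weight :: "real \<Rightarrow> int ^ 'n::finite \<Rightarrow> int ^ 'n \<Rightarrow> real" where
  "weight t j i = exp (- ell1 (i - j) / t)"

definition wmul :: "real \<Rightarrow> int ^ 'n::finite \<Rightarrow> (int ^ 'n \<Rightarrow> 'a::real_normed_vector) \<Rightarrow> int ^ 'n \<Rightarrow> 'a"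
  where "wmul t j x = (\<lambda>i. weight t j i *\<^sub>R x i)"

lemma weight_pos: "0 < weight t j i"
  by (simp add: weight_def)

lemma weight_le_1: "0 < t \<Longrightarrow> weight t j i \<le> 1"
  by (simp add: weight_def ell1_nonneg)

lemma weight_self: "weight t j j = 1"
  by (simp add: weight_def ell1_zero)

lemma weight_outside_cube:
  assumes "0 < t" "i - j \<notin> cube r"
  shows "weight t j i \<le> exp (- real r / t)"
  unfolding weight_def using assms ell1_outside_cube[OF assms(2)] by (simp add: divide_right_mono)

text \<open>The logarithm of the weight is Lipschitz with constant \<open>1/t\<close>, so the weight varies
  slowly relative to its own size.\<close>

lemma weight_variation:
  assumes t: "0 < t"
  shows "\<bar>weight t j (i - \<alpha>) - weight t j i\<bar> \<le> (exp (ell1 \<alpha> / t) - 1) * weight t j (i - \<alpha>)"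
proof -
  define a b e where "a = weight t j (i - \<alpha>)" and "b = weight t j i" and "e = exp (ell1 \<alpha> / t)"
  have pos: "0 < a" "0 < b" "1 \<le> e"
    using t ell1_nonneg[of \<alpha>] by (auto simp: a_def b_def e_def weight_pos)
  have "ell1 (i - \<alpha> - j) \<le> ell1 (i - j) + ell1 \<alpha>"
    using ell1_triangle[of "i - j" "- \<alpha>"] by (simp add: ell1_uminus algebra_simps)
  then have "- ell1 (i - j) / t \<le> - ell1 (i - \<alpha> - j) / t + ell1 \<alpha> / t"
    using t by (simp add: field_simps)
  then have ba: "b \<le> a * e"
    by (simp add: a_def b_def e_def weight_def exp_add[symmetric])
  have "ell1 (i - j) \<le> ell1 (i - \<alpha> - j) + ell1 \<alpha>"
    using ell1_triangle[of "i - \<alpha> - j" \<alpha>] by (simp add: algebra_simps)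
  then have "- ell1 (i - \<alpha> - j) / t \<le> - ell1 (i - j) / t + ell1 \<alpha> / t"
    using t by (simp add: field_simps)
  then have "a \<le> b * e"
    by (simp add: a_def b_def e_def weight_def exp_add[symmetric])
  then have "a * (2 - e) \<le> b"
  proof (cases "e \<le> 2")
    case True
    have "a * (2 - e) \<le> b * (e * (2 - e))"
      using mult_right_mono[OF \<open>a \<le> b * e\<close>, of "2 - e"] True by (simp add: mult.assoc)
    also have "\<dots> \<le> b * 1"
    proof (rule mult_left_mono)
      have "0 \<le> (e - 1)\<^sup>2" by simp
      then show "e * (2 - e) \<le> 1" by (simp add: power2_eq_square algebra_simps)
    qed (use pos in simp)
    finally show ?thesis by simp
  next
    case False
    then have "a * (2 - e) \<le> 0" using pos by (intro mult_nonneg_nonpos) auto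
    then show ?thesis using pos by simp
  qed
  then have "\<bar>a - b\<bar> \<le> (e - 1) * a"
    using ba by (simp add: abs_le_iff algebra_simps)
  then show ?thesis by (simp add: a_def b_def e_def)
qed

context lp_exponent
begin

lemma wmul_closed:
  assumes "0 < t" "x \<in> E"
  shows wmul_in_E: "wmul t j x \<in> E" and nrm_wmul: "nrm (wmul t j x) \<le> nrm x"
  using assms weight_le_1[OF assms(1)] weight_pos[of t j]
  by (auto intro!: dominated[of x] mult_left_le_one_le simp: wmul_def less_imp_le)

text \<open>On a bounded set the weight tends to 1 as \<open>t\<close> grows, so weighting loses arbitrarily little of the
  norm of a fixed finite part.\<close>

lemma nrm_le_wmul:
  assumes t: "0 < t" and x: "x \<in> E" and M: "\<And>i. x i \<noteq> 0 \<Longrightarrow> ell1 (i - j) \<le> M"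
  shows "nrm x \<le> exp (M / t) * nrm (wmul t j x)"
proof -
  have w: "wmul t j x \<in> E" by (rule wmul_in_E[OF t x])
  have "nrm x \<le> nrm (\<lambda>i. exp (M / t) *\<^sub>R wmul t j x i)"
  proof (rule dominated_nrm[OF scaleR_in_E[OF w]])
    fix i
    show "norm (x i) \<le> norm (exp (M / t) *\<^sub>R wmul t j x i)"
    proof (cases "x i = 0")
      case False
      then have "1 \<le> exp (M / t) * weight t j i"
        using M[of i] t by (simp add: weight_def exp_add[symmetric] diff_divide_distrib[symmetric])
      then have "1 * norm (x i) \<le> (exp (M / t) * weight t j i) * norm (x i)"
        by (rule mult_right_mono) simp
      then show ?thesis by (simp add: wmul_def weight_pos less_imp_le abs_of_nonneg mult.assoc)
    qed simp
  qed
  then show ?thesis using nrm_scaleR[OF w, of "exp (M / t)"] by simp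
qed

lemma nrm_coord_wmul:
  assumes "0 < t" "x \<in> E"
  shows "norm (x j) \<le> nrm (wmul t j x)"
  using nrm_coord[OF wmul_in_E[OF assms, of j], of j] by (simp add: wmul_def weight_self)

lemma nrm_wmul_tail:
  assumes t: "0 < t" and x: "x \<in> E" and "\<And>i. i - j \<in> cube r \<Longrightarrow> x i = 0"
  shows "nrm (wmul t j x) \<le> exp (- real r / t) * nrm x"
proof -
  have "nrm (wmul t j x) \<le> nrm (\<lambda>i. exp (- real r / t) *\<^sub>R x i)"
  proof (rule dominated_nrm[OF scaleR_in_E[OF x]])
    fix i
    show "norm (wmul t j x i) \<le> norm (exp (- real r / t) *\<^sub>R x i)"
    proof (cases "i - j \<in> cube r")
      case False
      then show ?thesis
        using weight_outside_cube[OF t False] weight_pos[of t j i]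
        by (auto simp: wmul_def intro!: mult_right_mono)
    qed (use assms(3) in \<open>simp add: wmul_def\<close>)
  qed
  then show ?thesis using nrm_scaleR[OF x, of "exp (- real r / t)"] by simp
qed

lemma shift_closed:
  shows shift_in_E: "shift h x \<in> E \<longleftrightarrow> x \<in> E" and nrm_shift: "nrm (shift h x) = nrm x"
proof -
  have "bij (\<lambda>i. i - h)"
    by (rule bij_betw_byWitness[where f' = "\<lambda>i. i + h"]) auto
  then show "shift h x \<in> E \<longleftrightarrow> x \<in> E" "nrm (shift h x) = nrm x"
    unfolding shift_def by (rule reindex_closed)+
qed

end

section \<open>Band and band-dominated operators\<close>

context lp_exponent
begin

text \<open>All estimates for band operators reduce to this one, because the norm is invariant under shifts
  and monotone.\<close>

lemma dominated_by_shifts: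
  fixes x :: "int ^ 'n::finite \<Rightarrow> 'a::complex_banach" and z :: "int ^ 'n \<Rightarrow> 'b::real_normed_vector"
  assumes F: "finite F" and x: "x \<in> E" and \<kappa>: "\<And>\<alpha>. \<alpha> \<in> F \<Longrightarrow> 0 \<le> \<kappa> \<alpha>"
    and z: "\<And>i. norm (z i) \<le> (\<Sum>\<alpha>\<in>F. \<kappa> \<alpha> * norm (x (i - \<alpha>)))"
  shows "z \<in> E" and "nrm z \<le> (\<Sum>\<alpha>\<in>F. \<kappa> \<alpha>) * nrm x"
proof -
  have sh: "(\<lambda>i. norm (x (i - \<alpha>))) \<in> E \<and> nrm (\<lambda>i. norm (x (i - \<alpha>))) \<le> nrm x" for \<alpha>
    using dominated[of "shift \<alpha> x" "\<lambda>i. norm (x (i - \<alpha>))"] x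
    by (simp add: shift_in_E nrm_shift) (simp add: shift_def)
  have "(\<lambda>i. \<Sum>\<alpha>\<in>F. \<kappa> \<alpha> * norm (x (i - \<alpha>))) \<in> E \<and>
      nrm (\<lambda>i. \<Sum>\<alpha>\<in>F. \<kappa> \<alpha> * norm (x (i - \<alpha>))) \<le> (\<Sum>\<alpha>\<in>F. \<kappa> \<alpha>) * nrm x"
    using F \<kappa>
  proof (induction F rule: finite_induct)
    case empty
    then show ?case by (simp add: zero_in_E nrm_zero)
  next
    case (insert \<alpha> F)
    have 1: "(\<lambda>i. \<kappa> \<alpha> * norm (x (i - \<alpha>))) \<in> E" "nrm (\<lambda>i. \<kappa> \<alpha> * norm (x (i - \<alpha>))) \<le> \<kappa> \<alpha> * nrm x"
      using scaleR_closed[OF conjunct1[OF sh], of "\<kappa> \<alpha>" \<alpha>] insert.prems[of \<alpha>] conjunct2[OF sh, of \<alpha>]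
      by (auto intro: mult_left_mono)
    have 2: "(\<lambda>i. \<Sum>\<alpha>\<in>F. \<kappa> \<alpha> * norm (x (i - \<alpha>))) \<in> E"
      "nrm (\<lambda>i. \<Sum>\<alpha>\<in>F. \<kappa> \<alpha> * norm (x (i - \<alpha>))) \<le> (\<Sum>\<alpha>\<in>F. \<kappa> \<alpha>) * nrm x"
      using insert by auto
    show ?case
      using add_closed[OF 1(1) 2(1)] 1(2) 2(2) insert.hyps by (simp add: distrib_right)
  qed
  moreover have "norm (z i) \<le> norm (\<Sum>\<alpha>\<in>F. \<kappa> \<alpha> * norm (x (i - \<alpha>)))" for i
    using z[of i] by (simp add: abs_of_nonneg)
  ultimately show "z \<in> E" "nrm z \<le> (\<Sum>\<alpha>\<in>F. \<kappa> \<alpha>) * nrm x"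
    using dominated[of "\<lambda>i. \<Sum>\<alpha>\<in>F. \<kappa> \<alpha> * norm (x (i - \<alpha>))" z] by (auto intro: order_trans)
qed

lemma band_opsE:
  fixes B :: "('n::finite, 'a::complex_banach) seq_op"
  assumes "B \<in> band_ops"
  obtains F :: "(int ^ 'n) set" and a C
  where "finite F" "\<forall>x i. B x i = (\<Sum>\<alpha>\<in>F. blinfun_apply (a \<alpha> i) (x (i - \<alpha>)))"
    "\<forall>\<alpha>\<in>F. \<forall>i z v. blinfun_apply (a \<alpha> i) (z *\<^sub>C v) = z *\<^sub>C blinfun_apply (a \<alpha> i) v"
    "\<forall>\<alpha>\<in>F. \<forall>i v. norm (blinfun_apply (a \<alpha> i) v) \<le> C \<alpha> * norm v" "\<forall>\<alpha>. 0 \<le> C \<alpha>"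
proof -
  obtain F a where F: "finite F" "\<forall>\<alpha>\<in>F. band_coeff (a \<alpha>)"
    and B: "B = (\<lambda>x i. \<Sum>\<alpha>\<in>F. mult_op (a \<alpha>) (shift \<alpha> x) i)"
    using assms unfolding band_ops_def by blast
  have "\<exists>C\<ge>0. \<forall>i v. norm (blinfun_apply (a \<alpha> i) v) \<le> C * norm v" if "\<alpha> \<in> F" for \<alpha>
  proof -
    have "bounded (range (a \<alpha>))" using F(2) that by (simp add: band_coeff_def)
    then obtain C where "\<forall>i. norm (a \<alpha> i) \<le> C" by (auto simp: bounded_iff)
    then have "norm (blinfun_apply (a \<alpha> i) v) \<le> max 0 C * norm v" for i v
    proof -
      have "norm (a \<alpha> i) \<le> max 0 C" using \<open>\<forall>i. norm (a \<alpha> i) \<le> C\<close> by (simp add: le_max_iff_disj)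
      then have "norm (a \<alpha> i) * norm v \<le> max 0 C * norm v" by (rule mult_right_mono) simp
      then show ?thesis using norm_blinfun[of "a \<alpha> i" v] by simp
    qed
    then show ?thesis by (intro exI[of _ "max 0 C"]) auto
  qed
  then have "\<forall>\<alpha>. \<exists>C. 0 \<le> C \<and> (\<alpha> \<in> F \<longrightarrow> (\<forall>i v. norm (blinfun_apply (a \<alpha> i) v) \<le> C * norm v))"
    by (meson order_refl)
  then obtain C where "\<And>\<alpha>. 0 \<le> C \<alpha>" "\<And>\<alpha> i v. \<alpha> \<in> F \<Longrightarrow> norm (blinfun_apply (a \<alpha> i) v) \<le> C \<alpha> * norm v"
    by metis
  then show ?thesis
    using F B by (intro that[of F a C]) (auto simp: mult_op_def shift_def band_coeff_def)
qed

lemma band_op_bounded: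
  fixes B :: "('n::finite, 'a::complex_banach) seq_op"
  assumes "B \<in> band_ops"
  shows "B \<in> bounded_ops p E"
proof -
  obtain F :: "(int ^ 'n) set" and a C
    where F: "finite F" and B0: "\<forall>x i. B x i = (\<Sum>\<alpha>\<in>F. blinfun_apply (a \<alpha> i) (x (i - \<alpha>)))"
    and hom0: "\<forall>\<alpha>\<in>F. \<forall>i z v. blinfun_apply (a \<alpha> i) (z *\<^sub>C v) = z *\<^sub>C blinfun_apply (a \<alpha> i) v"
    and C0: "\<forall>\<alpha>\<in>F. \<forall>i v. norm (blinfun_apply (a \<alpha> i) v) \<le> C \<alpha> * norm v" "\<forall>\<alpha>. 0 \<le> C \<alpha>"
    by (rule band_opsE[OF assms])
  note B = B0[rule_format] and hom = hom0[rule_format] and C = C0[rule_format]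
  have bd: "norm (B x i) \<le> (\<Sum>\<alpha>\<in>F. C \<alpha> * norm (x (i - \<alpha>)))" for x i
    unfolding B by (rule order_trans[OF norm_sum sum_mono]) (rule C(1))
  have z0: "z *\<^sub>C (0::'a) = 0" for z
    using scaleC_add_right[of z "0::'a" 0] by simp
  show ?thesis
  proof (rule bounded_opsI)
    show "B x \<in> E" "nrm (B x) \<le> (\<Sum>\<alpha>\<in>F. C \<alpha>) * nrm x" if "x \<in> E" for x
      using dominated_by_shifts[OF F that C(2) bd] by auto
    show "B (\<lambda>i. x i + y i) = (\<lambda>i. B x i + B y i)" for x y
      by (rule ext) (simp add: B blinfun.add_right sum.distrib)
    show "B (\<lambda>i. z *\<^sub>C x i) = (\<lambda>i. z *\<^sub>C B x i)" for z x
    proof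
      fix i
      have "(\<Sum>\<alpha>\<in>G. z *\<^sub>C blinfun_apply (a \<alpha> i) (x (i - \<alpha>))) = z *\<^sub>C (\<Sum>\<alpha>\<in>G. blinfun_apply (a \<alpha> i) (x (i - \<alpha>)))"
        if "finite G" for G
        using that by induction (simp_all add: z0 scaleC_add_right)
      then show "B (\<lambda>i. z *\<^sub>C x i) i = z *\<^sub>C B x i"
        using F by (simp add: B hom)
    qed
  qed
qed

text \<open>Relative slow variation of the weights makes the commutator of a band operator with a
  weight small relative to the weighted sequence itself, for each centre separately
  and uniformly in the centre.\<close>

lemma band_op_weight_commutator:
  fixes B :: "('n::finite, 'a::complex_banach) seq_op"
  assumes "B \<in> band_ops" "0 < \<epsilon>"
  obtains t0 where "0 < t0"
    "\<And>t j x. t0 \<le> t \<Longrightarrow> x \<in> E \<Longrightarrow> nrm (\<lambda>i. B (wmul t j x) i - wmul t j (B x) i) \<le> \<epsilon> * nrm (wmul t j x)"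
proof -
  obtain F :: "(int ^ 'n) set" and a C
    where F: "finite F" and B0: "\<forall>x i. B x i = (\<Sum>\<alpha>\<in>F. blinfun_apply (a \<alpha> i) (x (i - \<alpha>)))"
    and hom0: "\<forall>\<alpha>\<in>F. \<forall>i z v. blinfun_apply (a \<alpha> i) (z *\<^sub>C v) = z *\<^sub>C blinfun_apply (a \<alpha> i) v"
    and C0: "\<forall>\<alpha>\<in>F. \<forall>i v. norm (blinfun_apply (a \<alpha> i) v) \<le> C \<alpha> * norm v" "\<forall>\<alpha>. 0 \<le> C \<alpha>"
    by (rule band_opsE[OF assms(1)])
  note B = B0[rule_format] and hom = hom0[rule_format] and C = C0[rule_format]
  have "((\<lambda>t. \<Sum>\<alpha>\<in>F. C \<alpha> * (exp (ell1 \<alpha> / t) - 1)) \<longlongrightarrow> (\<Sum>\<alpha>\<in>F. C \<alpha> * (exp 0 - 1))) at_top"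
    by (intro tendsto_intros real_tendsto_divide_at_top[OF tendsto_const] filterlim_ident)
  then have "\<forall>\<^sub>F t in at_top. (\<Sum>\<alpha>\<in>F. C \<alpha> * (exp (ell1 \<alpha> / t) - 1)) < \<epsilon>"
    by (rule order_tendstoD(2)) (use assms(2) in simp)
  then obtain t1 where t1: "\<And>t. t1 \<le> t \<Longrightarrow> (\<Sum>\<alpha>\<in>F. C \<alpha> * (exp (ell1 \<alpha> / t) - 1)) < \<epsilon>"
    by (auto simp: eventually_at_top_linorder)
  show ?thesis
  proof (rule that[of "max 1 t1"])
    fix t :: real and j :: "int ^ 'n" and x :: "('n, 'a) seqs"
    assume t: "max 1 t1 \<le> t" and x: "x \<in> E"
    have tpos: "0 < t" using t by simp
    let ?\<kappa> = "\<lambda>\<alpha>. C \<alpha> * (exp (ell1 \<alpha> / t) - 1)"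
    have \<kappa>: "0 \<le> ?\<kappa> \<alpha>" for \<alpha>
      using C(2)[of \<alpha>] ell1_nonneg[of \<alpha>] tpos by simp
    have "norm (B (wmul t j x) i - wmul t j (B x) i) \<le> (\<Sum>\<alpha>\<in>F. ?\<kappa> \<alpha> * norm (wmul t j x (i - \<alpha>)))" for i
    proof -
      have "B (wmul t j x) i - wmul t j (B x) i
          = (\<Sum>\<alpha>\<in>F. (weight t j (i - \<alpha>) - weight t j i) *\<^sub>R blinfun_apply (a \<alpha> i) (x (i - \<alpha>)))"
        by (simp add: B wmul_def blinfun.scaleR_right scaleR_sum_right sum_subtractf[symmetric] scaleR_left_diff_distrib)
      also have "norm \<dots> \<le> (\<Sum>\<alpha>\<in>F. ?\<kappa> \<alpha> * norm (wmul t j x (i - \<alpha>)))"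
      proof (rule order_trans[OF norm_sum sum_mono])
        fix \<alpha> assume \<alpha>: "\<alpha> \<in> F"
        have "norm ((weight t j (i - \<alpha>) - weight t j i) *\<^sub>R blinfun_apply (a \<alpha> i) (x (i - \<alpha>)))
            \<le> ((exp (ell1 \<alpha> / t) - 1) * weight t j (i - \<alpha>)) * (C \<alpha> * norm (x (i - \<alpha>)))"
          unfolding norm_scaleR
          using weight_variation[OF tpos, of j i \<alpha>] C(1)[OF \<alpha>, of i "x (i - \<alpha>)"]
            weight_pos[of t j "i - \<alpha>"] tpos ell1_nonneg[of \<alpha>]
          by (intro mult_mono) auto
        also have "\<dots> = ?\<kappa> \<alpha> * norm (wmul t j x (i - \<alpha>))"
          by (simp add: wmul_def weight_pos less_imp_le abs_of_nonneg)
        finally show "norm ((weight t j (i - \<alpha>) - weight t j i) *\<^sub>R blinfun_apply (a \<alpha> i) (x (i - \<alpha>)))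
            \<le> ?\<kappa> \<alpha> * norm (wmul t j x (i - \<alpha>))" .
      qed
      finally show ?thesis .
    qed
    then have "nrm (\<lambda>i. B (wmul t j x) i - wmul t j (B x) i) \<le> (\<Sum>\<alpha>\<in>F. ?\<kappa> \<alpha>) * nrm (wmul t j x)"
      by (rule dominated_by_shifts(2)[OF F wmul_in_E[OF tpos x] \<kappa>])
    also have "\<dots> \<le> \<epsilon> * nrm (wmul t j x)"
      using t1[of t] t nrm_nonneg[OF wmul_in_E[OF tpos x]] by (intro mult_right_mono) auto
    finally show "nrm (\<lambda>i. B (wmul t j x) i - wmul t j (B x) i) \<le> \<epsilon> * nrm (wmul t j x)" .
  qed simp
qed

lemma band_op_width:
  fixes B :: "('n::finite, 'a::complex_banach) seq_op"
  assumes "B \<in> band_ops"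
  obtains w where "\<And>x i. (\<And>k. i - k \<in> cube w \<Longrightarrow> x k = 0) \<Longrightarrow> B x i = 0"
proof -
  obtain F :: "(int ^ 'n) set" and a C
    where F: "finite F" and B0: "\<forall>x i. B x i = (\<Sum>\<alpha>\<in>F. blinfun_apply (a \<alpha> i) (x (i - \<alpha>)))"
    and hom0: "\<forall>\<alpha>\<in>F. \<forall>i z v. blinfun_apply (a \<alpha> i) (z *\<^sub>C v) = z *\<^sub>C blinfun_apply (a \<alpha> i) v"
    and C0: "\<forall>\<alpha>\<in>F. \<forall>i v. norm (blinfun_apply (a \<alpha> i) v) \<le> C \<alpha> * norm v" "\<forall>\<alpha>. 0 \<le> C \<alpha>"
    by (rule band_opsE[OF assms])
  note B = B0[rule_format] and hom = hom0[rule_format] and C = C0[rule_format]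
  obtain w where w: "F \<subseteq> cube w" using finite_subset_cube[OF F] by blast
  show ?thesis
  proof (rule that[of w])
    fix x :: "('n, 'a) seqs" and i :: "int ^ 'n" assume x: "\<And>k. i - k \<in> cube w \<Longrightarrow> x k = 0"
    have "x (i - \<alpha>) = 0" if "\<alpha> \<in> F" for \<alpha>
      using x[of "i - \<alpha>"] that w by auto
    then show "B x i = 0" by (simp add: B blinfun.zero_right)
  qed
qed

lemma band_dominated_approx:
  assumes "A \<in> band_dominated p" "0 < \<epsilon>"
  obtains B where "B \<in> band_ops" "B \<in> bounded_ops p E"
    "\<And>x. x \<in> E \<Longrightarrow> nrm (\<lambda>i. A x i - B x i) \<le> \<epsilon> * nrm x"
proof -
  obtain B where B: "B \<in> band_ops" "op_norm p E (op_diff A B) < \<epsilon>"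
    using assms unfolding band_dominated_def by blast
  have A: "A \<in> bounded_ops p E" using assms by (simp add: band_dominated_def)
  have Bb: "B \<in> bounded_ops p E" by (rule band_op_bounded[OF B(1)])
  have "nrm (\<lambda>i. A x i - B x i) \<le> \<epsilon> * nrm x" if x: "x \<in> E" for x
  proof -
    have "nrm (op_diff A B x) \<le> op_norm p E (op_diff A B) * nrm x"
      by (rule op_norm_bound[OF seq_subspace_E op_diff_bounded[OF A Bb] x])
    also have "\<dots> \<le> \<epsilon> * nrm x"
      using B(2) nrm_nonneg[OF x] by (intro mult_right_mono) auto
    finally show ?thesis by (simp add: op_diff_def)
  qed
  then show ?thesis using that B(1) Bb by blast
qed

lemma band_dominated_bounded: "A \<in> band_dominated p \<Longrightarrow> A \<in> bounded_ops p E"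
  by (simp add: band_dominated_def)

text \<open>Approximation by a band operator costs a term relative to the unweighted norm, so for band-dominated
  operators only the absolute commutator estimate remains. It is uniform in the centre.\<close>

lemma band_dominated_weight_commutator:
  fixes A :: "('n::finite, 'a::complex_banach) seq_op"
  assumes A: "A \<in> band_dominated p" and \<epsilon>: "0 < \<epsilon>"
  obtains t0 where "0 < t0"
    "\<And>t j x. t0 \<le> t \<Longrightarrow> x \<in> E \<Longrightarrow> nrm (\<lambda>i. A (wmul t j x) i - wmul t j (A x) i) \<le> \<epsilon> * nrm x"
proof -
  have e3: "0 < \<epsilon> / 3" using \<epsilon> by simp
  obtain B where B: "B \<in> band_ops" "B \<in> bounded_ops p E"
    and AB: "\<And>x. x \<in> E \<Longrightarrow> nrm (\<lambda>i. A x i - B x i) \<le> \<epsilon> / 3 * nrm x"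
    using band_dominated_approx[OF A e3] by blast
  obtain t0 where t0: "0 < t0" "\<And>t j x. t0 \<le> t \<Longrightarrow> x \<in> E \<Longrightarrow>
      nrm (\<lambda>i. B (wmul t j x) i - wmul t j (B x) i) \<le> \<epsilon> / 3 * nrm (wmul t j x)"
    using band_op_weight_commutator[OF B(1) e3] by blast
  show ?thesis
  proof (rule that[OF t0(1)])
    fix t :: real and j :: "int ^ 'n" and x :: "('n, 'a) seqs"
    assume t: "t0 \<le> t" and x: "x \<in> E"
    have tpos: "0 < t" using t t0(1) by simp
    note W = wmul_in_E[OF tpos] and AE = bounded_opsD(1)[OF band_dominated_bounded[OF A]]
      and BE = bounded_opsD(1)[OF B(2)]
    have Wx: "nrm (wmul t j x) \<le> nrm x" by (rule nrm_wmul[OF tpos x])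
    have 1: "nrm (\<lambda>i. A (wmul t j x) i - B (wmul t j x) i) \<le> \<epsilon> / 3 * nrm x"
      using AB[OF W[OF x, of j]] Wx \<epsilon> by (meson less_imp_le mult_left_mono order_trans e3)
    have 2: "nrm (\<lambda>i. B (wmul t j x) i - wmul t j (B x) i) \<le> \<epsilon> / 3 * nrm x"
      using t0(2)[OF t x, of j] Wx \<epsilon> by (meson less_imp_le mult_left_mono order_trans e3)
    have "nrm (\<lambda>i. wmul t j (B x) i - wmul t j (A x) i) = nrm (wmul t j (\<lambda>i. A x i - B x i))"
      by (subst nrm_minus_commute) (simp add: wmul_def scaleR_diff_right)
    also have "\<dots> \<le> nrm (\<lambda>i. A x i - B x i)"
      by (rule nrm_wmul[OF tpos diff_in_E[OF AE[OF x] BE[OF x]]])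
    also have "\<dots> \<le> \<epsilon> / 3 * nrm x" by (rule AB[OF x])
    finally have 3: "nrm (\<lambda>i. wmul t j (B x) i - wmul t j (A x) i) \<le> \<epsilon> / 3 * nrm x" .
    have "nrm (\<lambda>i. A (wmul t j x) i - wmul t j (A x) i) \<le>
        nrm (\<lambda>i. A (wmul t j x) i - B (wmul t j x) i) + nrm (\<lambda>i. B (wmul t j x) i - wmul t j (A x) i)"
      using x by (intro nrm_diff_triangle AE BE W)
    also have "nrm (\<lambda>i. B (wmul t j x) i - wmul t j (A x) i) \<le>
        nrm (\<lambda>i. B (wmul t j x) i - wmul t j (B x) i) + nrm (\<lambda>i. wmul t j (B x) i - wmul t j (A x) i)"
      using x by (intro nrm_diff_triangle AE BE W)
    finally show "nrm (\<lambda>i. A (wmul t j x) i - wmul t j (A x) i) \<le> \<epsilon> * nrm x"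
      using 1 2 3 by linarith
  qed
qed

text \<open>An approximating band operator has no entries at distance more than its width from the diagonal.\<close>

lemma band_dominated_off_diagonal:
  fixes A :: "('n::finite, 'a::complex_banach) seq_op"
  assumes A: "A \<in> band_dominated p" and \<epsilon>: "0 < \<epsilon>"
  obtains w where "\<And>U V x. (\<And>i k. i \<in> U \<Longrightarrow> k \<in> V \<Longrightarrow> i - k \<notin> cube w) \<Longrightarrow> x \<in> E \<Longrightarrow>
    nrm (restr U (A (restr V x))) \<le> \<epsilon> * nrm x"
proof -
  obtain B where B: "B \<in> band_ops" "B \<in> bounded_ops p E"
    and AB: "\<And>x. x \<in> E \<Longrightarrow> nrm (\<lambda>i. A x i - B x i) \<le> \<epsilon> * nrm x"
    using band_dominated_approx[OF A \<epsilon>] by blast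
  obtain w where w: "\<And>x i. (\<And>k. i - k \<in> cube w \<Longrightarrow> x k = 0) \<Longrightarrow> B x i = 0"
    using band_op_width[OF B(1)] by blast
  show ?thesis
  proof (rule that[of w])
    fix U V :: "(int ^ 'n) set" and x :: "('n, 'a) seqs"
    assume sep: "\<And>i k. i \<in> U \<Longrightarrow> k \<in> V \<Longrightarrow> i - k \<notin> cube w" and x: "x \<in> E"
    note V = restr_in_E[OF x, of V]
    have "B (restr V x) i = 0" if "i \<in> U" for i
      by (rule w) (use sep[OF that] in \<open>auto simp: restr_def\<close>)
    then have "nrm (restr U (A (restr V x))) = nrm (restr U (\<lambda>i. A (restr V x) i - B (restr V x) i))"
      by (intro nrm_cong) (auto simp: restr_def)
    also have "\<dots> \<le> nrm (\<lambda>i. A (restr V x) i - B (restr V x) i)"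
      by (intro nrm_restr diff_in_E bounded_opsD(1)[OF band_dominated_bounded[OF A]] bounded_opsD(1)[OF B(2)] V)
    also have "\<dots> \<le> \<epsilon> * nrm (restr V x)" by (rule AB[OF V])
    also have "\<dots> \<le> \<epsilon> * nrm x" using nrm_restr[OF x, of V] \<epsilon> by simp
    finally show "nrm (restr U (A (restr V x))) \<le> \<epsilon> * nrm x" .
  qed
qed

end

section \<open>Summability of the weights\<close>

lemma sum_exp_abs_le:
  fixes s :: real
  assumes "0 < s"
  shows "(\<Sum>a\<in>{- int r..int r}. exp (- s * real_of_int \<bar>a\<bar>)) \<le> 2 / (1 - exp (- s))"
proof -
  let ?g = "\<lambda>a::int. exp (- s * real_of_int \<bar>a\<bar>)"
  let ?h = "\<lambda>k::nat. exp (- s) ^ k"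
  have gh: "?g (int k) = ?h k" "?g (- int k) = ?h k" for k
    by (simp_all add: exp_of_nat_mult[symmetric] mult.commute)
  have "(\<Sum>k\<le>r. ?h k) \<le> suminf ?h"
    by (rule sum_le_suminf) (use assms in \<open>auto intro: summable_geometric\<close>)
  then have geo: "(\<Sum>k\<le>r. ?h k) \<le> 1 / (1 - exp (- s))"
    using assms by (simp add: suminf_geometric)
  have sub: "{- int r..int r} \<subseteq> int ` {..r} \<union> (\<lambda>k. - int k) ` {..r}"
  proof
    fix a assume a: "a \<in> {- int r..int r}"
    show "a \<in> int ` {..r} \<union> (\<lambda>k. - int k) ` {..r}"
    proof (cases "0 \<le> a")
      case True
      then show ?thesis using a by (intro UnI1 image_eqI[of _ _ "nat a"]) auto
    next
      case False
      then show ?thesis using a by (intro UnI2 image_eqI[of _ _ "nat (- a)"]) auto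
    qed
  qed
  have "sum ?g {- int r..int r} \<le> sum ?g (int ` {..r} \<union> (\<lambda>k. - int k) ` {..r})"
    by (rule sum_mono2[OF _ sub]) auto
  also have "\<dots> \<le> sum ?g (int ` {..r}) + sum ?g ((\<lambda>k. - int k) ` {..r})"
    by (subst sum_Un) (auto intro!: sum_nonneg)
  also have "\<dots> = (\<Sum>k\<le>r. ?h k) + (\<Sum>k\<le>r. ?h k)"
    by (subst (1 2) sum.reindex) (auto simp: inj_on_def gh[unfolded of_int_abs] exp_of_nat_mult[symmetric] mult.commute)
  finally show ?thesis using geo by simp
qed

lemma summable_exp_ell1:
  fixes s :: real
  assumes "0 < s"
  shows "(\<lambda>d::int ^ 'n::finite. exp (- s * ell1 d)) summable_on UNIV"
proof (rule nonneg_bdd_above_summable_on)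
  let ?g = "\<lambda>a::int. exp (- s * real_of_int \<bar>a\<bar>)"
  let ?G = "(2 / (1 - exp (- s))) ^ CARD('n)"
  have prod: "exp (- s * ell1 d) = (\<Prod>j\<in>UNIV. ?g (d $ j))" for d :: "int ^ 'n"
    by (simp add: ell1_def sum_distrib_left exp_sum sum_negf[symmetric])
  show "bdd_above (sum (\<lambda>d::int ^ 'n. exp (- s * ell1 d)) ` {F. F \<subseteq> UNIV \<and> finite F})"
  proof (rule bdd_aboveI2)
    fix F :: "(int ^ 'n) set" assume "F \<in> {F. F \<subseteq> UNIV \<and> finite F}"
    then obtain r where r: "F \<subseteq> cube r" using finite_subset_cube[of F] by auto
    have cube: "cube r = vec_lambda ` (PiE (UNIV :: 'n set) (\<lambda>_. {- int r..int r}))"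
    proof (intro set_eqI iffI)
      fix k :: "int ^ 'n" assume "k \<in> cube r"
      then have "vec_nth k \<in> PiE UNIV (\<lambda>_. {- int r..int r})"
        by (auto simp: cube_def PiE_def minus_le_iff)
      then show "k \<in> vec_lambda ` (PiE UNIV (\<lambda>_. {- int r..int r}))"
        by (metis image_eqI vec_nth_inverse)
    qed (auto simp: cube_def)
    have "(\<Sum>d\<in>F. exp (- s * ell1 d)) \<le> (\<Sum>d\<in>(cube r :: (int ^ 'n) set). \<Prod>j\<in>UNIV. ?g (d $ j))"
      unfolding prod by (rule sum_mono2[OF finite_cube r]) (auto intro: prod_nonneg)
    also have "\<dots> = (\<Sum>f\<in>PiE (UNIV :: 'n set) (\<lambda>_. {- int r..int r}). \<Prod>j\<in>UNIV. ?g (f j))"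
      unfolding cube by (subst sum.reindex) (auto simp: inj_on_def vec_lambda_inject)
    also have "\<dots> = (\<Prod>j\<in>(UNIV :: 'n set). \<Sum>a\<in>{- int r..int r}. ?g a)"
      by (rule prod_sum_PiE[symmetric]) auto
    also have "\<dots> \<le> ?G"
      using sum_exp_abs_le[OF assms, of r] by (simp del: of_int_abs) (intro power_mono sum_nonneg, auto)
    finally show "(\<Sum>d\<in>F. exp (- s * ell1 d)) \<le> ?G" .
  qed
qed simp

section \<open>Localisation of approximate minimisers\<close>

lemma powr_superadditive:
  fixes a b q :: real
  assumes "1 \<le> q" "0 \<le> a" "0 \<le> b"
  shows "a powr q + b powr q \<le> (a + b) powr q"
proof (cases "a + b = 0")
  case False
  then have s: "0 < a + b" using assms by simp
  have le: "(u / (a + b)) powr q \<le> u / (a + b)" if "0 \<le> u" "u \<le> a + b" for u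
    using powr_mono'[OF assms(1), of "u / (a + b)"] that s by (cases "u = 0") auto
  have "(a / (a + b)) powr q + (b / (a + b)) powr q \<le> a / (a + b) + b / (a + b)"
    using assms by (intro add_mono le) auto
  also have "\<dots> = 1" using s by (simp add: add_divide_distrib[symmetric])
  finally show ?thesis using s assms by (simp add: powr_divide field_simps)
next
  case True
  then have "a = 0" "b = 0" using assms by auto
  then show ?thesis by simp
qed

context lp_exponent
begin

text \<open>Averaging over all translates of a multiplier reproduces the norm up to a constant.\<close>

lemma sum_translated_multipliers:
  fixes x :: "int ^ 'n::finite \<Rightarrow> 'a::real_normed_vector" and u :: "int ^ 'n \<Rightarrow> real"
  assumes q: "p = ereal q" "1 \<le> q" and fin: "finite {i. x i \<noteq> 0}"
    and u: "\<And>d. 0 \<le> u d" "(\<lambda>d. u d powr q) summable_on UNIV"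
  shows "((\<lambda>j. nrm (\<lambda>i. u (i - j) *\<^sub>R x i) powr q) has_sum (\<Sum>\<^sub>\<infinity>d. u d powr q) * nrm x powr q) UNIV"
proof -
  let ?S = "{i. x i \<noteq> 0}"
  let ?C = "\<Sum>\<^sub>\<infinity>d. u d powr q"
  have on_S: "(\<Sum>\<^sub>\<infinity>i. f i) = (\<Sum>i\<in>?S. f i)" if "\<And>i. x i = 0 \<Longrightarrow> f i = 0" for f :: "int ^ 'n \<Rightarrow> real"
  proof -
    have "(\<Sum>\<^sub>\<infinity>i. f i) = (\<Sum>\<^sub>\<infinity>i\<in>?S. f i)" by (rule infsum_cong_neutral) (use that in auto)
    then show ?thesis using fin by simp
  qed
  have one: "((\<lambda>j. u (i - j) powr q * norm (x i) powr q) has_sum ?C * norm (x i) powr q) UNIV" for i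
  proof -
    have "bij (\<lambda>j. i - j)" by (rule bij_betw_byWitness[where f' = "\<lambda>j. i - j"]) auto
    then have "((\<lambda>j. u (i - j) powr q) has_sum ?C) UNIV"
      using has_sum_reindex_bij_betw[of "\<lambda>j. i - j" UNIV UNIV "\<lambda>d. u d powr q" ?C] u(2) by simp
    then show ?thesis by (rule has_sum_cmult_left)
  qed
  have "((\<lambda>j. \<Sum>i\<in>G. u (i - j) powr q * norm (x i) powr q) has_sum (\<Sum>i\<in>G. ?C * norm (x i) powr q)) UNIV"
    if "finite G" for G
    using that by induction (auto intro!: has_sum_add one)
  from this[OF fin] show ?thesis
    unfolding nrm_powr[OF q] using u(1) q(2)
    by (simp add: on_S powr_mult sum_distrib_left abs_of_nonneg)
qed

lemma weighted_tail_sum_small: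
  fixes u :: "int ^ 'n::finite \<Rightarrow> real"
  assumes u: "\<And>d. 0 \<le> u d" "u summable_on UNIV" and \<delta>: "0 < \<delta>"
  obtains R where "(\<lambda>d. if d \<in> cube R then 0 else u d) summable_on UNIV"
    "(\<Sum>\<^sub>\<infinity>d. if d \<in> cube R then 0 else u d) < \<delta>"
proof -
  obtain F where F: "finite F" "dist (sum u F) (infsum u UNIV) \<le> \<delta> / 2"
    using infsum_finite_approximation[OF u(2), of "\<delta> / 2"] \<delta> by auto
  obtain R where R: "F \<subseteq> cube R" using finite_subset_cube[OF F(1)] by blast
  let ?a = "\<lambda>d. if d \<in> cube R then u d else 0" and ?b = "\<lambda>d. if d \<in> cube R then 0 else u d"
  have a: "?a summable_on UNIV" and b: "?b summable_on UNIV"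
    by (rule summable_on_comparison_test[OF u(2)]; use u(1) in auto)+
  have "infsum u UNIV = (\<Sum>\<^sub>\<infinity>d. ?a d + ?b d)"
    by (rule infsum_cong) auto
  also have "\<dots> = infsum ?a UNIV + infsum ?b UNIV" by (rule infsum_add[OF a b])
  also have "infsum ?a UNIV = infsum u (cube R)"
    by (rule infsum_cong_neutral) auto
  also have "\<dots> = sum u (cube R)" by (rule infsum_finite[OF finite_cube])
  finally have "infsum ?b UNIV = infsum u UNIV - sum u (cube R)" by simp
  also have "\<dots> \<le> infsum u UNIV - sum u F"
    using sum_mono2[OF finite_cube R, of u] u(1) by simp
  also have "\<dots> < \<delta>" using F(2) \<delta> unfolding dist_real_def by linarith
  finally show ?thesis using that[OF b] by blast
qed

text \<open>For a finite exponent the centre is found by summing over all centres: in the sum, the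
  first inequality holds with the constant \<open>lam\<close>, and the tail has an arbitrarily small share of
  the total. Adding the tail with a large factor to the first inequality produces one centre
  that serves both. For the supremum norm any coordinate of maximal norm is a good centre.\<close>

lemma common_centre:
  fixes t \<epsilon> \<kappa> \<Lambda> :: real
  assumes t: "0 < t" and \<epsilon>: "0 < \<epsilon>" and \<kappa>: "0 < \<kappa>" and \<Lambda>: "0 \<le> \<Lambda>"
  shows "\<exists>R. \<forall>(x :: int ^ 'n::finite \<Rightarrow> 'a::real_normed_vector) (y :: int ^ 'n \<Rightarrow> 'a) lam.
    finite {i. x i \<noteq> 0} \<longrightarrow> finite {i. y i \<noteq> 0} \<longrightarrow> x \<noteq> (\<lambda>_. 0) \<longrightarrow> 0 \<le> lam \<longrightarrow> lam \<le> \<Lambda> \<longrightarrow>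
    nrm y \<le> lam * nrm x \<longrightarrow>
    (\<exists>j. nrm (wmul t j y) \<le> (lam + \<epsilon>) * nrm (wmul t j x) \<and>
         nrm (wmul t j (restr {i. i - j \<notin> cube R} x)) \<le> \<kappa> * nrm (wmul t j x))"
proof (cases rule: exponent_cases)
  case sup
  have "((\<lambda>r. exp (- real r / t)) \<longlongrightarrow> 0) sequentially"
    using t by real_asymp
  then have "\<forall>\<^sub>F r in sequentially. exp (- real r / t) < \<kappa>"
    by (rule order_tendstoD(2)) (rule \<kappa>)
  then obtain R where R: "exp (- real R / t) < \<kappa>"
    by (auto simp: eventually_sequentially)
  show ?thesis
  proof (intro exI[of _ R] allI impI)
    fix x y :: "int ^ 'n \<Rightarrow> 'a" and lam
    assume fx: "finite {i. x i \<noteq> 0}" and fy: "finite {i. y i \<noteq> 0}" and x0: "x \<noteq> (\<lambda>_. 0)"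
      and lam: "0 \<le> lam" "lam \<le> \<Lambda>" and y: "nrm y \<le> lam * nrm x"
    note xE = finite_support_in_E[OF fx] and yE = finite_support_in_E[OF fy]
    let ?N = "(\<lambda>i. norm (x i)) ` {i. x i \<noteq> 0}"
    have ne: "?N \<noteq> {}" using x0 by auto
    have "Max ?N \<in> ?N" using fx ne by (intro Max_in) auto
    then obtain j where j: "norm (x j) = Max ?N" by auto
    have "norm (x i) \<le> norm (x j)" for i
    proof (cases "x i = 0")
      case False
      then show ?thesis unfolding j using fx by (intro Max_ge) auto
    qed simp
    then have "nrm x \<le> norm (x j)"
      unfolding nrm_sup[OF sup] by (intro cSUP_least) auto
    then have low: "nrm x \<le> nrm (wmul t j x)"
      using nrm_coord_wmul[OF t xE, of j] by simp
    have "nrm (wmul t j y) \<le> nrm y" by (rule nrm_wmul[OF t yE])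
    also have "\<dots> \<le> lam * nrm (wmul t j x)"
      using y mult_left_mono[OF low lam(1)] by simp
    also have "\<dots> \<le> (lam + \<epsilon>) * nrm (wmul t j x)"
      using \<epsilon> nrm_nonneg[OF wmul_in_E[OF t xE]] by (simp add: distrib_right)
    finally have 1: "nrm (wmul t j y) \<le> (lam + \<epsilon>) * nrm (wmul t j x)" .
    have "nrm (wmul t j (restr {i. i - j \<notin> cube R} x)) \<le> exp (- real R / t) * nrm (restr {i. i - j \<notin> cube R} x)"
      by (rule nrm_wmul_tail[OF t restr_in_E[OF xE]]) (simp add: restr_def)
    also have "\<dots> \<le> \<kappa> * nrm (wmul t j x)"
      using R nrm_restr[OF xE] low nrm_nonneg[OF restr_in_E[OF xE]] \<kappa>
      by (intro mult_mono) (auto intro: order_trans)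
    finally show "\<exists>j. nrm (wmul t j y) \<le> (lam + \<epsilon>) * nrm (wmul t j x) \<and>
         nrm (wmul t j (restr {i. i - j \<notin> cube R} x)) \<le> \<kappa> * nrm (wmul t j x)"
      using 1 by blast
  qed
next
  case (pow q)
  define u :: "int ^ 'n \<Rightarrow> real" where "u d = weight t 0 d" for d
  have u: "0 \<le> u d" for d by (simp add: u_def weight_pos less_imp_le)
  have wu: "weight t j i = u (i - j)" for i j :: "int ^ 'n" by (simp add: u_def weight_def)
  have upow: "u d powr q = exp (- (q / t) * ell1 d)" for d
    by (simp add: u_def weight_def powr_def)
  have su: "(\<lambda>d. u d powr q) summable_on UNIV"
    unfolding upow by (rule summable_exp_ell1) (use t pow(2) in simp)
  define C where "C = (\<Sum>\<^sub>\<infinity>d. u d powr q)"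
  have "(\<Sum>d\<in>{0}. u d powr q) \<le> C"
    unfolding C_def by (rule finite_sum_le_infsum[OF su]) auto
  then have C1: "1 \<le> C" by (simp add: u_def weight_self)
  \<comment> \<open>With this factor, \<open>b + M * c \<le> (lam powr q + \<epsilon> powr q) * a\<close> bounds both \<open>b\<close> and \<open>c\<close> as required.\<close>
  define M where "M = (\<Lambda> powr q + \<epsilon> powr q) / \<kappa> powr q"
  have M: "0 < M" using \<epsilon> \<kappa> by (auto simp: M_def intro!: divide_pos_pos add_nonneg_pos)
  obtain R where R0: "(\<lambda>d. if d \<in> cube R then 0 else u d powr q) summable_on UNIV"
      "(\<Sum>\<^sub>\<infinity>d. if d \<in> cube R then 0 else u d powr q) < \<epsilon> powr q / M"
    by (rule weighted_tail_sum_small[OF _ su, of "\<epsilon> powr q / M"]) (use \<epsilon> M in auto)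
  define v :: "int ^ 'n \<Rightarrow> real" where "v d = (if d \<in> cube R then 0 else u d)" for d
  have v: "0 \<le> v d" for d by (simp add: v_def u)
  have vpow: "v d powr q = (if d \<in> cube R then 0 else u d powr q)" for d by (simp add: v_def)
  have sv: "(\<lambda>d. v d powr q) summable_on UNIV" and CR: "(\<Sum>\<^sub>\<infinity>d. v d powr q) < \<epsilon> powr q / M"
    unfolding vpow by (rule R0)+
  show ?thesis
  proof (intro exI[of _ R] allI impI)
    fix x y :: "int ^ 'n \<Rightarrow> 'a" and lam
    assume fx: "finite {i. x i \<noteq> 0}" and fy: "finite {i. y i \<noteq> 0}" and x0: "x \<noteq> (\<lambda>_. 0)"
      and lam: "0 \<le> lam" "lam \<le> \<Lambda>" and y: "nrm y \<le> lam * nrm x"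
    note xE = finite_support_in_E[OF fx] and yE = finite_support_in_E[OF fy]
    have xpos: "0 < nrm x" using nrm_eq_0_imp[OF xE] x0 by fastforce
    define a where "a j = nrm (wmul t j x) powr q" for j
    define b where "b j = nrm (wmul t j y) powr q" for j
    define c where "c j = nrm (wmul t j (restr {i. i - j \<notin> cube R} x)) powr q" for j
    let ?X = "nrm x powr q"
    have Xpos: "0 < ?X" using xpos by simp
    have tail: "wmul t j (restr {i. i - j \<notin> cube R} x) = (\<lambda>i. v (i - j) *\<^sub>R x i)" for j
      by (auto simp: wmul_def restr_def v_def wu)
    have ha: "(a has_sum C * ?X) UNIV"
      using sum_translated_multipliers[OF pow fx u su] unfolding a_def C_def wmul_def wu .
    have hb: "(b has_sum C * nrm y powr q) UNIV"
      using sum_translated_multipliers[OF pow fy u su] unfolding b_def C_def wmul_def wu .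
    have hc: "(c has_sum (\<Sum>\<^sub>\<infinity>d. v d powr q) * ?X) UNIV"
      using sum_translated_multipliers[OF pow fx v sv] unfolding c_def tail .
    let ?\<theta> = "lam powr q + \<epsilon> powr q"
    have "nrm y powr q \<le> (lam * nrm x) powr q"
      using y nrm_nonneg[OF yE] pow(2) by (intro powr_mono2) auto
    then have yX: "nrm y powr q \<le> lam powr q * ?X"
      using lam xpos by (simp add: powr_mult)
    have "\<exists>j. b j + M * c j < ?\<theta> * a j"
    proof (rule ccontr)
      assume "\<not> ?thesis"
      then have "?\<theta> * a j \<le> b j + M * c j" for j by (simp add: not_less)
      then have "?\<theta> * (C * ?X) \<le> C * nrm y powr q + M * ((\<Sum>\<^sub>\<infinity>d. v d powr q) * ?X)"
        by (intro has_sum_mono[OF has_sum_cmult_right[OF ha] has_sum_add[OF hb has_sum_cmult_right[OF hc]]]) auto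
      also have "\<dots> \<le> C * (lam powr q * ?X) + M * ((\<Sum>\<^sub>\<infinity>d. v d powr q) * ?X)"
        using yX C1 by simp
      also have "\<dots> < C * (lam powr q * ?X) + \<epsilon> powr q * ?X"
        using CR M Xpos by (simp add: field_simps)
      also have "\<dots> \<le> C * (lam powr q * ?X) + C * (\<epsilon> powr q * ?X)"
      proof -
        have "1 * (\<epsilon> powr q * ?X) \<le> C * (\<epsilon> powr q * ?X)" by (rule mult_right_mono[OF C1]) simp
        then show ?thesis by simp
      qed
      also have "\<dots> = ?\<theta> * (C * ?X)" by (simp add: algebra_simps)
      finally show False by simp
    qed
    then obtain j where j: "b j + M * c j < ?\<theta> * a j" by blast
    have bc: "0 \<le> b j" "0 \<le> c j" "0 \<le> a j" by (auto simp: a_def b_def c_def)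
    have nx: "0 \<le> nrm (wmul t j x)" by (rule nrm_nonneg[OF wmul_in_E[OF t xE]])
    have ny: "0 \<le> nrm (wmul t j y)" by (rule nrm_nonneg[OF wmul_in_E[OF t yE]])
    have root: "r \<le> s" if "0 \<le> r" "0 \<le> s" "r powr q \<le> s powr q" for r s :: real
      using that powr_less_mono2[of q s r] pow(2) by (force simp: not_le[symmetric])
    have "b j \<le> ?\<theta> * a j" using j mult_nonneg_nonneg[of M "c j"] bc M by linarith
    also have "\<dots> \<le> (lam + \<epsilon>) powr q * a j"
      using powr_superadditive[OF pow(2) lam(1), of \<epsilon>] \<epsilon> bc by (intro mult_right_mono) auto
    also have "\<dots> = ((lam + \<epsilon>) * nrm (wmul t j x)) powr q"
      using lam \<epsilon> nx by (simp add: a_def powr_mult)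
    finally have 1: "nrm (wmul t j y) \<le> (lam + \<epsilon>) * nrm (wmul t j x)"
      using root[of "nrm (wmul t j y)" "(lam + \<epsilon>) * nrm (wmul t j x)"] lam \<epsilon> nx ny by (simp add: b_def)
    have "M * c j \<le> ?\<theta> * a j" using j bc by linarith
    also have "\<dots> \<le> (\<Lambda> powr q + \<epsilon> powr q) * a j"
      using lam pow(2) bc by (intro mult_right_mono add_right_mono powr_mono2) auto
    also have "\<dots> = M * (\<kappa> powr q * a j)" using \<kappa> by (simp add: M_def)
    finally have "c j \<le> \<kappa> powr q * a j" using M by simp
    also have "\<dots> = (\<kappa> * nrm (wmul t j x)) powr q" using \<kappa> nx by (simp add: a_def powr_mult)
    finally have 2: "nrm (wmul t j (restr {i. i - j \<notin> cube R} x)) \<le> \<kappa> * nrm (wmul t j x)"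
      using root[of "nrm (wmul t j (restr {i. i - j \<notin> cube R} x))" "\<kappa> * nrm (wmul t j x)"]
        \<kappa> nx nrm_nonneg[OF wmul_in_E[OF t restr_in_E[OF xE]]] by (simp add: c_def)
    show "\<exists>j. nrm (wmul t j y) \<le> (lam + \<epsilon>) * nrm (wmul t j x) \<and>
         nrm (wmul t j (restr {i. i - j \<notin> cube R} x)) \<le> \<kappa> * nrm (wmul t j x)"
      using 1 2 by blast
  qed
qed

text \<open>The commutator estimate relative to the weighted sequence says that the weighted minimiser is
  almost as good as the minimiser itself, provided that the centre is chosen well. Cutting off the
  tail, which is a small fraction of the weighted minimiser, gives a finite localisation. The radius
  depends on the operator only through the parameter \<open>t\<close> and the bounds \<open>\<epsilon>\<close> and \<open>C\<close>.\<close>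

lemma localize_minimiser:
  fixes t \<epsilon> C :: real
  assumes t: "0 < t" and \<epsilon>: "0 < \<epsilon>" and C: "0 \<le> C"
  shows "\<exists>R. \<forall>(T :: ('n::finite, 'a::complex_banach) seq_op) x lam.
    T \<in> bounded_ops p E \<longrightarrow> (\<forall>y\<in>E. nrm (T y) \<le> C * nrm y) \<longrightarrow>
    (\<forall>j. \<forall>y\<in>E. nrm (\<lambda>i. T (wmul t j y) i - wmul t j (T y) i) \<le> \<epsilon> * nrm (wmul t j y)) \<longrightarrow>
    finite {i. x i \<noteq> 0} \<longrightarrow> finite {i. T x i \<noteq> 0} \<longrightarrow> x \<noteq> (\<lambda>_. 0) \<longrightarrow> 0 \<le> lam \<longrightarrow> lam \<le> C \<longrightarrow>
    nrm (T x) \<le> lam * nrm x \<longrightarrow>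
    (\<exists>j y. y \<noteq> (\<lambda>_. 0) \<and> (\<forall>i. y i \<noteq> 0 \<longrightarrow> x i \<noteq> 0 \<and> i - j \<in> cube R) \<and>
           nrm (T y) \<le> (lam + 3 * \<epsilon>) * nrm y)"
proof -
  \<comment> \<open>This gives \<open>lam + 2 * \<epsilon> + C * \<kappa> \<le> (lam + 3 * \<epsilon>) * (1 - \<kappa>)\<close> whenever \<open>lam \<le> C\<close>.\<close>
  define \<kappa> where "\<kappa> = \<epsilon> / (2 * C + 3 * \<epsilon>)"
  have \<kappa>: "0 < \<kappa>" "\<kappa> < 1" "\<kappa> * (2 * C + 3 * \<epsilon>) = \<epsilon>"
    using \<epsilon> C by (auto simp: \<kappa>_def field_simps)
  obtain R where R: "\<forall>(x :: ('n, 'a) seqs) (y :: ('n, 'a) seqs) lam.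
    finite {i. x i \<noteq> 0} \<longrightarrow> finite {i. y i \<noteq> 0} \<longrightarrow> x \<noteq> (\<lambda>_. 0) \<longrightarrow> 0 \<le> lam \<longrightarrow> lam \<le> C \<longrightarrow>
    nrm y \<le> lam * nrm x \<longrightarrow>
    (\<exists>j. nrm (wmul t j y) \<le> (lam + \<epsilon>) * nrm (wmul t j x) \<and>
         nrm (wmul t j (restr {i. i - j \<notin> cube R} x)) \<le> \<kappa> * nrm (wmul t j x))"
    using common_centre[OF t \<epsilon> \<kappa>(1) C] by blast
  show ?thesis
  proof (intro exI[of _ R] allI impI)
    fix T :: "('n, 'a) seq_op" and x lam
    assume T: "T \<in> bounded_ops p E" and TC: "\<forall>y\<in>E. nrm (T y) \<le> C * nrm y"
      and comm: "\<forall>j. \<forall>y\<in>E. nrm (\<lambda>i. T (wmul t j y) i - wmul t j (T y) i) \<le> \<epsilon> * nrm (wmul t j y)"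
      and fx: "finite {i. x i \<noteq> 0}" and fy: "finite {i. T x i \<noteq> 0}" and x0: "x \<noteq> (\<lambda>_. 0)"
      and lam: "0 \<le> lam" "lam \<le> C" and le: "nrm (T x) \<le> lam * nrm x"
    note xE = finite_support_in_E[OF fx]
    have TxE: "T x \<in> E" by (rule bounded_opsD(1)[OF T xE])
    obtain j where j: "nrm (wmul t j (T x)) \<le> (lam + \<epsilon>) * nrm (wmul t j x)"
         "nrm (wmul t j (restr {i. i - j \<notin> cube R} x)) \<le> \<kappa> * nrm (wmul t j x)"
      using R[rule_format, OF fx fy x0 lam le] by blast
    define u where "u = wmul t j x"
    define \<tau> where "\<tau> = wmul t j (restr {i. i - j \<notin> cube R} x)"
    define y where "y = wmul t j (restr {i. i - j \<in> cube R} x)"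
    have E: "u \<in> E" "\<tau> \<in> E" "y \<in> E"
      unfolding u_def \<tau>_def y_def by (intro wmul_in_E[OF t] restr_in_E xE)+
    have y_eq: "y = (\<lambda>i. u i - \<tau> i)"
      by (auto simp: y_def u_def \<tau>_def wmul_def restr_def)
    have u_eq: "u = (\<lambda>i. y i + \<tau> i)"
      by (auto simp: y_def u_def \<tau>_def wmul_def restr_def)
    have "u \<noteq> (\<lambda>_. 0)"
    proof
      assume "u = (\<lambda>_. 0)"
      then have "weight t j i *\<^sub>R x i = 0" for i by (metis u_def wmul_def)
      then have "x i = 0" for i using weight_pos[of t j i] by (metis less_irrefl scaleR_eq_0_iff)
      then show False using x0 by blast
    qed
    then have upos: "0 < nrm u" using nrm_eq_0_imp[OF E(1)] by fastforce
    have tau: "nrm \<tau> \<le> \<kappa> * nrm u" using j(2) by (simp add: \<tau>_def u_def)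
    have "nrm u \<le> nrm y + nrm \<tau>" using nrm_triangle[OF E(3,2)] u_eq by simp
    then have uy: "(1 - \<kappa>) * nrm u \<le> nrm y" using tau by (simp add: algebra_simps)
    have ypos: "0 < nrm y"
      using uy mult_pos_pos[OF _ upos, of "1 - \<kappa>"] \<kappa> by simp
    have "nrm (T u) \<le> nrm (wmul t j (T x)) + nrm (\<lambda>i. T u i - wmul t j (T x) i)"
      by (rule nrm_le_diff[OF bounded_opsD(1)[OF T E(1)] wmul_in_E[OF t TxE]])
    also have "\<dots> \<le> (lam + \<epsilon>) * nrm u + \<epsilon> * nrm u"
      using j(1) comm xE by (intro add_mono) (auto simp: u_def)
    finally have Tu: "nrm (T u) \<le> (lam + 2 * \<epsilon>) * nrm u" by (simp add: algebra_simps)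
    have "nrm (T y) \<le> nrm (T u) + nrm (T \<tau>)"
      unfolding y_eq bounded_ops_diff[OF seq_subspace_E T E(1,2)]
      by (rule nrm_diff[OF bounded_opsD(1)[OF T E(1)] bounded_opsD(1)[OF T E(2)]])
    also have "nrm (T \<tau>) \<le> C * (\<kappa> * nrm u)"
      using TC E(2) mult_left_mono[OF tau C] by force
    finally have "nrm (T y) \<le> (lam + 2 * \<epsilon> + C * \<kappa>) * nrm u"
      using Tu by (simp add: algebra_simps)
    also have "\<dots> \<le> ((lam + 3 * \<epsilon>) * (1 - \<kappa>)) * nrm u"
    proof (rule mult_right_mono)
      have "\<kappa> * lam \<le> \<kappa> * C" using lam \<kappa> by simp
      then show "lam + 2 * \<epsilon> + C * \<kappa> \<le> (lam + 3 * \<epsilon>) * (1 - \<kappa>)"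
        using \<kappa>(3) by (simp add: algebra_simps)
    qed (use upos in simp)
    also have "\<dots> \<le> (lam + 3 * \<epsilon>) * nrm y"
      using mult_left_mono[OF uy, of "lam + 3 * \<epsilon>"] lam \<epsilon> by (simp add: mult.assoc)
    finally have "nrm (T y) \<le> (lam + 3 * \<epsilon>) * nrm y" .
    moreover have "y \<noteq> (\<lambda>_. 0)" using ypos by (auto simp: nrm_zero)
    moreover have "y i \<noteq> 0 \<longrightarrow> x i \<noteq> 0 \<and> i - j \<in> cube R" for i
      by (auto simp: y_def wmul_def restr_def)
    ultimately show "\<exists>j y. y \<noteq> (\<lambda>_. 0) \<and> (\<forall>i. y i \<noteq> 0 \<longrightarrow> x i \<noteq> 0 \<and> i - j \<in> cube R) \<and>
           nrm (T y) \<le> (lam + 3 * \<epsilon>) * nrm y"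
      by blast
  qed
qed

end

section \<open>Compressions to index sets\<close>

definition compress ::
    "(int ^ 'n::finite) set \<Rightarrow> ('n, 'a::complex_banach) seq_op \<Rightarrow> ('n, 'a) seq_op" where
  "compress U T x = restr U (T (restr U x))"

text \<open>For a cube this is the extended finite section. Other sets arise as translates of cubes and as
  limits of such translates.\<close>

definition section_ext ::
    "(int ^ 'n::finite) set \<Rightarrow> real \<Rightarrow> ('n, 'a::complex_banach) seq_op \<Rightarrow> ('n, 'a) seq_op" where
  "section_ext U c T x = (\<lambda>i. compress U T x i + c *\<^sub>R restr (- U) x i)"

definition translate ::
    "int ^ 'n::finite \<Rightarrow> ('n, 'a::complex_banach) seq_op \<Rightarrow> ('n, 'a) seq_op" where
  "translate h T = shift (- h) \<circ> T \<circ> shift h"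

lemma P_proj_eq_restr: "P_proj n = restr (cube n)"
  by (auto simp: P_proj_def restr_def fun_eq_iff)

lemma Q_proj_eq_restr: "Q_proj n = restr (- cube n)"
  by (auto simp: Q_proj_def P_proj_def restr_def fun_eq_iff)

lemma fin_sec_eq_compress: "fin_sec A n = compress (cube n) A"
  by (auto simp: fin_sec_def compress_def P_proj_eq_restr fun_eq_iff)

lemma fin_sec_ext_eq_section_ext: "fin_sec_ext A c n = section_ext (cube n) c A"
  by (simp add: fin_sec_ext_def section_ext_def fin_sec_eq_compress Q_proj_eq_restr fun_eq_iff)

lemma restr_restr: "restr U (restr V x) = restr (U \<inter> V) x"
  by (auto simp: restr_def)

lemma restr_add: "restr U (\<lambda>i. x i + y i) = (\<lambda>i. restr U x i + restr U y i)"
  by (auto simp: restr_def)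

lemma restr_diff: "restr U (\<lambda>i. x i - y i) = (\<lambda>i. restr U x i - restr U y i)"
  by (auto simp: restr_def)

lemma restr_split: "x = (\<lambda>i. restr U x i + restr (- U) x i)"
  by (auto simp: restr_def)

lemma restr_id: "(\<And>i. i \<notin> U \<Longrightarrow> x i = 0) \<Longrightarrow> restr U x = x"
  by (auto simp: restr_def)

lemma restr_wmul: "restr U (wmul t j x) = wmul t j (restr U x)"
  by (auto simp: restr_def wmul_def)

lemma wmul_diff: "wmul t j (\<lambda>i. x i - y i) = (\<lambda>i. wmul t j x i - wmul t j y i)"
  by (simp add: wmul_def scaleR_diff_right)

lemma wmul_add: "wmul t j (\<lambda>i. x i + y i) = (\<lambda>i. wmul t j x i + wmul t j y i)"
  by (simp add: wmul_def scaleR_add_right)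

lemma scaleC_zero: "a *\<^sub>C (0::'a::complex_banach) = 0"
  using scaleC_add_right[of a "0::'a" 0] by simp

lemma scaleC_scaleR_commute: "a *\<^sub>C (r *\<^sub>R v) = r *\<^sub>R (a *\<^sub>C v)"
  by (simp add: scaleC_of_real[symmetric] scaleC_scaleC mult.commute)

lemma translate_section_ext:
  "translate h (section_ext U c T) = section_ext {i. i + h \<in> U} c (translate h T)"
proof -
  have r: "restr W (shift h x) = shift h (restr {i. i + h \<in> W} x)" for W x
    by (auto simp: restr_def shift_def)
  have s: "shift (- h) (restr W y) = restr {i. i + h \<in> W} (shift (- h) y)" for W y
    by (auto simp: restr_def shift_def)
  have c: "- {i. i + h \<in> U} = {i. i + h \<in> - U}" by auto
  show ?thesis
  proof (intro ext)
    fix x i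
    have "translate h (section_ext U c T) x i
        = restr U (T (restr U (shift h x))) (i + h) + c *\<^sub>R restr (- U) (shift h x) (i + h)"
      by (simp add: translate_def section_ext_def compress_def) (simp add: shift_def)
    also have "\<dots> = shift (- h) (restr U (T (restr U (shift h x)))) i + c *\<^sub>R shift (- h) (restr (- U) (shift h x)) i"
      by (simp add: shift_def)
    also have "\<dots> = section_ext {i. i + h \<in> U} c (translate h T) x i"
      unfolding r s section_ext_def compress_def translate_def c by (simp add: shift_def)
    finally show "translate h (section_ext U c T) x i = section_ext {i. i + h \<in> U} c (translate h T) x i" .
  qed
qed

context lp_exponent
begin

lemma shift_bounded: "shift h \<in> bounded_ops p E"
  by (rule bounded_opsI[where C = 1]) (simp_all add: shift_in_E nrm_shift, simp_all add: shift_def)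

lemma restr_bounded: "restr U \<in> bounded_ops p E"
  by (rule bounded_opsI[where C = 1])
    (auto simp: restr_in_E nrm_restr, auto simp: restr_def scaleC_zero)

lemma translate_bounded: "T \<in> bounded_ops p E \<Longrightarrow> translate h T \<in> bounded_ops p E"
  unfolding translate_def by (intro compose_bounded seq_subspace_E shift_bounded)

lemma translate_bound:
  assumes "\<And>x. x \<in> E \<Longrightarrow> nrm (T x) \<le> C * nrm x" "x \<in> E"
  shows "nrm (translate h T x) \<le> C * nrm x"
  using assms(1)[of "shift h x"] assms(2) by (simp add: translate_def nrm_shift shift_in_E)

lemma compress_bounded:
  assumes "T \<in> bounded_ops p E"
  shows "compress U T \<in> bounded_ops p E"
proof -
  have "compress U T = restr U \<circ> (T \<circ> restr U)" by (auto simp: compress_def)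
  then show ?thesis
    using assms by (metis compose_bounded restr_bounded seq_subspace_E)
qed

lemma compress_bound:
  assumes T: "T \<in> bounded_ops p E" and C: "\<And>x. x \<in> E \<Longrightarrow> nrm (T x) \<le> C * nrm x" "0 \<le> C" and x: "x \<in> E"
  shows "nrm (compress U T x) \<le> C * nrm x"
proof -
  have "nrm (compress U T x) \<le> nrm (T (restr U x))"
    unfolding compress_def by (intro nrm_restr bounded_opsD(1)[OF T] restr_in_E x)
  also have "\<dots> \<le> C * nrm (restr U x)" by (intro C restr_in_E x)
  also have "\<dots> \<le> C * nrm x" by (intro mult_left_mono nrm_restr x C)
  finally show ?thesis .
qed

lemma section_ext_closed:
  assumes T: "T \<in> bounded_ops p E" and C: "\<And>x. x \<in> E \<Longrightarrow> nrm (T x) \<le> C * nrm x" "0 \<le> C"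
  shows section_ext_bounded: "section_ext U c T \<in> bounded_ops p E"
    and section_ext_bound: "x \<in> E \<Longrightarrow> nrm (section_ext U c T x) \<le> (C + \<bar>c\<bar>) * nrm x"
proof -
  note K = compress_bounded[OF T, of U]
  have bd: "nrm (section_ext U c T x) \<le> (C + \<bar>c\<bar>) * nrm x" if x: "x \<in> E" for x
  proof -
    have "nrm (section_ext U c T x) \<le> nrm (compress U T x) + nrm (\<lambda>i. c *\<^sub>R restr (- U) x i)"
      unfolding section_ext_def by (intro nrm_triangle bounded_opsD(1)[OF K] scaleR_in_E restr_in_E x)
    also have "\<dots> \<le> C * nrm x + \<bar>c\<bar> * nrm x"
      unfolding nrm_scaleR[OF restr_in_E[OF x]]
      by (intro add_mono compress_bound T C x mult_left_mono nrm_restr) auto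
    finally show ?thesis by (simp add: distrib_right)
  qed
  then show "x \<in> E \<Longrightarrow> nrm (section_ext U c T x) \<le> (C + \<bar>c\<bar>) * nrm x" .
  show "section_ext U c T \<in> bounded_ops p E"
  proof (rule bounded_opsI[OF _ _ _ bd])
    show "section_ext U c T x \<in> E" if "x \<in> E" for x
      unfolding section_ext_def using that by (intro add_in_E bounded_opsD(1)[OF K] scaleR_in_E restr_in_E)
    show "section_ext U c T (\<lambda>i. x i + y i) = (\<lambda>i. section_ext U c T x i + section_ext U c T y i)"
      if "x \<in> E" "y \<in> E" for x y
      unfolding section_ext_def bounded_opsD(2)[OF K that] restr_add
      by (simp add: scaleR_add_right algebra_simps)
    show "section_ext U c T (\<lambda>i. a *\<^sub>C x i) = (\<lambda>i. a *\<^sub>C section_ext U c T x i)" if "x \<in> E" for a x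
      unfolding section_ext_def bounded_opsD(3)[OF K that] bounded_opsD(3)[OF restr_bounded that]
      by (simp add: scaleC_add_right scaleC_scaleR_commute)
  qed
qed

lemma im_P_eq: "im_P p n = {x :: ('n::finite, 'a::complex_banach) seqs. \<forall>i. i \<notin> cube n \<longrightarrow> x i = 0}"
proof (intro set_eqI iffI)
  fix x :: "('n, 'a) seqs" assume "x \<in> {x. \<forall>i. i \<notin> cube n \<longrightarrow> x i = 0}"
  then have x: "\<And>i. i \<notin> cube n \<Longrightarrow> x i = 0" by simp
  have "{i. x i \<noteq> 0} \<subseteq> cube n" using x by blast
  then have "x \<in> E"
    by (intro finite_support_in_E) (rule finite_subset[OF _ finite_cube])
  moreover have "P_proj n x = x" using x by (simp add: P_proj_eq_restr restr_id)
  ultimately show "x \<in> im_P p n" unfolding im_P_def by (metis image_eqI)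
qed (auto simp: im_P_def P_proj_def)

lemma im_P_finite_support: "x \<in> im_P p n \<Longrightarrow> finite {i. x i \<noteq> 0}"
  by (rule finite_subset[OF _ finite_cube[of n]]) (auto simp: im_P_eq)

lemma seq_subspace_im_P: "seq_subspace (im_P p n)"
  unfolding seq_subspace_def
  using finite_support_in_E[OF im_P_finite_support] by (auto simp: im_P_eq scaleC_zero)

lemma im_P_subset_E: "x \<in> im_P p n \<Longrightarrow> x \<in> E"
  using seq_subspaceD(1)[OF seq_subspace_im_P] by blast

section \<open>Localised minimisers of finite sections\<close>

text \<open>Compressions commute with weights, so the finite sections of an approximating band operator inherit
  its commutator estimate with the same constants. This makes the radius independent of the
  size of the section.\<close>

lemma fin_sec_localization:
  fixes A :: "('n::finite, 'a::complex_banach) seq_op"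
  assumes A: "A \<in> band_dominated p" and \<epsilon>: "0 < \<epsilon>"
  shows "\<exists>R. \<forall>n x lam. x \<in> im_P p n \<longrightarrow> x \<noteq> (\<lambda>_. 0) \<longrightarrow> 0 \<le> lam \<longrightarrow>
    nrm (fin_sec A n x) \<le> lam * nrm x \<longrightarrow>
    (\<exists>g y. y g \<noteq> 0 \<and> (\<forall>i. y i \<noteq> 0 \<longrightarrow> x i \<noteq> 0 \<and> i - g \<in> cube R) \<and>
           nrm (fin_sec A n y) \<le> (lam + \<epsilon>) * nrm y)"
proof -
  define e where "e = \<epsilon> / 5"
  have e: "0 < e" using \<epsilon> by (simp add: e_def)
  note Ab = band_dominated_bounded[OF A]
  obtain CA where CA: "0 \<le> CA" "\<And>x. x \<in> E \<Longrightarrow> nrm (A x) \<le> CA * nrm x"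
    using bounded_ops_bound[OF seq_subspace_E Ab] by blast
  obtain B where B: "B \<in> band_ops" "B \<in> bounded_ops p E"
    and AB: "\<And>x. x \<in> E \<Longrightarrow> nrm (\<lambda>i. A x i - B x i) \<le> e * nrm x"
    using band_dominated_approx[OF A e] by blast
  obtain t where t: "0 < t" and comm: "\<And>j x. x \<in> E \<Longrightarrow>
      nrm (\<lambda>i. B (wmul t j x) i - wmul t j (B x) i) \<le> e * nrm (wmul t j x)"
    using band_op_weight_commutator[OF B(1) e] by (metis order_refl)
  let ?C = "CA + e"
  have C: "0 \<le> ?C" using CA e by simp
  have BC: "nrm (B x) \<le> ?C * nrm x" if x: "x \<in> E" for x
    using nrm_le_diff[OF bounded_opsD(1)[OF B(2) x] bounded_opsD(1)[OF Ab x]] CA(2)[OF x] AB[OF x]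
    by (simp add: nrm_minus_commute[of "B x"] distrib_right)
  have diff: "nrm (\<lambda>i. fin_sec A n x i - fin_sec B n x i) \<le> e * nrm x" if x: "x \<in> E" for n x
  proof -
    note Px = restr_in_E[OF x, of "cube n"]
    have "nrm (\<lambda>i. fin_sec A n x i - fin_sec B n x i)
        = nrm (restr (cube n) (\<lambda>i. A (restr (cube n) x) i - B (restr (cube n) x) i))"
      by (simp add: fin_sec_eq_compress compress_def restr_diff)
    also have "\<dots> \<le> nrm (\<lambda>i. A (restr (cube n) x) i - B (restr (cube n) x) i)"
      by (intro nrm_restr diff_in_E bounded_opsD(1)[OF Ab] bounded_opsD(1)[OF B(2)] Px)
    also have "\<dots> \<le> e * nrm (restr (cube n) x)" by (rule AB[OF Px])
    also have "\<dots> \<le> e * nrm x" using nrm_restr[OF x] e by simp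
    finally show ?thesis .
  qed
  have fsE: "fin_sec S n x \<in> E" if "S \<in> bounded_ops p E" "x \<in> E" for S n x
    using bounded_opsD(1)[OF compress_bounded[OF that(1)] that(2)] by (simp add: fin_sec_eq_compress)
  obtain R where R: "\<forall>(T :: ('n, 'a) seq_op) x lam.
    T \<in> bounded_ops p E \<longrightarrow> (\<forall>y\<in>E. nrm (T y) \<le> ?C * nrm y) \<longrightarrow>
    (\<forall>j. \<forall>y\<in>E. nrm (\<lambda>i. T (wmul t j y) i - wmul t j (T y) i) \<le> e * nrm (wmul t j y)) \<longrightarrow>
    finite {i. x i \<noteq> 0} \<longrightarrow> finite {i. T x i \<noteq> 0} \<longrightarrow> x \<noteq> (\<lambda>_. 0) \<longrightarrow> 0 \<le> lam \<longrightarrow> lam \<le> ?C \<longrightarrow>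
    nrm (T x) \<le> lam * nrm x \<longrightarrow>
    (\<exists>j y. y \<noteq> (\<lambda>_. 0) \<and> (\<forall>i. y i \<noteq> 0 \<longrightarrow> x i \<noteq> 0 \<and> i - j \<in> cube R) \<and>
           nrm (T y) \<le> (lam + 3 * e) * nrm y)"
    using localize_minimiser[OF t e C] by blast
  show ?thesis
    \<comment> \<open>The radius is doubled because the centre is moved into the support of the minimiser.\<close>
  proof (intro exI[of _ "R + R"] allI impI)
    fix n and x :: "('n, 'a) seqs" and lam
    assume x: "x \<in> im_P p n" and x0: "x \<noteq> (\<lambda>_. 0)" and lam: "0 \<le> lam"
      and le: "nrm (fin_sec A n x) \<le> lam * nrm x"
    note xE = im_P_subset_E[OF x]
    define T where "T = fin_sec B n"
    have T: "T \<in> bounded_ops p E" unfolding T_def fin_sec_eq_compress by (rule compress_bounded[OF B(2)])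
    have TC: "\<forall>y\<in>E. nrm (T y) \<le> ?C * nrm y"
      unfolding T_def fin_sec_eq_compress using compress_bound[OF B(2) BC C] by blast
    have Tcomm: "nrm (\<lambda>i. T (wmul t j y) i - wmul t j (T y) i) \<le> e * nrm (wmul t j y)" if y: "y \<in> E" for j y
    proof -
      note Py = restr_in_E[OF y, of "cube n"]
      have "nrm (\<lambda>i. T (wmul t j y) i - wmul t j (T y) i)
          = nrm (restr (cube n) (\<lambda>i. B (wmul t j (restr (cube n) y)) i - wmul t j (B (restr (cube n) y)) i))"
        by (simp add: T_def fin_sec_eq_compress compress_def restr_diff restr_wmul)
      also have "\<dots> \<le> nrm (\<lambda>i. B (wmul t j (restr (cube n) y)) i - wmul t j (B (restr (cube n) y)) i)"
        by (intro nrm_restr diff_in_E bounded_opsD(1)[OF B(2)] wmul_in_E[OF t] Py)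
      also have "\<dots> \<le> e * nrm (restr (cube n) (wmul t j y))"
        unfolding restr_wmul by (rule comm[OF Py])
      also have "\<dots> \<le> e * nrm (wmul t j y)" using nrm_restr[OF wmul_in_E[OF t y]] e by simp
      finally show ?thesis .
    qed
    \<comment> \<open>Ratios above \<open>CA\<close> are replaced by \<open>CA\<close>, so that one radius serves all ratios.\<close>
    define mu where "mu = min lam CA"
    have mu: "0 \<le> mu" "mu \<le> CA" "mu \<le> lam" using lam CA(1) by (auto simp: mu_def)
    have "nrm (fin_sec A n x) \<le> mu * nrm x"
      using le compress_bound[OF Ab CA(2,1) xE, of "cube n"] by (auto simp: mu_def min_def fin_sec_eq_compress)
    then have "nrm (T x) \<le> (mu + e) * nrm x"
      using nrm_le_diff[OF fsE[OF B(2) xE] fsE[OF Ab xE], of n n] diff[OF xE, of n]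
      by (simp add: T_def nrm_minus_commute[of "fin_sec B n x"] distrib_right)
    moreover have "finite {i. T x i \<noteq> 0}"
      by (rule finite_subset[OF _ finite_cube[of n]]) (auto simp: T_def fin_sec_eq_compress compress_def restr_def)
    ultimately obtain j y where y: "y \<noteq> (\<lambda>_. 0)" "\<forall>i. y i \<noteq> 0 \<longrightarrow> x i \<noteq> 0 \<and> i - j \<in> cube R"
      "nrm (T y) \<le> (mu + e + 3 * e) * nrm y"
      using R[rule_format, OF T _ _ im_P_finite_support[OF x] _ x0, of "mu + e"] TC Tcomm mu e by auto
    obtain g where g: "y g \<noteq> 0" using y(1) by blast
    have "finite {i. y i \<noteq> 0}"
      by (rule finite_subset[OF _ im_P_finite_support[OF x]]) (use y(2) in auto)
    then have yE: "y \<in> E" by (rule finite_support_in_E)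
    have "nrm (fin_sec A n y) \<le> (mu + 5 * e) * nrm y"
      using nrm_le_diff[OF fsE[OF Ab yE] fsE[OF B(2) yE], of n n] diff[OF yE, of n] y(3)
      by (simp add: T_def algebra_simps)
    also have "\<dots> \<le> (lam + \<epsilon>) * nrm y"
      using mu nrm_nonneg[OF yE] by (intro mult_right_mono) (auto simp: e_def)
    finally have "nrm (fin_sec A n y) \<le> (lam + \<epsilon>) * nrm y" .
    moreover have "i - g \<in> cube (R + R)" if "y i \<noteq> 0" for i
      using cube_diff[of "i - j" R "g - j" R] y(2) that g by auto
    ultimately show "\<exists>g y. y g \<noteq> 0 \<and> (\<forall>i. y i \<noteq> 0 \<longrightarrow> x i \<noteq> 0 \<and> i - g \<in> cube (R + R)) \<and>
           nrm (fin_sec A n y) \<le> (lam + \<epsilon>) * nrm y"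
      using g y(2) by blast
  qed
qed

text \<open>Localising with an accuracy that depends on the desired error would give a different limit
  operator for every error, and no operator in the stability spectrum attaining the maximum. The
  remedy is to localise repeatedly, with the finest accuracy first: each minimiser is obtained
  inside the support of the previous one, so a point in the support of the last one is close to
  all of them, on the scale that belongs to the respective accuracy.\<close>

lemma nested_localization:
  fixes A :: "('n::finite, 'a::complex_banach) seq_op"
  assumes A: "A \<in> band_dominated p"
  shows "\<exists>\<rho>. \<forall>k n x lam. x \<in> im_P p n \<longrightarrow> x \<noteq> (\<lambda>_. 0) \<longrightarrow> 0 \<le> lam \<longrightarrow>
    nrm (fin_sec A n x) \<le> lam * nrm x \<longrightarrow>
    (\<exists>g. x g \<noteq> 0 \<and> (\<forall>l\<le>k. \<exists>y. y \<noteq> (\<lambda>_. 0) \<and> (\<forall>i. y i \<noteq> 0 \<longrightarrow> x i \<noteq> 0 \<and> i - g \<in> cube (\<rho> l)) \<and>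
           nrm (fin_sec A n y) \<le> (lam + (\<Sum>i=l..k. (1/2)^i)) * nrm y))"
proof -
  have "\<forall>l. \<exists>R. \<forall>n x lam. x \<in> im_P p n \<longrightarrow> x \<noteq> (\<lambda>_. 0) \<longrightarrow> 0 \<le> lam \<longrightarrow>
    nrm (fin_sec A n x) \<le> lam * nrm x \<longrightarrow>
    (\<exists>g y. y g \<noteq> 0 \<and> (\<forall>i. y i \<noteq> 0 \<longrightarrow> x i \<noteq> 0 \<and> i - g \<in> cube R) \<and>
           nrm (fin_sec A n y) \<le> (lam + (1/2)^l) * nrm y)"
    by (intro allI fin_sec_localization[OF A]) simp
  then obtain R where R: "\<forall>l n x lam. x \<in> im_P p n \<longrightarrow> x \<noteq> (\<lambda>_. 0) \<longrightarrow> 0 \<le> lam \<longrightarrow>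
    nrm (fin_sec A n x) \<le> lam * nrm x \<longrightarrow>
    (\<exists>g y. y g \<noteq> 0 \<and> (\<forall>i. y i \<noteq> 0 \<longrightarrow> x i \<noteq> 0 \<and> i - g \<in> cube (R l)) \<and>
           nrm (fin_sec A n y) \<le> (lam + (1/2)^l) * nrm y)"
    by metis
  define \<rho> where "\<rho> l = R l + R l" for l
  have "\<exists>g. x g \<noteq> 0 \<and> (\<forall>l\<le>k. \<exists>y. y \<noteq> (\<lambda>_. 0) \<and> (\<forall>i. y i \<noteq> 0 \<longrightarrow> x i \<noteq> 0 \<and> i - g \<in> cube (\<rho> l)) \<and>
           nrm (fin_sec A n y) \<le> (lam + (\<Sum>i=l..k. (1/2)^i)) * nrm y)"
    if x: "x \<in> im_P p n" "x \<noteq> (\<lambda>_. 0)" "0 \<le> lam" "nrm (fin_sec A n x) \<le> lam * nrm x"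
    for k n x lam
    using x
  proof (induction k arbitrary: x lam)
    case 0
    obtain g y where y: "y g \<noteq> 0" "\<forall>i. y i \<noteq> 0 \<longrightarrow> x i \<noteq> 0 \<and> i - g \<in> cube (R 0)"
      "nrm (fin_sec A n y) \<le> (lam + (1/2)^0) * nrm y"
      using R[rule_format, OF 0, of 0] by blast
    have "y i \<noteq> 0 \<longrightarrow> x i \<noteq> 0 \<and> i - g \<in> cube (\<rho> 0)" for i
      using y(2) cube_mono[of "R 0" "\<rho> 0" "i - g"] by (auto simp: \<rho>_def)
    then show ?case using y by (intro exI[of _ g] conjI) (auto intro!: exI[of _ y])
  next
    case (Suc k)
    let ?k = "Suc k"
    obtain j z where z: "z j \<noteq> 0" "\<forall>i. z i \<noteq> 0 \<longrightarrow> x i \<noteq> 0 \<and> i - j \<in> cube (R ?k)"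
      "nrm (fin_sec A n z) \<le> (lam + (1/2)^?k) * nrm z"
      using R[rule_format, OF Suc.prems, of ?k] by blast
    have z0: "z \<noteq> (\<lambda>_. 0)" using z(1) by auto
    have zP: "z \<in> im_P p n" using z(2) Suc.prems(1) by (auto simp: im_P_eq)
    obtain g where g: "z g \<noteq> 0" and IH: "\<forall>l\<le>k. \<exists>y. y \<noteq> (\<lambda>_. 0) \<and> (\<forall>i. y i \<noteq> 0 \<longrightarrow> z i \<noteq> 0 \<and> i - g \<in> cube (\<rho> l)) \<and>
           nrm (fin_sec A n y) \<le> (lam + (1/2)^?k + (\<Sum>i=l..k. (1/2)^i)) * nrm y"
      using Suc.IH[OF zP z0 _ z(3)] Suc.prems(3) by auto
    show ?case
    proof (intro exI[of _ g] conjI allI impI)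
      show "x g \<noteq> 0" using g z(2) by blast
      fix l assume l: "l \<le> ?k"
      show "\<exists>y. y \<noteq> (\<lambda>_. 0) \<and> (\<forall>i. y i \<noteq> 0 \<longrightarrow> x i \<noteq> 0 \<and> i - g \<in> cube (\<rho> l)) \<and>
           nrm (fin_sec A n y) \<le> (lam + (\<Sum>i=l..?k. (1/2)^i)) * nrm y"
      proof (cases "l = ?k")
        case True
        have "i - g \<in> cube (\<rho> ?k)" if "z i \<noteq> 0" for i
          using cube_diff[of "i - j" "R ?k" "g - j" "R ?k"] z(2) that g by (auto simp: \<rho>_def)
        then show ?thesis using z z0 True by (intro exI[of _ z]) auto
      next
        case False
        then have "l \<le> k" using l by simp
        then obtain y where y: "y \<noteq> (\<lambda>_. 0)" "\<forall>i. y i \<noteq> 0 \<longrightarrow> z i \<noteq> 0 \<and> i - g \<in> cube (\<rho> l)"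
           "nrm (fin_sec A n y) \<le> (lam + (1/2)^?k + (\<Sum>i=l..k. (1/2)^i)) * nrm y"
          using IH by blast
        have "(\<Sum>i=l..?k. (1/2::real)^i) = (1/2)^?k + (\<Sum>i=l..k. (1/2)^i)"
          using l by (simp add: sum.cl_ivl_Suc)
        then show ?thesis using y z(2) by (intro exI[of _ y]) (auto simp: add.assoc)
      qed
    qed
  qed
  then show ?thesis by blast
qed

end

section \<open>Limits of uniformly local sequences of operators\<close>

context lp_exponent
begin

text \<open>The properties that band-dominated operators share with all their translated sections, with
  constants that do not depend on the member of the sequence.\<close>

definition uniformly_local :: "(nat \<Rightarrow> ('n::finite, 'a::complex_banach) seq_op) \<Rightarrow> bool" where
  "uniformly_local B \<longleftrightarrow>
     (\<forall>k. B k \<in> bounded_ops p E) \<and> (\<exists>C\<ge>0. \<forall>k. \<forall>x\<in>E. nrm (B k x) \<le> C * nrm x) \<and>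
     (\<forall>\<epsilon>>0. \<exists>t0>0. \<forall>t\<ge>t0. \<forall>k j. \<forall>x\<in>E. nrm (\<lambda>i. B k (wmul t j x) i - wmul t j (B k x) i) \<le> \<epsilon> * nrm x)"

text \<open>Rows and columns are the two halves of P-strong convergence, tested on the projections only. The
  inheritance of lower bounds and of surjectivity needs the convergence of rows; the transport of
  a minimiser to the limit needs the convergence of columns.\<close>

definition row_limit ::
    "(nat \<Rightarrow> ('n::finite, 'a::complex_banach) seq_op) \<Rightarrow> ('n, 'a) seq_op \<Rightarrow> bool" where
  "row_limit B S \<longleftrightarrow>
     (\<forall>m. \<forall>\<epsilon>>0. \<forall>\<^sub>F k in sequentially. \<forall>x\<in>E. nrm (restr (cube m) (\<lambda>i. B k x i - S x i)) \<le> \<epsilon> * nrm x)"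

definition column_limit ::
    "(nat \<Rightarrow> ('n::finite, 'a::complex_banach) seq_op) \<Rightarrow> ('n, 'a) seq_op \<Rightarrow> bool" where
  "column_limit B S \<longleftrightarrow>
     (\<forall>m. \<forall>\<epsilon>>0. \<forall>\<^sub>F k in sequentially. \<forall>x\<in>E.
        nrm (\<lambda>i. B k (restr (cube m) x) i - S (restr (cube m) x) i) \<le> \<epsilon> * nrm x)"

lemma nrm_wmul_le_near_far:
  assumes t: "0 < t" and z: "z \<in> E"
  shows "nrm (wmul t j z) \<le> nrm (restr {i. i - j \<in> cube r} z) + exp (- real r / t) * nrm z"
proof -
  let ?U = "{i. i - j \<in> cube r}"
  have "nrm (wmul t j z) \<le> nrm (wmul t j (restr ?U z)) + nrm (wmul t j (restr (- ?U) z))"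
    using nrm_triangle[OF wmul_in_E[OF t restr_in_E[OF z, of ?U], of j] wmul_in_E[OF t restr_in_E[OF z, of "- ?U"], of j]]
    unfolding wmul_add[symmetric] restr_split[symmetric] .
  also have "\<dots> \<le> nrm (restr ?U z) + exp (- real r / t) * nrm (restr (- ?U) z)"
    by (intro add_mono nrm_wmul nrm_wmul_tail restr_in_E t z) (simp add: restr_def)
  also have "\<dots> \<le> nrm (restr ?U z) + exp (- real r / t) * nrm z"
    by (intro add_left_mono mult_left_mono nrm_restr z) simp
  finally show ?thesis .
qed

lemma exp_tail_small:
  fixes t e :: real
  assumes "0 < t" "0 < e"
  obtains r :: nat where "exp (- real r / t) < e"
proof -
  have "((\<lambda>r. exp (- real r / t)) \<longlongrightarrow> 0) sequentially"
    using assms(1) by real_asymp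
  then have "\<forall>\<^sub>F r in sequentially. exp (- real r / t) < e"
    by (rule order_tendstoD(2)) (rule assms(2))
  then show ?thesis using that by (auto simp: eventually_sequentially)
qed

lemma nrm_restr_mono:
  assumes "x \<in> E" "U \<subseteq> V"
  shows "nrm (restr U x) \<le> nrm (restr V x)"
  by (rule dominated_nrm[OF restr_in_E[OF assms(1)]]) (use assms(2) in \<open>auto simp: restr_def\<close>)

lemma nrm_finite_le_sum:
  fixes x :: "'i \<Rightarrow> 'a::real_normed_vector"
  assumes "finite F"
  shows "nrm (restr F x) \<le> (\<Sum>i\<in>F. norm (x i))"
  using assms
proof induction
  case empty
  then show ?case by (simp add: restr_def nrm_zero)
next
  case (insert i F)
  have fin: "restr G x \<in> E" if "finite G" for G
    by (rule finite_support_in_E, rule finite_subset[OF _ that]) (auto simp: restr_def)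
  have single: "nrm (restr {i} x) \<le> norm (x i)"
  proof (cases rule: exponent_cases)
    case sup
    show ?thesis unfolding nrm_sup[OF sup] by (rule cSUP_least) (auto simp: restr_def)
  next
    case (pow q)
    have "(\<Sum>\<^sub>\<infinity>k. norm (restr {i} x k) powr q) = (\<Sum>\<^sub>\<infinity>k\<in>{i}. norm (x k) powr q)"
      by (rule infsum_cong_neutral) (auto simp: restr_def)
    then show ?thesis
      using nrm_le_iff_pow[OF pow fin[of "{i}"], of "norm (x i)"] by simp
  qed
  have "restr (insert i F) x = (\<lambda>k. restr {i} x k + restr F x k)"
    using insert.hyps by (auto simp: restr_def)
  then have "nrm (restr (insert i F) x) \<le> nrm (restr {i} x) + nrm (restr F x)"
    using nrm_triangle[OF fin[of "{i}"] fin[OF insert.hyps(1)]] by simp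
  then show ?case using single insert by simp
qed

text \<open>A weight is concentrated on a finite cube around its centre up to an arbitrarily small tail, and the
  tail is controlled by the common bound of the operators.\<close>

lemma weighted_row_limit:
  fixes B :: "nat \<Rightarrow> ('n::finite, 'a::complex_banach) seq_op"
  assumes B: "uniformly_local B" and S: "S \<in> bounded_ops p E" and lim: "row_limit B S"
    and t: "0 < t" and \<epsilon>: "0 < \<epsilon>"
  shows "\<forall>\<^sub>F k in sequentially. \<forall>x\<in>E. nrm (wmul t j (\<lambda>i. B k x i - S x i)) \<le> \<epsilon> * nrm x"
proof -
  have Bb: "B k \<in> bounded_ops p E" for k using B by (simp add: uniformly_local_def)
  obtain C where C: "0 \<le> C" "\<And>k x. x \<in> E \<Longrightarrow> nrm (B k x) \<le> C * nrm x"
    using B unfolding uniformly_local_def by blast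
  obtain D where D: "0 \<le> D" "\<And>x. x \<in> E \<Longrightarrow> nrm (S x) \<le> D * nrm x"
    using bounded_ops_bound[OF seq_subspace_E S] by blast
  have e: "0 < \<epsilon> / 2 / (C + D + 1)" using \<epsilon> C D by simp
  obtain r where r: "exp (- real r / t) < \<epsilon> / 2 / (C + D + 1)"
    using exp_tail_small[OF t e] by blast
  let ?m = "r + nat (sup_abs j)"
  have sub: "{i. i - j \<in> cube r} \<subseteq> cube ?m"
    using cube_add[OF _ in_cube_sup_abs[of j], of _ r] by (metis (no_types, lifting) diff_add_cancel mem_Collect_eq subsetI)
  have "\<forall>\<^sub>F k in sequentially. \<forall>x\<in>E. nrm (restr (cube ?m) (\<lambda>i. B k x i - S x i)) \<le> \<epsilon> / 2 * nrm x"
    using lim[unfolded row_limit_def, rule_format, of "\<epsilon> / 2" ?m] \<epsilon> by simp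
  then show ?thesis
  proof (rule eventually_mono, intro ballI)
    fix k and x :: "('n, 'a) seqs"
    assume k: "\<forall>x\<in>E. nrm (restr (cube ?m) (\<lambda>i. B k x i - S x i)) \<le> \<epsilon> / 2 * nrm x" and x: "x \<in> E"
    let ?z = "\<lambda>i. B k x i - S x i"
    have z: "?z \<in> E" by (intro diff_in_E bounded_opsD(1)[OF Bb] bounded_opsD(1)[OF S] x)
    have "nrm ?z \<le> (C + D) * nrm x"
      using nrm_diff[OF bounded_opsD(1)[OF Bb x] bounded_opsD(1)[OF S x], of k] C(2)[OF x, of k] D(2)[OF x]
      by (simp add: distrib_right)
    also have "\<dots> \<le> (C + D + 1) * nrm x" using nrm_nonneg[OF x] by (simp add: distrib_right)
    finally have zb: "nrm ?z \<le> (C + D + 1) * nrm x" .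
    have "exp (- real r / t) * nrm ?z \<le> \<epsilon> / 2 / (C + D + 1) * ((C + D + 1) * nrm x)"
      using r zb nrm_nonneg[OF z] e by (intro mult_mono) auto
    also have "\<dots> = \<epsilon> / 2 * nrm x"
    proof -
      have cancel: "\<epsilon> / 2 / a * (a * b) = \<epsilon> / 2 * b" if "a \<noteq> 0" for a b :: real
        using that by simp
      show ?thesis by (rule cancel) (use C(1) D(1) in simp)
    qed
    finally have far: "exp (- real r / t) * nrm ?z \<le> \<epsilon> / 2 * nrm x" .
    have "nrm (restr {i. i - j \<in> cube r} ?z) \<le> \<epsilon> / 2 * nrm x"
      using nrm_restr_mono[OF z sub] k x by fastforce
    then show "nrm (wmul t j ?z) \<le> \<epsilon> * nrm x"
      using nrm_wmul_le_near_far[OF t z, of j r] far by simp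
  qed
qed

text \<open>For the supremum norm the limit cannot be tested on finitely supported sequences only.
  Testing it on the weighted sequence works for all exponents: the weight makes convergence of
  the rows sufficient, and it commutes with all operators up to a uniformly small error.\<close>

lemma limit_lower_bound:
  fixes B :: "nat \<Rightarrow> ('n::finite, 'a::complex_banach) seq_op"
  assumes B: "uniformly_local B" and S: "S \<in> bounded_ops p E" and lim: "row_limit B S"
    and \<delta>: "0 < \<delta>" and low: "\<forall>\<^sub>F k in sequentially. \<forall>x\<in>E. \<delta> * nrm x \<le> nrm (B k x)"
    and x: "x \<in> E"
  shows "\<delta> * nrm x \<le> nrm (S x)"
proof -
  have Bb: "B k \<in> bounded_ops p E" for k using B by (simp add: uniformly_local_def)
  note SxE = bounded_opsD(1)[OF S x]
  have part: "\<delta> * nrm (restr F x) \<le> nrm (S x)" if F: "finite F" for F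
  proof (rule field_le_epsilon)
    fix e :: real assume e: "0 < e"
    define \<epsilon> where "\<epsilon> = e / (2 * nrm x + 1)"
    have \<epsilon>: "0 < \<epsilon>" "\<epsilon> * (2 * nrm x) \<le> e"
      using e nrm_nonneg[OF x] by (auto simp: \<epsilon>_def field_simps)
    obtain t0 where t0: "0 < t0" "\<forall>t\<ge>t0. \<forall>k j. \<forall>x\<in>E. nrm (\<lambda>i. B k (wmul t j x) i - wmul t j (B k x) i) \<le> \<epsilon> * nrm x"
      using B \<epsilon>(1) unfolding uniformly_local_def by blast
    define M where "M = (\<Sum>i\<in>F. ell1 i)"
    have M: "ell1 i \<le> M" if "i \<in> F" for i
      unfolding M_def by (rule member_le_sum) (use F that ell1_nonneg in auto)
    have bound: "\<delta> * nrm (restr F x) \<le> exp (M / t) * (nrm (S x) + e)" if t: "t0 \<le> t" for t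
    proof -
      have tpos: "0 < t" using t t0(1) by simp
      note W = wmul_in_E[OF tpos]
      have "\<forall>\<^sub>F k in sequentially. \<forall>x\<in>E. nrm (wmul t 0 (\<lambda>i. B k x i - S x i)) \<le> \<epsilon> * nrm x"
        by (rule weighted_row_limit[OF B S lim tpos \<epsilon>(1)])
      then have "\<forall>\<^sub>F k in sequentially. (\<forall>x\<in>E. nrm (wmul t 0 (\<lambda>i. B k x i - S x i)) \<le> \<epsilon> * nrm x)
          \<and> (\<forall>x\<in>E. \<delta> * nrm x \<le> nrm (B k x))"
        using low by (rule eventually_conj)
      then obtain k where k: "nrm (wmul t 0 (\<lambda>i. B k x i - S x i)) \<le> \<epsilon> * nrm x"
        "\<And>y. y \<in> E \<Longrightarrow> \<delta> * nrm y \<le> nrm (B k y)"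
        using x by (auto simp: eventually_sequentially)
      note BxE = bounded_opsD(1)[OF Bb x, of k]
      have "\<delta> * nrm (wmul t 0 x) \<le> nrm (B k (wmul t 0 x))" by (rule k(2)[OF W[OF x]])
      also have "\<dots> \<le> nrm (wmul t 0 (B k x)) + \<epsilon> * nrm x"
        using nrm_le_diff[OF bounded_opsD(1)[OF Bb W[OF x]] W[OF BxE], of k 0 0]
          t0(2)[rule_format, OF t x, of k 0] by linarith
      also have "nrm (wmul t 0 (B k x)) \<le> nrm (wmul t 0 (S x)) + \<epsilon> * nrm x"
        using nrm_le_diff[OF W[OF BxE] W[OF SxE], of 0 0] k(1) by (simp add: wmul_diff)
      also have "nrm (wmul t 0 (S x)) \<le> nrm (S x)" by (rule nrm_wmul[OF tpos SxE])
      finally have "\<delta> * nrm (wmul t 0 x) \<le> nrm (S x) + e" using \<epsilon>(2) by simp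
      moreover have "nrm (restr F x) \<le> exp (M / t) * nrm (wmul t 0 x)"
      proof -
        have "nrm (restr F x) \<le> exp (M / t) * nrm (wmul t 0 (restr F x))"
          by (rule nrm_le_wmul[OF tpos restr_in_E[OF x]]) (auto simp: restr_def M split: if_splits)
        also have "nrm (wmul t 0 (restr F x)) \<le> nrm (wmul t 0 x)"
          unfolding restr_wmul[symmetric] by (rule nrm_restr[OF W[OF x]])
        finally show ?thesis by simp
      qed
      ultimately have "\<delta> * nrm (restr F x) \<le> exp (M / t) * (\<delta> * nrm (wmul t 0 x))"
        using mult_left_mono[of "nrm (restr F x)" "exp (M / t) * nrm (wmul t 0 x)" \<delta>] \<delta>
        by (simp add: mult.left_commute)
      also have "\<dots> \<le> exp (M / t) * (nrm (S x) + e)"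
        using \<open>\<delta> * nrm (wmul t 0 x) \<le> nrm (S x) + e\<close> by simp
      finally show ?thesis .
    qed
    have "((\<lambda>t. exp (M / t) * (nrm (S x) + e)) \<longlongrightarrow> exp 0 * (nrm (S x) + e)) at_top"
      by (intro tendsto_intros real_tendsto_divide_at_top[OF tendsto_const] filterlim_ident)
    then have "((\<lambda>t. exp (M / t) * (nrm (S x) + e)) \<longlongrightarrow> nrm (S x) + e) at_top" by simp
    moreover have "\<forall>\<^sub>F t in at_top. \<delta> * nrm (restr F x) \<le> exp (M / t) * (nrm (S x) + e)"
      using bound by (auto simp: eventually_at_top_linorder)
    ultimately show "\<delta> * nrm (restr F x) \<le> nrm (S x) + e"
      by (rule tendsto_lowerbound) simp
  qed
  have "nrm x \<le> nrm (S x) / \<delta>"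
    by (rule nrm_le_finite_restr) (use part \<delta> in \<open>simp add: field_simps\<close>)
  then show ?thesis using \<delta> by (simp add: field_simps)
qed

text \<open>For exponent 0 the solutions of a limit equation must be shown to vanish at infinity. This is tested
  with weights whose centres move away, which do not see a right-hand side that vanishes at infinity.\<close>

lemma lp_0_weight_small:
  fixes y :: "int ^ 'n::finite \<Rightarrow> 'a::real_normed_vector"
  assumes p0: "p = 0" and y: "y \<in> E" and t: "0 < t" and e: "0 < e"
  obtains m where "\<And>j. j \<notin> cube m \<Longrightarrow> nrm (wmul t j y) \<le> e"
proof -
  have "finite {i. e \<le> norm (y i)}"
    using y e p0 by (simp add: lp_space_0_iff)
  then obtain r0 where r0: "{i. e \<le> norm (y i)} \<subseteq> cube r0" by (rule finite_subset_cube)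
  have e': "0 < e / (nrm y + 1)" using e nrm_nonneg[OF y] by simp
  obtain r where r: "exp (- real r / t) < e / (nrm y + 1)"
    using exp_tail_small[OF t e'] by blast
  show ?thesis
  proof (rule that[of "r0 + r"])
    fix j :: "int ^ 'n" assume j: "j \<notin> cube (r0 + r)"
    show "nrm (wmul t j y) \<le> e"
      unfolding nrm_sup[OF disjI1[OF p0]]
    proof (rule cSUP_least)
      fix i
      show "norm (wmul t j y i) \<le> e"
      proof (cases "i \<in> cube r0")
        case True
        have "i - j \<notin> cube r"
          using cube_diff[OF True, of "i - j" r] j by auto
        then have "weight t j i * norm (y i) \<le> e / (nrm y + 1) * nrm y"
          using weight_outside_cube[OF t, of i j r] r nrm_coord[OF y, of i] e' weight_pos[of t j i]
          by (intro mult_mono) auto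
        also have "\<dots> \<le> e" using e nrm_nonneg[OF y] by (simp add: field_simps)
        finally show ?thesis by (simp add: wmul_def weight_pos less_imp_le abs_of_nonneg)
      next
        case False
        then have "norm (y i) \<le> e" using r0 linear[of "norm (y i)" e] by blast
        moreover have "weight t j i * norm (y i) \<le> 1 * norm (y i)"
          by (intro mult_right_mono weight_le_1 t) simp
        ultimately show ?thesis by (simp add: wmul_def weight_pos less_imp_le abs_of_nonneg)
      qed
    qed simp
  qed
qed

text \<open>A solution of \<open>S x = y\<close> is the coordinatewise limit of the solutions of \<open>B k x = y\<close>. Weights
  centred at a coordinate turn the resolvent identity into a Cauchy estimate for that coordinate;
  for exponent 0 weights with distant centres show that the limit vanishes at infinity.\<close>

lemma limit_surjective:
  fixes B :: "nat \<Rightarrow> ('n::finite, 'a::complex_banach) seq_op"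
  assumes B: "uniformly_local B" and S: "S \<in> bounded_ops p E" and lim: "row_limit B S"
    and \<delta>: "0 < \<delta>" and low: "\<forall>\<^sub>F k in sequentially. \<forall>x\<in>E. \<delta> * nrm x \<le> nrm (B k x)"
    and surj: "\<forall>\<^sub>F k in sequentially. \<forall>y\<in>E. \<exists>x\<in>E. B k x = y"
    and y: "y \<in> E"
  shows "\<exists>x\<in>E. S x = y"
proof -
  have Bb: "B k \<in> bounded_ops p E" for k using B by (simp add: uniformly_local_def)
  note BE = bounded_opsD(1)[OF Bb] and SE = bounded_opsD(1)[OF S]
  obtain C where C: "0 \<le> C" "\<And>k x. x \<in> E \<Longrightarrow> nrm (B k x) \<le> C * nrm x"
    using B unfolding uniformly_local_def by blast
  obtain N where N0: "\<forall>k\<ge>N. (\<forall>x\<in>E. \<delta> * nrm x \<le> nrm (B k x)) \<and> (\<forall>y\<in>E. \<exists>x\<in>E. B k x = y)"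
    using eventually_conj[OF low surj] by (auto simp: eventually_sequentially)
  have N: "\<delta> * nrm x \<le> nrm (B k x)" if "N \<le> k" "x \<in> E" for k x
    using N0 that by blast
  have sN: "\<exists>x\<in>E. B k x = y" if "N \<le> k" for k
    using N0 that y by blast
  obtain X where X: "\<And>k. N \<le> k \<Longrightarrow> X k \<in> E" "\<And>k. N \<le> k \<Longrightarrow> B k (X k) = y"
    using sN by metis
  define K where "K = nrm y / \<delta> + 1"
  have K: "0 < K" using nrm_nonneg[OF y] \<delta> by (simp add: K_def add_nonneg_pos)
  have XK: "nrm (X k) \<le> K" if "N \<le> k" for k
    using N[OF that X(1)[OF that]] X(2)[OF that] \<delta> by (simp add: K_def field_simps)
  have key: "\<exists>t0>0. \<forall>t\<ge>t0. \<forall>k\<ge>N. \<forall>j. \<forall>z\<in>E. \<delta> * nrm (wmul t j z) \<le> nrm (wmul t j (B k z)) + \<epsilon> * nrm z \<and>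
       nrm (wmul t j (B k z)) \<le> C * nrm (wmul t j z) + \<epsilon> * nrm z"
    if \<epsilon>: "0 < \<epsilon>" for \<epsilon>
  proof -
    obtain t0 where t0: "0 < t0" "\<forall>t\<ge>t0. \<forall>k j. \<forall>x\<in>E. nrm (\<lambda>i. B k (wmul t j x) i - wmul t j (B k x) i) \<le> \<epsilon> * nrm x"
      using B \<epsilon> unfolding uniformly_local_def by blast
    show ?thesis
    proof (intro exI[of _ t0] conjI t0(1) allI impI ballI)
      fix t k j z assume t: "t0 \<le> t" and k: "N \<le> k" and z: "(z :: ('n, 'a) seqs) \<in> E"
      have tpos: "0 < t" using t t0(1) by simp
      note W = wmul_in_E[OF tpos]
      have c: "nrm (\<lambda>i. B k (wmul t j z) i - wmul t j (B k z) i) \<le> \<epsilon> * nrm z"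
        using t0(2) t z by blast
      show "\<delta> * nrm (wmul t j z) \<le> nrm (wmul t j (B k z)) + \<epsilon> * nrm z"
        using N[OF k W[OF z, of j]] nrm_le_diff[OF BE[OF W[OF z]] W[OF BE[OF z]], of k j j k] c by linarith
      show "nrm (wmul t j (B k z)) \<le> C * nrm (wmul t j z) + \<epsilon> * nrm z"
        using C(2)[OF W[OF z], of k j] nrm_le_diff[OF W[OF BE[OF z]] BE[OF W[OF z]], of j k k j] c
          nrm_minus_commute[of "B k (wmul t j z)" "wmul t j (B k z)"] by linarith
    qed
  qed
  have conv: "convergent (\<lambda>k. X k i)" for i
  proof (rule Cauchy_convergent, rule CauchyI)
    fix e :: real assume e: "0 < e"
    define \<epsilon> where "\<epsilon> = \<delta> * e / (8 * K)"
    have \<epsilon>: "0 < \<epsilon>" "4 * (\<epsilon> * K) = \<delta> * e / 2" using e \<delta> K by (auto simp: \<epsilon>_def)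
    obtain t where t: "0 < t" and kt: "\<forall>k\<ge>N. \<forall>j. \<forall>z\<in>E. \<delta> * nrm (wmul t j z) \<le> nrm (wmul t j (B k z)) + \<epsilon> * nrm z"
      using key[OF \<epsilon>(1)] by blast
    note W = wmul_in_E[OF t]
    obtain N' where N': "\<And>k x. N' \<le> k \<Longrightarrow> x \<in> E \<Longrightarrow> nrm (wmul t i (\<lambda>i. B k x i - S x i)) \<le> \<epsilon> * nrm x"
      using weighted_row_limit[OF B S lim t \<epsilon>(1), of i] by (auto simp: eventually_sequentially)
    show "\<exists>M. \<forall>m\<ge>M. \<forall>n\<ge>M. norm (X m i - X n i) < e"
    proof (intro exI[of _ "max N N'"] allI impI)
      fix m n assume mn: "max N N' \<le> m" "max N N' \<le> n"
      have XE: "X m \<in> E" "X n \<in> E" using X(1) mn by auto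
      let ?z = "\<lambda>i. X m i - X n i"
      have z: "?z \<in> E" by (rule diff_in_E[OF XE])
      have zK: "nrm ?z \<le> 2 * K" using nrm_diff[OF XE] XK[of m] XK[of n] mn by simp
      have Bz: "wmul t i (B m ?z) = (\<lambda>l. wmul t i (\<lambda>i. B n (X n) i - S (X n) i) l - wmul t i (\<lambda>i. B m (X n) i - S (X n) i) l)"
        unfolding bounded_ops_diff[OF seq_subspace_E Bb XE] wmul_diff[symmetric] using X(2)[of m] X(2)[of n] mn by simp
      have "nrm (wmul t i (B m ?z)) \<le> \<epsilon> * nrm (X n) + \<epsilon> * nrm (X n)"
        unfolding Bz
        by (rule order_trans[OF nrm_diff[OF W W] add_mono[OF N' N']]) (use mn XE in \<open>auto intro!: diff_in_E BE SE\<close>)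
      also have "\<dots> \<le> 2 * (\<epsilon> * K)" using XK[of n] mn \<epsilon>(1) by simp
      finally have 1: "nrm (wmul t i (B m ?z)) \<le> 2 * (\<epsilon> * K)" .
      have "\<delta> * norm (X m i - X n i) \<le> \<delta> * nrm (wmul t i ?z)"
        using nrm_coord_wmul[OF t z, of i] \<delta> by simp
      also have "\<dots> \<le> nrm (wmul t i (B m ?z)) + \<epsilon> * nrm ?z" using kt mn z by simp
      also have "\<dots> \<le> 2 * (\<epsilon> * K) + \<epsilon> * (2 * K)"
        using 1 mult_left_mono[OF zK, of \<epsilon>] \<epsilon>(1) by linarith
      also have "\<dots> = \<delta> * e / 2" using \<epsilon>(2) by (simp add: algebra_simps)
      also have "\<dots> < \<delta> * e" using e \<delta> by simp
      finally show "norm (X m i - X n i) < e" using \<delta> by simp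
    qed
  qed
  define x where "x i = lim (\<lambda>k. X k i)" for i
  have Xx: "(\<lambda>k. X k i) \<longlonglongrightarrow> x i" for i
    using conv convergent_LIMSEQ_iff unfolding x_def by blast
  have restr_conv: "\<forall>\<^sub>F k in sequentially. nrm (restr F (\<lambda>i. x i - X k i)) < e" if "finite F" "0 < e" for F e
  proof -
    have "(\<lambda>k. \<Sum>i\<in>F. norm (x i - X k i)) \<longlonglongrightarrow> (\<Sum>i\<in>F. norm (x i - x i))"
      by (intro tendsto_intros Xx)
    then have "\<forall>\<^sub>F k in sequentially. (\<Sum>i\<in>F. norm (x i - X k i)) < e"
      by (rule order_tendstoD(2)) (use that in simp)
    then show ?thesis
      by (rule eventually_mono) (rule le_less_trans[OF nrm_finite_le_sum[OF that(1)]])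
  qed
  have fin: "restr F v \<in> E" if "finite F" for F and v :: "('n, 'a) seqs"
    by (rule finite_support_in_E, rule finite_subset[OF _ that]) (auto simp: restr_def)
  have xK: "nrm (restr F x) \<le> K" if F: "finite F" for F
  proof (rule field_le_epsilon)
    fix e :: real assume e: "0 < e"
    obtain k where k: "N \<le> k" "nrm (restr F (\<lambda>i. x i - X k i)) < e"
      using eventually_conj[OF restr_conv[OF F e] eventually_ge_at_top[of N]] by (auto simp: eventually_sequentially)
    have "nrm (restr F x) \<le> nrm (restr F (X k)) + nrm (\<lambda>i. restr F x i - restr F (X k) i)"
      by (rule nrm_le_diff[OF fin[OF F] fin[OF F]])
    also have "\<dots> \<le> K + e"
      using k nrm_restr[OF X(1)[OF k(1)], of F] XK[OF k(1)] by (simp add: restr_diff)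
    finally show "nrm (restr F x) \<le> K + e" .
  qed
  have xE: "x \<in> E"
  proof (cases "p = 0")
    case False
    then show ?thesis using in_E_finite_restr[of x K] xK by blast
  next
    case True
    have "finite {i. e \<le> norm (x i)}" if e: "0 < e" for e
    proof -
      define \<epsilon> where "\<epsilon> = \<delta> * e / (4 * K)"
      have \<epsilon>: "0 < \<epsilon>" "\<epsilon> * K = \<delta> * e / 4" using e \<delta> K by (auto simp: \<epsilon>_def)
      obtain t where t: "0 < t" and kt: "\<forall>k\<ge>N. \<forall>j. \<forall>z\<in>E. \<delta> * nrm (wmul t j z) \<le> nrm (wmul t j (B k z)) + \<epsilon> * nrm z"
        using key[OF \<epsilon>(1)] by blast
      have de: "0 < \<delta> * e / 4" using \<delta> e by simp
      obtain m where m: "\<And>j. j \<notin> cube m \<Longrightarrow> nrm (wmul t j y) \<le> \<delta> * e / 4"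
        using lp_0_weight_small[OF True y t de] by blast
      have "norm (x j) < e" if j: "j \<notin> cube m" for j
      proof -
        have "\<delta> * norm (X k j) \<le> \<delta> * e / 2" if k: "N \<le> k" for k
        proof -
          have "\<delta> * norm (X k j) \<le> \<delta> * nrm (wmul t j (X k))"
            using nrm_coord_wmul[OF t X(1)[OF k], of j] \<delta> by simp
          also have "\<dots> \<le> nrm (wmul t j y) + \<epsilon> * nrm (X k)"
            using kt k X by metis
          also have "\<dots> \<le> \<delta> * e / 4 + \<epsilon> * K"
            using m[OF j] XK[OF k] \<epsilon>(1) by (intro add_mono mult_left_mono) auto
          finally show ?thesis using \<epsilon>(2) by simp
        qed
        then have "norm (X k j) \<le> e / 2" if "N \<le> k" for k using that \<delta> by force
        then have "norm (x j) \<le> e / 2"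
          by (intro LIMSEQ_le_const2[OF tendsto_norm[OF Xx]]) blast
        then show ?thesis using e by simp
      qed
      then have "{i. e \<le> norm (x i)} \<subseteq> cube m" by force
      then show ?thesis by (rule finite_subset[OF _ finite_cube])
    qed
    moreover have "bounded (range x)"
    proof -
      have "norm (x i) \<le> K" for i
        using nrm_coord[OF fin[of "{i}" x], of i] xK[of "{i}"] by (simp add: restr_def)
      then show ?thesis by (auto simp: bounded_iff)
    qed
    ultimately show ?thesis using True by (simp add: lp_space_0_iff)
  qed
  have xnK: "nrm x \<le> K" by (rule nrm_le_finite_restr[OF xK])
  have "S x i = y i" for i
  proof -
    have "norm (S x i - y i) \<le> e" if e: "0 < e" for e
    proof -
      define \<epsilon> where "\<epsilon> = e / (4 * K)"
      have \<epsilon>: "0 < \<epsilon>" "\<epsilon> * K = e / 4" using e K by (auto simp: \<epsilon>_def)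
      obtain t where t: "0 < t" and kt: "\<forall>k\<ge>N. \<forall>j. \<forall>z\<in>E. nrm (wmul t j (B k z)) \<le> C * nrm (wmul t j z) + \<epsilon> * nrm z"
        using key[OF \<epsilon>(1)] by blast
      note W = wmul_in_E[OF t]
      define \<eta> where "\<eta> = e / (4 * (C + 1))"
      have \<eta>: "0 < \<eta>" "C * \<eta> \<le> e / 4" using e C(1) by (auto simp: \<eta>_def field_simps)
      have e': "0 < \<eta> / 2 / (2 * K)" using \<eta> K by simp
      obtain r where r: "exp (- real r / t) < \<eta> / 2 / (2 * K)"
        using exp_tail_small[OF t e'] by blast
      let ?U = "{l. l - i \<in> cube r}"
      have "?U = (\<lambda>l. l + i) ` cube r" by (auto intro: image_eqI[of _ _ "_ - i"])
      then have finU: "finite ?U" by (simp only: finite_imageI[OF finite_cube])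
      have h2: "0 < \<eta> / 2" using \<eta> by simp
      obtain k where k: "N \<le> k" "nrm (restr ?U (\<lambda>l. x l - X k l)) < \<eta> / 2"
        "nrm (wmul t i (\<lambda>l. B k x l - S x l)) \<le> \<epsilon> * nrm x"
        using eventually_conj[OF eventually_ge_at_top[of N]
            eventually_conj[OF restr_conv[OF finU h2] weighted_row_limit[OF B S lim t \<epsilon>(1), of i]]] xE
        by (auto simp: eventually_sequentially)
      let ?z = "\<lambda>l. x l - X k l"
      have z: "?z \<in> E" by (rule diff_in_E[OF xE X(1)[OF k(1)]])
      have zK: "nrm ?z \<le> 2 * K" using nrm_diff[OF xE X(1)[OF k(1)]] xnK XK[OF k(1)] by simp
      have "exp (- real r / t) * nrm ?z \<le> \<eta> / 2 / (2 * K) * (2 * K)"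
        using r zK e' nrm_nonneg[OF z] by (intro mult_mono) auto
      then have "nrm (wmul t i ?z) \<le> \<eta>"
        using nrm_wmul_le_near_far[OF t z, of i r] k(2) K by simp
      then have "C * nrm (wmul t i ?z) \<le> C * \<eta>" using C(1) by (rule mult_left_mono)
      moreover have "\<epsilon> * nrm ?z \<le> \<epsilon> * (2 * K)" using zK \<epsilon>(1) by simp
      ultimately have "C * nrm (wmul t i ?z) + \<epsilon> * nrm ?z \<le> e / 4 + e / 2"
        using \<eta>(2) \<epsilon>(2) by linarith
      then have Bz: "nrm (wmul t i (B k ?z)) \<le> e / 4 + e / 2"
        using kt[rule_format, OF k(1) z, of i] by linarith
      have eq: "wmul t i (\<lambda>l. S x l - y l) = (\<lambda>l. wmul t i (B k ?z) l - wmul t i (\<lambda>l. B k x l - S x l) l)"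
        unfolding bounded_ops_diff[OF seq_subspace_E Bb xE X(1)[OF k(1)]] wmul_diff[symmetric] X(2)[OF k(1)] by simp
      have "norm (S x i - y i) \<le> nrm (wmul t i (\<lambda>l. S x l - y l))"
        by (rule nrm_coord_wmul[OF t diff_in_E[OF SE[OF xE] y]])
      also have "\<dots> \<le> nrm (wmul t i (B k ?z)) + nrm (wmul t i (\<lambda>l. B k x l - S x l))"
        unfolding eq by (rule nrm_diff[OF W[OF BE[OF z]] W[OF diff_in_E[OF BE[OF xE] SE[OF xE]]]])
      also have "\<dots> \<le> (e / 4 + e / 2) + \<epsilon> * K"
        using Bz k(3) mult_left_mono[OF xnK, of \<epsilon>] \<epsilon>(1) by linarith
      finally show ?thesis using \<epsilon>(2) by simp
    qed
    then have "norm (S x i - y i) \<le> 0" by (rule field_le_epsilon[of _ 0, simplified])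
    then show ?thesis by simp
  qed
  then show ?thesis using xE by blast
qed

lemma limit_invertible:
  assumes "uniformly_local B" "S \<in> bounded_ops p E" "row_limit B S" "0 < \<delta>"
    "\<forall>\<^sub>F k in sequentially. \<forall>x\<in>E. \<delta> * nrm x \<le> nrm (B k x)"
    "\<forall>\<^sub>F k in sequentially. \<forall>y\<in>E. \<exists>x\<in>E. B k x = y"
  shows "invertible_op p E S" and "inv_norm p E S \<le> 1 / \<delta>"
  using invertible_op_by_lower_bound[OF seq_subspace_E assms(2,4) limit_lower_bound[OF assms(1-5)]
      limit_surjective[OF assms]] by blast+

end

section \<open>P-strong convergence and truncations\<close>

context lp_exponent
begin

lemma row_limitD:
  "row_limit B S \<Longrightarrow> 0 < \<epsilon> \<Longrightarrow>
    \<forall>\<^sub>F k in sequentially. \<forall>x\<in>E. nrm (restr (cube m) (\<lambda>i. B k x i - S x i)) \<le> \<epsilon> * nrm x"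
  by (simp add: row_limit_def)

lemma column_limitD:
  "column_limit B S \<Longrightarrow> 0 < \<epsilon> \<Longrightarrow>
    \<forall>\<^sub>F k in sequentially. \<forall>x\<in>E. nrm (\<lambda>i. B k (restr (cube m) x) i - S (restr (cube m) x) i) \<le> \<epsilon> * nrm x"
  by (simp add: column_limit_def)

lemma restr_cube_P_compact: "(restr (cube m) :: ('n::finite, 'a::complex_banach) seq_op) \<in> P_compact p"
proof -
  let ?K = "restr (cube m) :: ('n, 'a) seq_op"
  have comp: "(restr U :: ('n, 'a) seq_op) \<circ> restr V \<in> bounded_ops p E" for U V
    by (intro compose_bounded seq_subspace_E restr_bounded)
  have zero: "op_norm p E ((restr U :: ('n, 'a) seq_op) \<circ> restr V) = 0" if "U \<inter> V = {}" for U V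
  proof (rule antisym)
    show "op_norm p E ((restr U :: ('n, 'a) seq_op) \<circ> restr V) \<le> 0"
    proof (rule op_norm_le[OF seq_subspace_E])
      fix x :: "('n, 'a) seqs"
      have "restr U (restr V x) = (\<lambda>_. 0)" using that by (auto simp: restr_def fun_eq_iff)
      then show "nrm ((restr U \<circ> restr V) x) \<le> 0 * nrm x" by (simp add: nrm_zero)
    qed simp
    show "0 \<le> op_norm p E ((restr U :: ('n, 'a) seq_op) \<circ> restr V)"
      by (rule op_norm_nonneg[OF seq_subspace_E comp])
  qed
  have "\<forall>\<^sub>F n in sequentially. op_norm p E (Q_proj n \<circ> ?K) + op_norm p E (?K \<circ> Q_proj n) = 0"
    using eventually_ge_at_top[of m]
  proof (rule eventually_mono)
    fix n assume "m \<le> n"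
    then have "cube m \<inter> - cube n = ({} :: (int ^ 'n) set)" using cube_mono[of m n] by blast
    then show "op_norm p E (Q_proj n \<circ> ?K) + op_norm p E (?K \<circ> Q_proj n) = 0"
      using zero[of "cube m" "- cube n"] zero[of "- cube n" "cube m"]
      unfolding Q_proj_eq_restr by (simp add: Int_commute)
  qed
  then show ?thesis
    unfolding P_compact_def by (simp add: restr_bounded tendsto_eventually)
qed

text \<open>The projections themselves belong to \<open>P_compact\<close>.\<close>

lemma P_strong_limitD:
  assumes lim: "P_strong_limit p B S"
  shows "row_limit B S" and "column_limit B S"
proof -
  have Bb: "B k \<in> bounded_ops p E" and Sb: "S \<in> bounded_ops p E" for k
    using lim unfolding P_strong_limit_def by auto
  note D = op_diff_bounded[OF Bb Sb]
  have comp: "restr (cube m) \<circ> op_diff (B k) S \<in> bounded_ops p E"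
    "op_diff (B k) S \<circ> restr (cube m) \<in> bounded_ops p E" for k m
    by (intro compose_bounded seq_subspace_E restr_bounded D)+
  have ev: "\<forall>\<^sub>F k in sequentially. (\<forall>x\<in>E. nrm (restr (cube m) (\<lambda>i. B k x i - S x i)) \<le> \<epsilon> * nrm x) \<and>
      (\<forall>x\<in>E. nrm (\<lambda>i. B k (restr (cube m) x) i - S (restr (cube m) x) i) \<le> \<epsilon> * nrm x)"
    if \<epsilon>: "0 < \<epsilon>" for m \<epsilon>
  proof -
    have "(\<lambda>k. op_norm p E (restr (cube m) \<circ> op_diff (B k) S)
           + op_norm p E (op_diff (B k) S \<circ> restr (cube m))) \<longlonglongrightarrow> 0"
      using lim restr_cube_P_compact unfolding P_strong_limit_def by blast
    then have "\<forall>\<^sub>F k in sequentially. op_norm p E (restr (cube m) \<circ> op_diff (B k) S)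
           + op_norm p E (op_diff (B k) S \<circ> restr (cube m)) < \<epsilon>"
      by (rule order_tendstoD(2)) (rule \<epsilon>)
    then show ?thesis
    proof (rule eventually_mono)
      fix k assume k: "op_norm p E (restr (cube m) \<circ> op_diff (B k) S)
           + op_norm p E (op_diff (B k) S \<circ> restr (cube m)) < \<epsilon>"
      have small: "op_norm p E (restr (cube m) \<circ> op_diff (B k) S) \<le> \<epsilon>"
        "op_norm p E (op_diff (B k) S \<circ> restr (cube m)) \<le> \<epsilon>"
        using k op_norm_nonneg[OF seq_subspace_E comp(1)[of m k]]
          op_norm_nonneg[OF seq_subspace_E comp(2)[of k m]] by linarith+
      have "nrm (restr (cube m) (\<lambda>i. B k x i - S x i)) \<le> \<epsilon> * nrm x" if x: "x \<in> E" for x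
        using op_norm_bound[OF seq_subspace_E comp(1) x, of m k] mult_right_mono[OF small(1) nrm_nonneg[OF x]]
        by (simp add: op_diff_def)
      moreover have "nrm (\<lambda>i. B k (restr (cube m) x) i - S (restr (cube m) x) i) \<le> \<epsilon> * nrm x" if x: "x \<in> E" for x
        using op_norm_bound[OF seq_subspace_E comp(2) x, of k m] mult_right_mono[OF small(2) nrm_nonneg[OF x]]
        by (simp add: op_diff_def)
      ultimately show "(\<forall>x\<in>E. nrm (restr (cube m) (\<lambda>i. B k x i - S x i)) \<le> \<epsilon> * nrm x) \<and>
      (\<forall>x\<in>E. nrm (\<lambda>i. B k (restr (cube m) x) i - S (restr (cube m) x) i) \<le> \<epsilon> * nrm x)" by blast
    qed
  qed
  show "row_limit B S"
    unfolding row_limit_def by (intro allI impI eventually_mono[OF ev]) auto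
  show "column_limit B S"
    unfolding column_limit_def by (intro allI impI eventually_mono[OF ev]) auto
qed

text \<open>Every member of \<open>P_compact\<close> is approximated in norm by its compositions with projections from either
  side, so for bounded sequences it suffices to test with projections.\<close>

lemma P_strong_limitI:
  fixes B :: "nat \<Rightarrow> ('n::finite, 'a::complex_banach) seq_op"
  assumes Bb: "\<And>k. B k \<in> bounded_ops p E" and Sb: "S \<in> bounded_ops p E"
    and C: "0 \<le> C" "\<And>k x. x \<in> E \<Longrightarrow> nrm (B k x) \<le> C * nrm x"
    and row: "row_limit B S" and col: "column_limit B S"
  shows "P_strong_limit p B S"
  unfolding P_strong_limit_def
proof (intro conjI allI ballI)
  show "B n \<in> bounded_ops p E" for n by (rule Bb)
  show "S \<in> bounded_ops p E" by (rule Sb)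
  fix K :: "('n, 'a) seq_op" assume K: "K \<in> P_compact p"
  then have Kb: "K \<in> bounded_ops p E"
    and Klim: "(\<lambda>n. op_norm p E (Q_proj n \<circ> K) + op_norm p E (K \<circ> Q_proj n)) \<longlonglongrightarrow> 0"
    by (auto simp: P_compact_def)
  obtain D' where D': "0 \<le> D'" "\<And>x. x \<in> E \<Longrightarrow> nrm (S x) \<le> D' * nrm x"
    using bounded_ops_bound[OF seq_subspace_E Sb] by blast
  obtain CK where CK: "0 \<le> CK" "\<And>x. x \<in> E \<Longrightarrow> nrm (K x) \<le> CK * nrm x"
    using bounded_ops_bound[OF seq_subspace_E Kb] by blast
  define D where "D = C + D'"
  have D0: "0 \<le> D" using C D' by (simp add: D_def)
  note KE = bounded_opsD(1)[OF Kb]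
  note diff = op_diff_bounded[OF Bb Sb]
  note dE = bounded_opsD(1)[OF diff]
  have dD: "nrm (op_diff (B k) S x) \<le> D * nrm x" if x: "x \<in> E" for k x
    using nrm_diff[OF bounded_opsD(1)[OF Bb x] bounded_opsD(1)[OF Sb x], of k] C(2)[OF x, of k] D'(2)[OF x]
    by (simp add: op_diff_def D_def distrib_right)
  let ?f = "\<lambda>k. op_norm p E (K \<circ> op_diff (B k) S) + op_norm p E (op_diff (B k) S \<circ> K)"
  have nonneg: "0 \<le> ?f k" for k
    by (intro add_nonneg_nonneg op_norm_nonneg seq_subspace_E compose_bounded Kb diff)
  have "\<forall>\<^sub>F k in sequentially. ?f k < e" if e: "0 < e" for e
  proof -
    define \<eta> where "\<eta> = e / (8 * (D + 1))"
    define \<xi> where "\<xi> = e / (8 * (CK + 1))"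
    have \<eta>: "0 < \<eta>" "\<eta> * D \<le> e / 8" using e D0 by (auto simp: \<eta>_def field_simps)
    have \<xi>: "0 < \<xi>" "\<xi> * CK \<le> e / 8" using e CK(1) by (auto simp: \<xi>_def field_simps)
    have "\<forall>\<^sub>F n in sequentially. op_norm p E (Q_proj n \<circ> K) + op_norm p E (K \<circ> Q_proj n) < \<eta>"
      by (rule order_tendstoD(2)[OF Klim \<eta>(1)])
    then obtain m where m: "op_norm p E (Q_proj m \<circ> K) + op_norm p E (K \<circ> Q_proj m) < \<eta>"
      by (auto simp: eventually_sequentially)
    have comp: "Q_proj m \<circ> K \<in> bounded_ops p E" "K \<circ> Q_proj m \<in> bounded_ops p E"
      unfolding Q_proj_eq_restr by (intro compose_bounded seq_subspace_E restr_bounded Kb)+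
    have "op_norm p E (Q_proj m \<circ> K) \<le> \<eta>" "op_norm p E (K \<circ> Q_proj m) \<le> \<eta>"
      using m op_norm_nonneg[OF seq_subspace_E comp(1)] op_norm_nonneg[OF seq_subspace_E comp(2)] by linarith+
    then have QK: "nrm (restr (- cube m) (K x)) \<le> \<eta> * nrm x" and KQ: "nrm (K (restr (- cube m) x)) \<le> \<eta> * nrm x"
      if x: "x \<in> E" for x
      using op_norm_bound[OF seq_subspace_E comp(1) x] op_norm_bound[OF seq_subspace_E comp(2) x]
        mult_right_mono[OF _ nrm_nonneg[OF x]] by (fastforce simp: Q_proj_eq_restr)+
    have "\<forall>\<^sub>F k in sequentially. (\<forall>x\<in>E. nrm (restr (cube m) (\<lambda>i. B k x i - S x i)) \<le> \<xi> * nrm x) \<and>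
      (\<forall>x\<in>E. nrm (\<lambda>i. B k (restr (cube m) x) i - S (restr (cube m) x) i) \<le> \<xi> * nrm x)"
      by (intro eventually_conj row_limitD[OF row \<xi>(1)] column_limitD[OF col \<xi>(1)])
    then show ?thesis
    proof (rule eventually_mono, elim conjE)
      fix k
      assume r: "\<forall>x\<in>E. nrm (restr (cube m) (\<lambda>i. B k x i - S x i)) \<le> \<xi> * nrm x"
        and c: "\<forall>x\<in>E. nrm (\<lambda>i. B k (restr (cube m) x) i - S (restr (cube m) x) i) \<le> \<xi> * nrm x"
      let ?d = "op_diff (B k) S"
      have "nrm (K (?d x)) \<le> e / 4 * nrm x" if x: "x \<in> E" for x
      proof -
        let ?y = "?d x"
        note yE = dE[OF x, of k]
        have "K ?y = (\<lambda>i. K (restr (cube m) ?y) i + K (restr (- cube m) ?y) i)"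
          using bounded_opsD(2)[OF Kb restr_in_E[OF yE, of "cube m"] restr_in_E[OF yE, of "- cube m"]]
          by (simp add: restr_split[symmetric])
        then have "nrm (K ?y) \<le> nrm (K (restr (cube m) ?y)) + nrm (K (restr (- cube m) ?y))"
          using nrm_triangle[OF KE KE, OF restr_in_E[OF yE] restr_in_E[OF yE], of "cube m" "- cube m"] by simp
        also have "nrm (K (restr (cube m) ?y)) \<le> CK * (\<xi> * nrm x)"
          using CK(2)[OF restr_in_E[OF yE, of "cube m"]] mult_left_mono[OF r[rule_format, OF x] CK(1)]
          by (simp add: op_diff_def)
        also have "\<dots> \<le> e / 8 * nrm x"
          using mult_right_mono[OF \<xi>(2) nrm_nonneg[OF x]] by (simp add: mult_ac)
        also have "nrm (K (restr (- cube m) ?y)) \<le> \<eta> * (D * nrm x)"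
          by (rule order_trans[OF KQ[OF yE] mult_left_mono[OF dD[OF x]]]) (use \<eta>(1) in simp)
        also have "\<dots> \<le> e / 8 * nrm x"
          using mult_right_mono[OF \<eta>(2) nrm_nonneg[OF x]] by (simp add: mult_ac)
        finally show ?thesis by simp
      qed
      then have 1: "op_norm p E (K \<circ> ?d) \<le> e / 4"
        using e by (intro op_norm_le seq_subspace_E) auto
      have "nrm (?d (K x)) \<le> e / 4 * nrm x" if x: "x \<in> E" for x
      proof -
        let ?y = "K x"
        note yE = KE[OF x]
        have "?d ?y = (\<lambda>i. ?d (restr (cube m) ?y) i + ?d (restr (- cube m) ?y) i)"
          using bounded_opsD(2)[OF diff restr_in_E[OF yE, of "cube m"] restr_in_E[OF yE, of "- cube m"], of k]
          by (simp add: restr_split[symmetric])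
        then have "nrm (?d ?y) \<le> nrm (?d (restr (cube m) ?y)) + nrm (?d (restr (- cube m) ?y))"
          using nrm_triangle[OF dE dE, OF restr_in_E[OF yE] restr_in_E[OF yE], of k "cube m" k "- cube m"] by simp
        also have "nrm (?d (restr (cube m) ?y)) \<le> \<xi> * (CK * nrm x)"
          unfolding op_diff_def
          by (rule order_trans[OF c[rule_format, OF yE] mult_left_mono[OF CK(2)[OF x]]]) (use \<xi>(1) in simp)
        also have "\<dots> \<le> e / 8 * nrm x"
          using mult_right_mono[OF \<xi>(2) nrm_nonneg[OF x]] by (simp add: mult_ac)
        also have "nrm (?d (restr (- cube m) ?y)) \<le> D * (\<eta> * nrm x)"
          using dD[OF restr_in_E[OF yE, of "- cube m"], of k] mult_left_mono[OF QK[OF x] D0] by simp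
        also have "\<dots> \<le> e / 8 * nrm x"
          using mult_right_mono[OF \<eta>(2) nrm_nonneg[OF x]] by (simp add: mult_ac)
        finally show ?thesis by simp
      qed
      then have 2: "op_norm p E (?d \<circ> K) \<le> e / 4"
        using e by (intro op_norm_le seq_subspace_E) auto
      show "?f k < e" using 1 2 e by simp
    qed
  qed
  then show "?f \<longlonglongrightarrow> 0"
    using nonneg by (intro order_tendstoI) (auto intro: always_eventually less_le_trans)
qed

text \<open>Translation and truncation do not affect the commutators with weights.\<close>

lemma uniformly_local_sections:
  fixes A :: "('n::finite, 'a::complex_banach) seq_op"
  assumes A: "A \<in> band_dominated p"
  shows "uniformly_local (\<lambda>k. section_ext (U k) c (translate (h k) A))"
proof -
  note Ab = band_dominated_bounded[OF A]
  note Tb = translate_bounded[OF Ab]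
  obtain C where C: "0 \<le> C" "\<And>x. x \<in> E \<Longrightarrow> nrm (A x) \<le> C * nrm x"
    using bounded_ops_bound[OF seq_subspace_E Ab] by blast
  have TC: "nrm (translate g A x) \<le> C * nrm x" if "x \<in> E" for g x
    by (rule translate_bound[OF C(2) that])
  show ?thesis
    unfolding uniformly_local_def
  proof (intro conjI allI impI)
    show "section_ext (U k) c (translate (h k) A) \<in> bounded_ops p E" for k
      by (rule section_ext_bounded[OF Tb TC C(1)])
    show "\<exists>C\<ge>0. \<forall>k. \<forall>x\<in>E. nrm (section_ext (U k) c (translate (h k) A) x) \<le> C * nrm x"
      using section_ext_bound[OF Tb TC C(1)] C(1) by (intro exI[of _ "C + \<bar>c\<bar>"]) auto
    fix \<epsilon> :: real assume \<epsilon>: "0 < \<epsilon>"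
    obtain t0 where t0: "0 < t0" and comm: "\<And>t j x. t0 \<le> t \<Longrightarrow> x \<in> E \<Longrightarrow>
        nrm (\<lambda>i. A (wmul t j x) i - wmul t j (A x) i) \<le> \<epsilon> * nrm x"
      using band_dominated_weight_commutator[OF A \<epsilon>] by blast
    show "\<exists>t0>0. \<forall>t\<ge>t0. \<forall>k j. \<forall>x\<in>E. nrm (\<lambda>i. section_ext (U k) c (translate (h k) A) (wmul t j x) i
        - wmul t j (section_ext (U k) c (translate (h k) A) x) i) \<le> \<epsilon> * nrm x"
    proof (intro exI[of _ t0] conjI t0 allI impI ballI)
      fix t k j x assume t: "t0 \<le> t" and x: "(x :: ('n, 'a) seqs) \<in> E"
      have tpos: "0 < t" using t t0 by simp
      let ?T = "translate (h k) A" and ?y = "restr (U k) x"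
      note y = restr_in_E[OF x, of "U k"]
      have sw: "shift g (wmul t l z) = wmul t (l + g) (shift g z)" for g l and z :: "('n, 'a) seqs"
        by (simp add: shift_def wmul_def weight_def algebra_simps)
      have "nrm (\<lambda>i. section_ext (U k) c ?T (wmul t j x) i - wmul t j (section_ext (U k) c ?T x) i)
          = nrm (restr (U k) (\<lambda>i. ?T (wmul t j ?y) i - wmul t j (?T ?y) i))"
        by (intro nrm_cong arg_cong[of _ _ norm])
          (simp add: section_ext_def compress_def restr_diff restr_wmul[symmetric] wmul_add,
            auto simp: restr_def wmul_def)
      also have "\<dots> \<le> nrm (\<lambda>i. ?T (wmul t j ?y) i - wmul t j (?T ?y) i)"
        by (intro nrm_restr diff_in_E bounded_opsD(1)[OF Tb] wmul_in_E[OF tpos] y)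
      also have "\<dots> = nrm (shift (- h k) (\<lambda>i. A (wmul t (j + h k) (shift (h k) ?y)) i
          - wmul t (j + h k) (A (shift (h k) ?y)) i))"
      proof -
        have "wmul t j (shift (- h k) z) = shift (- h k) (wmul t (j + h k) z)" for z :: "('n, 'a) seqs"
          by (simp add: sw)
        then have "(\<lambda>i. ?T (wmul t j ?y) i - wmul t j (?T ?y) i)
            = (\<lambda>i. shift (- h k) (A (wmul t (j + h k) (shift (h k) ?y))) i
                - shift (- h k) (wmul t (j + h k) (A (shift (h k) ?y))) i)"
          by (simp add: translate_def sw del: diff_minus_eq_add)
        then show ?thesis by (simp add: shift_def)
      qed
      also have "\<dots> \<le> \<epsilon> * nrm (shift (h k) ?y)"
        unfolding nrm_shift[of "- h k"] using y by (intro comm t) (simp add: shift_in_E)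
      also have "\<dots> \<le> \<epsilon> * nrm x" using nrm_restr[OF x, of "U k"] \<epsilon> by (simp add: nrm_shift)
      finally show "nrm (\<lambda>i. section_ext (U k) c ?T (wmul t j x) i - wmul t j (section_ext (U k) c ?T x) i) \<le> \<epsilon> * nrm x" .
    qed
  qed
qed

text \<open>A row of \<open>A\<close> feels the truncation only through entries far from the diagonal.\<close>

lemma fin_sec_ext_row_limit:
  fixes A :: "('n::finite, 'a::complex_banach) seq_op"
  assumes A: "A \<in> band_dominated p"
  shows "row_limit (fin_sec_ext A c) A"
  unfolding row_limit_def
proof (intro allI impI)
  fix m and \<epsilon> :: real assume \<epsilon>: "0 < \<epsilon>"
  note Ab = band_dominated_bounded[OF A]
  obtain w where w: "\<And>U V x. (\<And>i k. i \<in> U \<Longrightarrow> k \<in> V \<Longrightarrow> i - k \<notin> cube w) \<Longrightarrow> x \<in> E \<Longrightarrow>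
    nrm (restr U (A (restr V x))) \<le> \<epsilon> * nrm x"
    using band_dominated_off_diagonal[OF A \<epsilon>] by blast
  show "\<forall>\<^sub>F n in sequentially. \<forall>x\<in>E. nrm (restr (cube m) (\<lambda>i. fin_sec_ext A c n x i - A x i)) \<le> \<epsilon> * nrm x"
    using eventually_ge_at_top[of "m + w"]
  proof (rule eventually_mono, intro ballI)
    fix n and x :: "('n, 'a) seqs" assume n: "m + w \<le> n" and x: "x \<in> E"
    have sub: "i \<in> cube n" if "i \<in> cube m" for i :: "int ^ 'n" using cube_mono[of m n i] n that by simp
    have split: "A x = (\<lambda>i. A (restr (cube n) x) i + A (restr (- cube n) x) i)"
      using bounded_opsD(2)[OF Ab restr_in_E[OF x, of "cube n"] restr_in_E[OF x, of "- cube n"]]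
      by (simp add: restr_split[symmetric])
    have "nrm (restr (cube m) (\<lambda>i. fin_sec_ext A c n x i - A x i)) = nrm (restr (cube m) (A (restr (- cube n) x)))"
      by (rule nrm_cong)
        (use sub in \<open>auto simp: fin_sec_ext_eq_section_ext section_ext_def compress_def restr_def[of "cube m"]
          restr_def[of _ "A _"] fun_cong[OF split] restr_def[of "- cube n" x]\<close>)
    also have "\<dots> \<le> \<epsilon> * nrm x"
    proof (rule w[OF _ x])
      fix i k :: "int ^ 'n" assume i: "i \<in> cube m" and k: "k \<in> - cube n"
      show "i - k \<notin> cube w"
      proof
        assume "i - k \<in> cube w"
        then have "k \<in> cube (m + w)" using cube_diff[OF i, of "i - k" w] by simp
        then show False using cube_mono[OF n] k by blast
      qed
    qed
    finally show "nrm (restr (cube m) (\<lambda>i. fin_sec_ext A c n x i - A x i)) \<le> \<epsilon> * nrm x" .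
  qed
qed

lemma translate_off_diagonal:
  fixes A :: "('n::finite, 'a::complex_banach) seq_op"
  assumes A: "A \<in> band_dominated p" and \<epsilon>: "0 < \<epsilon>"
  obtains w where "\<And>h U V x. (\<And>i k. i \<in> U \<Longrightarrow> k \<in> V \<Longrightarrow> i - k \<notin> cube w) \<Longrightarrow> x \<in> E \<Longrightarrow>
    nrm (restr U (translate h A (restr V x))) \<le> \<epsilon> * nrm x"
proof -
  obtain w where w: "\<And>U V x. (\<And>i k. i \<in> U \<Longrightarrow> k \<in> V \<Longrightarrow> i - k \<notin> cube w) \<Longrightarrow> x \<in> E \<Longrightarrow>
    nrm (restr U (A (restr V x))) \<le> \<epsilon> * nrm x"
    using band_dominated_off_diagonal[OF A \<epsilon>] by blast
  show ?thesis
  proof (rule that[of w])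
    fix h :: "int ^ 'n" and U V :: "(int ^ 'n) set" and x :: "('n, 'a) seqs"
    assume sep: "\<And>i k. i \<in> U \<Longrightarrow> k \<in> V \<Longrightarrow> i - k \<notin> cube w" and x: "x \<in> E"
    let ?U = "{i. i - h \<in> U}" and ?V = "{i. i - h \<in> V}"
    have "restr U (translate h A (restr V x)) = shift (- h) (restr ?U (A (restr ?V (shift h x))))"
    proof -
      have "shift h (restr V x) = restr ?V (shift h x)" by (auto simp: shift_def restr_def)
      then show ?thesis by (auto simp: translate_def) (auto simp: shift_def restr_def)
    qed
    then have "nrm (restr U (translate h A (restr V x))) = nrm (restr ?U (A (restr ?V (shift h x))))"
      by (simp add: nrm_shift)
    also have "\<dots> \<le> \<epsilon> * nrm (shift h x)"
    proof (rule w)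
      fix i k assume "i \<in> ?U" "k \<in> ?V"
      then show "i - k \<notin> cube w" using sep[of "i - h" "k - h"] by simp
    qed (simp add: shift_in_E x)
    finally show "nrm (restr U (translate h A (restr V x))) \<le> \<epsilon> * nrm x" by (simp add: nrm_shift)
  qed
qed

text \<open>A limit operator inherits the decay away from the diagonal from the translates, for which it is
  uniform.\<close>

lemma limit_operator_off_diagonal:
  fixes A :: "('n::finite, 'a::complex_banach) seq_op"
  assumes A: "A \<in> band_dominated p" and L: "L \<in> bounded_ops p E"
    and row: "row_limit (\<lambda>k. translate (h k) A) L" and col: "column_limit (\<lambda>k. translate (h k) A) L"
    and \<epsilon>: "0 < \<epsilon>"
  obtains r where "\<And>x. x \<in> E \<Longrightarrow> nrm (restr (cube m) (L (restr (- cube r) x))) \<le> \<epsilon> * nrm x"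
    "\<And>x. x \<in> E \<Longrightarrow> nrm (restr (- cube r) (L (restr (cube m) x))) \<le> \<epsilon> * nrm x"
proof -
  note Tb = translate_bounded[OF band_dominated_bounded[OF A]]
  have e2: "0 < \<epsilon> / 2" using \<epsilon> by simp
  obtain w where w: "\<And>h U V x. (\<And>i k. i \<in> U \<Longrightarrow> k \<in> V \<Longrightarrow> i - k \<notin> cube w) \<Longrightarrow> x \<in> E \<Longrightarrow>
    nrm (restr U (translate h A (restr V x))) \<le> \<epsilon> / 2 * nrm x"
    using translate_off_diagonal[OF A e2] by blast
  have "\<forall>\<^sub>F k in sequentially. (\<forall>x\<in>E. nrm (restr (cube m) (\<lambda>i. translate (h k) A x i - L x i)) \<le> \<epsilon> / 2 * nrm x) \<and>
      (\<forall>x\<in>E. nrm (\<lambda>i. translate (h k) A (restr (cube m) x) i - L (restr (cube m) x) i) \<le> \<epsilon> / 2 * nrm x)"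
    by (intro eventually_conj row_limitD[OF row e2] column_limitD[OF col e2])
  then obtain k where k: "\<And>x. x \<in> E \<Longrightarrow> nrm (restr (cube m) (\<lambda>i. translate (h k) A x i - L x i)) \<le> \<epsilon> / 2 * nrm x"
      "\<And>x. x \<in> E \<Longrightarrow> nrm (\<lambda>i. translate (h k) A (restr (cube m) x) i - L (restr (cube m) x) i) \<le> \<epsilon> / 2 * nrm x"
    unfolding eventually_sequentially by blast
  let ?T = "translate (h k) A"
  have far: "i - l \<notin> cube w" "l - i \<notin> cube w"
    if i: "i \<in> cube m" and l: "l \<in> - cube (m + w)" for i l :: "int ^ 'n"
  proof -
    have "i - l \<notin> cube w"
    proof
      assume "i - l \<in> cube w"
      then have "l \<in> cube (m + w)" using cube_diff[OF i, of "i - l" w] by simp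
      then show False using l by blast
    qed
    then show "i - l \<notin> cube w" "l - i \<notin> cube w" using cube_uminus[of "i - l" w] by auto
  qed
  show ?thesis
  proof (rule that[of "m + w"])
    fix x :: "('n, 'a) seqs" assume x: "x \<in> E"
    let ?R = "cube (m + w)"
    let ?z = "restr (- ?R) x" and ?y = "restr (cube m) x"
    note z = restr_in_E[OF x, of "- ?R"] and y = restr_in_E[OF x, of "cube m"]
    note E = bounded_opsD(1)[OF Tb] bounded_opsD(1)[OF L]
    have "nrm (restr (cube m) (L ?z)) \<le> nrm (restr (cube m) (?T ?z)) + nrm (\<lambda>i. restr (cube m) (L ?z) i - restr (cube m) (?T ?z) i)"
      by (intro nrm_le_diff restr_in_E E z)
    also have "nrm (\<lambda>i. restr (cube m) (L ?z) i - restr (cube m) (?T ?z) i) \<le> \<epsilon> / 2 * nrm ?z"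
      using k(1)[OF z] by (subst nrm_minus_commute) (simp add: restr_diff)
    also have "\<epsilon> / 2 * nrm ?z \<le> \<epsilon> / 2 * nrm x" using nrm_restr[OF x] e2 by simp
    also have "nrm (restr (cube m) (?T ?z)) \<le> \<epsilon> / 2 * nrm x"
      by (rule w[OF far(1) x])
    finally show "nrm (restr (cube m) (L ?z)) \<le> \<epsilon> * nrm x" by simp
    have "nrm (restr (- ?R) (L ?y)) \<le> nrm (restr (- ?R) (?T ?y)) + nrm (\<lambda>i. restr (- ?R) (L ?y) i - restr (- ?R) (?T ?y) i)"
      by (intro nrm_le_diff restr_in_E E y)
    also have "nrm (\<lambda>i. restr (- ?R) (L ?y) i - restr (- ?R) (?T ?y) i) \<le> nrm (\<lambda>i. L ?y i - ?T ?y i)"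
      unfolding restr_diff[symmetric] by (intro nrm_restr diff_in_E E y)
    also have "\<dots> \<le> \<epsilon> / 2 * nrm x" using k(2)[OF x] by (subst nrm_minus_commute)
    also have "nrm (restr (- ?R) (?T ?y)) \<le> \<epsilon> / 2 * nrm x"
      by (rule w[OF far(2) x])
    finally show "nrm (restr (- ?R) (L ?y)) \<le> \<epsilon> * nrm x" by simp
  qed
qed

text \<open>On any fixed cube the truncating sets eventually coincide with their limit. The parts where they still
  differ are far away and are reached only through entries far from the diagonal.\<close>

lemma section_limits:
  fixes A :: "('n::finite, 'a::complex_banach) seq_op"
  assumes A: "A \<in> band_dominated p" and L: "L \<in> bounded_ops p E"
    and row: "row_limit (\<lambda>k. translate (h k) A) L" and col: "column_limit (\<lambda>k. translate (h k) A) L"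
    and U: "\<And>i. \<forall>\<^sub>F k in sequentially. i \<in> U k \<longleftrightarrow> i \<in> V"
  shows "row_limit (\<lambda>k. section_ext (U k) c (translate (h k) A)) (section_ext V c L)"
    and "column_limit (\<lambda>k. section_ext (U k) c (translate (h k) A)) (section_ext V c L)"
proof -
  note Tb = translate_bounded[OF band_dominated_bounded[OF A]]
  note TE = bounded_opsD(1)[OF Tb] and LE = bounded_opsD(1)[OF L]
  have ev: "\<forall>\<^sub>F k in sequentially.
      (\<forall>x\<in>E. nrm (restr (cube m) (\<lambda>i. section_ext (U k) c (translate (h k) A) x i - section_ext V c L x i)) \<le> \<epsilon> * nrm x) \<and>
      (\<forall>x\<in>E. nrm (\<lambda>i. section_ext (U k) c (translate (h k) A) (restr (cube m) x) i
         - section_ext V c L (restr (cube m) x) i) \<le> \<epsilon> * nrm x)"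
    if \<epsilon>: "0 < \<epsilon>" for m and \<epsilon> :: real
  proof -
    have e2: "0 < \<epsilon> / 2" using \<epsilon> by simp
    obtain r where r1: "\<And>x. x \<in> E \<Longrightarrow> nrm (restr (cube m) (L (restr (- cube r) x))) \<le> \<epsilon> / 2 * nrm x"
      and r2: "\<And>x. x \<in> E \<Longrightarrow> nrm (restr (- cube r) (L (restr (cube m) x))) \<le> \<epsilon> / 2 * nrm x"
      using limit_operator_off_diagonal[OF A L row col e2, of m] by blast
    have evU: "\<forall>\<^sub>F k in sequentially. \<forall>i\<in>cube s. i \<in> U k \<longleftrightarrow> i \<in> V" for s
      by (intro eventually_ball_finite finite_cube ballI U)
    have "\<forall>\<^sub>F k in sequentially.
        ((\<forall>x\<in>E. nrm (restr (cube m) (\<lambda>i. translate (h k) A x i - L x i)) \<le> \<epsilon> / 2 * nrm x) \<and>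
        (\<forall>x\<in>E. nrm (\<lambda>i. translate (h k) A (restr (cube m) x) i - L (restr (cube m) x) i) \<le> \<epsilon> / 2 * nrm x)) \<and>
        (\<forall>i\<in>cube m. i \<in> U k \<longleftrightarrow> i \<in> V) \<and> (\<forall>i\<in>cube r. i \<in> U k \<longleftrightarrow> i \<in> V)"
      by (intro eventually_conj row_limitD[OF row e2] column_limitD[OF col e2] evU)
    then show ?thesis
    proof (rule eventually_mono, elim conjE)
      fix k
      let ?T = "translate (h k) A"
      assume kr: "\<forall>x\<in>E. nrm (restr (cube m) (\<lambda>i. ?T x i - L x i)) \<le> \<epsilon> / 2 * nrm x"
        and kc: "\<forall>x\<in>E. nrm (\<lambda>i. ?T (restr (cube m) x) i - L (restr (cube m) x) i) \<le> \<epsilon> / 2 * nrm x"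
        and Um: "\<forall>i\<in>cube m. i \<in> U k \<longleftrightarrow> i \<in> V" and Ur: "\<forall>i\<in>cube r. i \<in> U k \<longleftrightarrow> i \<in> V"
      have rowb: "nrm (restr (cube m) (\<lambda>i. section_ext (U k) c ?T x i - section_ext V c L x i)) \<le> \<epsilon> * nrm x"
        if x: "x \<in> E" for x
      proof -
        let ?a = "restr (U k) x" and ?b = "restr V x"
        note a = restr_in_E[OF x, of "U k"] and b = restr_in_E[OF x, of V]
        let ?d = "\<lambda>i. ?a i - ?b i"
        have d: "?d \<in> E" by (rule diff_in_E[OF a b])
        have dx: "nrm ?d \<le> nrm x" by (rule dominated_nrm[OF x]) (auto simp: restr_def)
        have dr: "restr (- cube r) ?d = ?d" by (rule restr_id) (use Ur in \<open>auto simp: restr_def\<close>)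
        have "nrm (restr (cube m) (\<lambda>i. section_ext (U k) c ?T x i - section_ext V c L x i))
            \<le> nrm (restr (cube m) (\<lambda>i. ?T ?a i - L ?b i))"
          by (rule dominated_nrm[OF restr_in_E[OF diff_in_E[OF TE[OF a] LE[OF b]]]])
            (use Um in \<open>auto simp: section_ext_def compress_def restr_def[of "cube m"] restr_def[of _ "translate _ _ _"]
              restr_def[of _ "L _"] restr_def[of "- _"]\<close>)
        also have "\<dots> = nrm (\<lambda>i. restr (cube m) (\<lambda>i. ?T ?a i - L ?a i) i + restr (cube m) (L ?d) i)"
          unfolding bounded_ops_diff[OF seq_subspace_E L a b] by (rule nrm_cong) (simp add: restr_def)
        also have "\<dots> \<le> nrm (restr (cube m) (\<lambda>i. ?T ?a i - L ?a i)) + nrm (restr (cube m) (L ?d))"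
          by (intro nrm_triangle restr_in_E diff_in_E TE LE a d)
        also have "nrm (restr (cube m) (\<lambda>i. ?T ?a i - L ?a i)) \<le> \<epsilon> / 2 * nrm ?a" using kr a by blast
        also have "\<epsilon> / 2 * nrm ?a \<le> \<epsilon> / 2 * nrm x" using nrm_restr[OF x] e2 by simp
        also have "nrm (restr (cube m) (L ?d)) \<le> \<epsilon> / 2 * nrm ?d" using r1[OF d] dr by simp
        also have "\<epsilon> / 2 * nrm ?d \<le> \<epsilon> / 2 * nrm x" using dx e2 by simp
        finally show ?thesis by simp
      qed
      have colb: "nrm (\<lambda>i. section_ext (U k) c ?T (restr (cube m) x) i - section_ext V c L (restr (cube m) x) i) \<le> \<epsilon> * nrm x"
        if x: "x \<in> E" for x
      proof -
        let ?z = "restr (cube m) x" and ?v = "restr V x"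
        note v = restr_in_E[OF x, of V]
        let ?u = "restr (cube m) ?v"
        note u = restr_in_E[OF v, of "cube m"]
        have eq: "restr (U k) ?z = ?u" "restr V ?z = ?u" "restr (- U k) ?z = restr (- V) ?z"
          using Um by (auto simp: restr_def)
        have "nrm (\<lambda>i. section_ext (U k) c ?T ?z i - section_ext V c L ?z i)
            = nrm (\<lambda>i. restr (U k) (\<lambda>i. ?T ?u i - L ?u i) i + (restr (U k) (L ?u) i - restr V (L ?u) i))"
          unfolding section_ext_def compress_def eq by (rule nrm_cong) (simp add: restr_diff)
        also have "\<dots> \<le> nrm (restr (U k) (\<lambda>i. ?T ?u i - L ?u i)) + nrm (\<lambda>i. restr (U k) (L ?u) i - restr V (L ?u) i)"
          by (intro nrm_triangle restr_in_E diff_in_E TE LE u)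
        also have "nrm (restr (U k) (\<lambda>i. ?T ?u i - L ?u i)) \<le> nrm (\<lambda>i. ?T ?u i - L ?u i)"
          by (intro nrm_restr diff_in_E TE LE u)
        also have "\<dots> \<le> \<epsilon> / 2 * nrm ?v" using kc v by blast
        also have "nrm (\<lambda>i. restr (U k) (L ?u) i - restr V (L ?u) i) \<le> nrm (restr (- cube r) (L ?u))"
          by (rule dominated_nrm[OF restr_in_E[OF LE[OF u]]]) (use Ur in \<open>auto simp: restr_def[of _ "L _"]\<close>)
        also have "\<dots> \<le> \<epsilon> / 2 * nrm ?v" by (rule r2[OF v])
        finally have "nrm (\<lambda>i. section_ext (U k) c ?T ?z i - section_ext V c L ?z i) \<le> \<epsilon> * nrm ?v" by simp
        also have "\<dots> \<le> \<epsilon> * nrm x" using nrm_restr[OF x] \<epsilon> by simp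
        finally show ?thesis .
      qed
      show "(\<forall>x\<in>E. nrm (restr (cube m) (\<lambda>i. section_ext (U k) c ?T x i - section_ext V c L x i)) \<le> \<epsilon> * nrm x) \<and>
        (\<forall>x\<in>E. nrm (\<lambda>i. section_ext (U k) c ?T (restr (cube m) x) i - section_ext V c L (restr (cube m) x) i) \<le> \<epsilon> * nrm x)"
        using rowb colb by blast
    qed
  qed
  show "row_limit (\<lambda>k. section_ext (U k) c (translate (h k) A)) (section_ext V c L)"
    unfolding row_limit_def by (intro allI impI eventually_mono[OF ev]) auto
  show "column_limit (\<lambda>k. section_ext (U k) c (translate (h k) A)) (section_ext V c L)"
    unfolding column_limit_def by (intro allI impI eventually_mono[OF ev]) auto
qed

end

section \<open>The stability spectrum\<close>

lemma sum_half_powers_le: "(\<Sum>i=l..k. (1/2::real)^i) \<le> 2 * (1/2)^l"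
proof (cases "l \<le> k")
  case True
  have "(\<Sum>i=l..k. (1/2::real)^i) = 2 * (1/2)^l - (1/2)^k"
    using True
  proof (induction k rule: dec_induct)
    case (step k)
    then show ?case by (simp add: sum.cl_ivl_Suc)
  qed simp
  then show ?thesis by simp
qed simp

text \<open>A coordinate of largest modulus is moved to the face of the cube, and all others are kept.\<close>

lemma exists_boundary_point:
  fixes g :: "int ^ 'n::finite"
  assumes g: "g \<in> cube n"
  obtains h where "sup_abs h = int n" "g - h \<in> cube (nat (int n - sup_abs g))"
proof -
  have "sup_abs g \<in> range (\<lambda>j. \<bar>g $ j\<bar>)"
    unfolding sup_abs_def by (rule Max_in) auto
  then obtain a where a: "sup_abs g = \<bar>g $ a\<bar>" by auto
  define s where "s = (if 0 \<le> g $ a then int n else - int n)"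
  define h where "h = (\<chi> j. if j = a then s else g $ j)"
  have gn: "sup_abs g \<le> int n" using g by (simp add: cube_iff_sup_abs)
  have gj: "\<bar>g $ j\<bar> \<le> int n" for j using g by (simp add: cube_iff)
  have "sup_abs h = int n"
  proof (rule antisym)
    have "h \<in> cube n" using gj by (auto simp: cube_iff h_def s_def)
    then show "sup_abs h \<le> int n" by (simp add: cube_iff_sup_abs)
    have "\<bar>h $ a\<bar> \<le> sup_abs h" unfolding sup_abs_def by (rule Max_ge) auto
    then show "int n \<le> sup_abs h" by (simp add: h_def s_def split: if_splits)
  qed
  moreover have "g - h \<in> cube (nat (int n - sup_abs g))"
    using gn a gj[of a] by (auto simp: cube_iff h_def s_def)
  ultimately show ?thesis by (rule that)
qed

lemma pointwise_stabilising_subsequence: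
  fixes U :: "nat \<Rightarrow> 'c::countable set"
  obtains r :: "nat \<Rightarrow> nat" and V where "strict_mono r" "\<And>i. \<forall>\<^sub>F k in sequentially. i \<in> U (r k) \<longleftrightarrow> i \<in> V"
proof -
  define P where "P n s \<longleftrightarrow> (\<exists>b. \<forall>\<^sub>F k in sequentially. (from_nat n \<in> U (s k)) = b)"
    for n and s :: "nat \<Rightarrow> nat"
  have step: "\<exists>r. strict_mono r \<and> P n (s \<circ> r)" for n and s :: "nat \<Rightarrow> nat"
  proof (cases "\<forall>\<^sub>F k in sequentially. from_nat n \<in> U (s k)")
    case True
    then have "P n (s \<circ> id)" unfolding P_def by (intro exI[of _ True]) simp
    then show ?thesis using strict_mono_id by blast
  next
    case False
    then obtain r :: "nat \<Rightarrow> nat" where r: "strict_mono r" "\<forall>k. from_nat n \<notin> U (s (r k))"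
      using not_eventually_sequentiallyD[OF False] by blast
    then have "P n (s \<circ> r)" unfolding P_def by (intro exI[of _ False]) simp
    then show ?thesis using r by blast
  qed
  interpret subseqs P
    by unfold_locales (rule step)
  have stable: "P n (s \<circ> r)" if "strict_mono r" "P n s" for n s r
  proof -
    obtain b where "\<forall>\<^sub>F k in sequentially. (from_nat n \<in> U (s k)) = b"
      using \<open>P n s\<close> unfolding P_def by blast
    then have "\<forall>\<^sub>F k in sequentially. (from_nat n \<in> U (s (r k))) = b"
      by (rule eventually_compose_filterlim[OF _ filterlim_subseq[OF \<open>strict_mono r\<close>]])
    then show ?thesis unfolding P_def by auto
  qed
  have "\<exists>b. \<forall>\<^sub>F k in sequentially. (i \<in> U (diagseq k)) = b" for i
  proof -
    have "P (to_nat i) (diagseq \<circ> ((+) (Suc (to_nat i))))"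
      by (rule diagseq_holds) (rule stable)
    then obtain b where "\<forall>\<^sub>F k in sequentially. (i \<in> U (diagseq (k + Suc (to_nat i)))) = b"
      unfolding P_def by (auto simp: add.commute)
    then show ?thesis
      using eventually_sequentially_seg[of "\<lambda>k. (i \<in> U (diagseq k)) = b" "Suc (to_nat i)"] by blast
  qed
  then obtain b where b: "\<And>i. \<forall>\<^sub>F k in sequentially. (i \<in> U (diagseq k)) = b i" by metis
  show ?thesis
    by (rule that[of diagseq "{i. b i}"]) (use b subseq_diagseq in auto)
qed

context lp_exponent
begin

lemma row_limit_subseq:
  assumes "row_limit B S" "strict_mono r"
  shows "row_limit (\<lambda>k. B (r k)) S"
  unfolding row_limit_def
  by (intro allI impI)
    (rule eventually_compose_filterlim[OF row_limitD[OF assms(1)] filterlim_subseq[OF assms(2)]])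

lemma column_limit_subseq:
  assumes "column_limit B S" "strict_mono r"
  shows "column_limit (\<lambda>k. B (r k)) S"
  unfolding column_limit_def
  by (intro allI impI)
    (rule eventually_compose_filterlim[OF column_limitD[OF assms(1)] filterlim_subseq[OF assms(2)]])

text \<open>The extended section is a direct sum, so its lower bound is the minimum of the lower bound of the
  section and \<open>c\<close>.\<close>

lemma fin_sec_ext_lower_bound:
  fixes A :: "('n::finite, 'a::complex_banach) seq_op"
  assumes A: "A \<in> bounded_ops p E" and \<delta>: "0 < \<delta>" "\<delta> \<le> c"
    and low: "\<And>x. x \<in> im_P p n \<Longrightarrow> \<delta> * nrm x \<le> nrm (fin_sec A n x)" and x: "x \<in> E"
  shows "\<delta> * nrm x \<le> nrm (fin_sec_ext A c n x)"
proof -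
  obtain C where C: "0 \<le> C" "\<And>x. x \<in> E \<Longrightarrow> nrm (A x) \<le> C * nrm x"
    using bounded_ops_bound[OF seq_subspace_E A] by blast
  let ?U = "cube n" and ?y = "fin_sec_ext A c n x"
  have y: "?y \<in> E"
    unfolding fin_sec_ext_eq_section_ext by (rule bounded_opsD(1)[OF section_ext_bounded[OF A C(2,1)] x])
  have "restr ?U ?y = fin_sec A n (restr ?U x)"
    by (auto simp: fin_sec_ext_eq_section_ext section_ext_def fin_sec_eq_compress compress_def restr_restr)
      (auto simp: restr_def)
  then have 1: "\<delta> * nrm (restr ?U x) \<le> nrm (restr ?U ?y)"
    using low[of "restr ?U x"] by (simp add: im_P_eq restr_def)
  have "restr (- ?U) ?y = (\<lambda>i. c *\<^sub>R restr (- ?U) x i)"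
    by (auto simp: fin_sec_ext_eq_section_ext section_ext_def compress_def restr_def)
  then have "nrm (restr (- ?U) ?y) = c * nrm (restr (- ?U) x)"
    using nrm_scaleR[OF restr_in_E[OF x], of c "- ?U"] \<delta> by simp
  then have 2: "\<delta> * nrm (restr (- ?U) x) \<le> nrm (restr (- ?U) ?y)"
    using mult_right_mono[OF \<delta>(2) nrm_nonneg[OF restr_in_E[OF x, of "- ?U"]]] by simp
  show ?thesis
    by (rule lower_bound_split[OF x y _ 1 2]) (use \<delta> in simp)
qed

lemma fin_sec_ext_surjective:
  fixes A :: "('n::finite, 'a::complex_banach) seq_op"
  assumes c: "0 < c" and surj: "\<And>y. y \<in> im_P p n \<Longrightarrow> \<exists>x\<in>im_P p n. fin_sec A n x = y" and y: "y \<in> E"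
  shows "\<exists>x\<in>E. fin_sec_ext A c n x = y"
proof -
  have "restr (cube n) y \<in> im_P p n" by (simp add: im_P_eq restr_def)
  then obtain u where u: "u \<in> im_P p n" "fin_sec A n u = restr (cube n) y" using surj by blast
  let ?v = "\<lambda>i. (1 / c) *\<^sub>R restr (- cube n) y i"
  let ?x = "\<lambda>i. u i + ?v i"
  have v: "?v \<in> E" by (intro scaleR_in_E restr_in_E y)
  have xE: "?x \<in> E" by (rule add_in_E[OF im_P_subset_E[OF u(1)] v])
  have u0: "u i = 0" if "i \<notin> cube n" for i using u(1) that by (simp add: im_P_eq)
  have r1: "restr (cube n) ?x = restr (cube n) u" by (auto simp: restr_def)
  have r2: "(\<lambda>i. c *\<^sub>R restr (- cube n) ?x i) = restr (- cube n) y"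
    using c u0 by (auto simp: restr_def)
  have "fin_sec_ext A c n ?x = (\<lambda>i. restr (cube n) (A (restr (cube n) u)) i + c *\<^sub>R restr (- cube n) ?x i)"
    by (simp add: fin_sec_ext_eq_section_ext section_ext_def compress_def r1)
  also have "\<dots> = (\<lambda>i. restr (cube n) y i + restr (- cube n) y i)"
    using u(2) fun_cong[OF r2] by (simp add: fin_sec_eq_compress compress_def)
  finally show ?thesis using xE restr_split[of y "cube n"] by auto
qed

text \<open>Stability passes to all members of the stability spectrum. The operator \<open>A\<close> itself is the limit
  of its finite sections, so all members are limits of one kind.\<close>

lemma stab_spectrum_invertible:
  fixes A :: "('n::finite, 'a::complex_banach) seq_op"
  assumes A: "A \<in> band_dominated p" and \<delta>: "0 < \<delta>" "\<delta> \<le> c"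
    and good: "\<forall>\<^sub>F n in sequentially. invertible_op p (im_P p n) (fin_sec A n) \<and>
       inv_norm p (im_P p n) (fin_sec A n) \<le> 1 / \<delta>"
    and S: "S \<in> stab_spectrum p A c"
  shows "invertible_op p E S" and "inv_norm p E S \<le> 1 / \<delta>"
proof -
  note Ab = band_dominated_bounded[OF A]
  have ext: "\<forall>\<^sub>F n in sequentially. (\<forall>x\<in>E. \<delta> * nrm x \<le> nrm (fin_sec_ext A c n x)) \<and>
      (\<forall>y\<in>E. \<exists>x\<in>E. fin_sec_ext A c n x = y)"
    using good
  proof (rule eventually_mono, elim conjE)
    fix n assume inv: "invertible_op p (im_P p n) (fin_sec A n)"
      and bd: "inv_norm p (im_P p n) (fin_sec A n) \<le> 1 / \<delta>"
    have "\<delta> * nrm x \<le> nrm (fin_sec A n x)" if x: "x \<in> im_P p n" for x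
    proof -
      have "fin_sec A n x \<in> im_P p n"
        using inv x bounded_opsD(1) unfolding invertible_op_def by blast
      note fE = im_P_subset_E[OF this]
      have "nrm x \<le> inv_norm p (im_P p n) (fin_sec A n) * nrm (fin_sec A n x)"
        by (rule inv_norm_lower_bound[OF seq_subspace_im_P inv x])
      also have "\<dots> \<le> 1 / \<delta> * nrm (fin_sec A n x)"
        by (rule mult_right_mono[OF bd nrm_nonneg[OF fE]])
      finally show ?thesis using \<delta> by (simp add: field_simps)
    qed
    then have low: "\<forall>x\<in>E. \<delta> * nrm x \<le> nrm (fin_sec_ext A c n x)"
      using fin_sec_ext_lower_bound[OF Ab \<delta>] by blast
    have "\<exists>x\<in>im_P p n. fin_sec A n x = y" if "y \<in> im_P p n" for y
      using invertible_op_inverse(3,4)[OF seq_subspace_im_P inv that] by blast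
    then have "\<forall>y\<in>E. \<exists>x\<in>E. fin_sec_ext A c n x = y"
      using fin_sec_ext_surjective[of c n A] \<delta> by auto
    with low show "(\<forall>x\<in>E. \<delta> * nrm x \<le> nrm (fin_sec_ext A c n x)) \<and> (\<forall>y\<in>E. \<exists>x\<in>E. fin_sec_ext A c n x = y)" by blast
  qed
  have "\<exists>B. uniformly_local B \<and> S \<in> bounded_ops p E \<and> row_limit B S \<and>
      (\<forall>\<^sub>F k in sequentially. (\<forall>x\<in>E. \<delta> * nrm x \<le> nrm (B k x)) \<and> (\<forall>y\<in>E. \<exists>x\<in>E. B k x = y))"
  proof (cases "S = A")
    case True
    have "translate 0 A = A" by (auto simp: translate_def shift_def)
    then have "uniformly_local (fin_sec_ext A c)"
      using uniformly_local_sections[OF A, of cube c "\<lambda>_. 0"]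
      by (simp add: fin_sec_ext_eq_section_ext[abs_def])
    then show ?thesis
      using fin_sec_ext_row_limit[OF A] ext Ab True by blast
  next
    case False
    then obtain m h where m: "filterlim m at_top sequentially"
      and lim: "P_strong_limit p (\<lambda>k. translate (h k) (fin_sec_ext A c (m k))) S"
      using S unfolding stab_spectrum_def translate_def by auto
    let ?B = "\<lambda>k. translate (h k) (fin_sec_ext A c (m k))"
    have "uniformly_local ?B"
      unfolding fin_sec_ext_eq_section_ext translate_section_ext by (rule uniformly_local_sections[OF A])
    moreover have "\<forall>\<^sub>F k in sequentially. (\<forall>x\<in>E. \<delta> * nrm x \<le> nrm (?B k x)) \<and> (\<forall>y\<in>E. \<exists>x\<in>E. ?B k x = y)"
      using eventually_compose_filterlim[OF ext m]
    proof (rule eventually_mono, elim conjE)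
      fix k assume low: "\<forall>x\<in>E. \<delta> * nrm x \<le> nrm (fin_sec_ext A c (m k) x)"
        and sur: "\<forall>y\<in>E. \<exists>x\<in>E. fin_sec_ext A c (m k) x = y"
      have "\<delta> * nrm x \<le> nrm (?B k x)" if "x \<in> E" for x
        using low[rule_format, of "shift (h k) x"] that by (simp add: translate_def nrm_shift shift_in_E)
      moreover have "\<exists>x\<in>E. ?B k x = y" if y: "y \<in> E" for y
      proof -
        obtain x where x: "x \<in> E" "fin_sec_ext A c (m k) x = shift (h k) y"
          using sur y shift_in_E by blast
        have inv: "shift g (shift (- g) z) = z" "shift (- g) (shift g z) = z" for g and z :: "('n, 'a) seqs"
          by (auto simp: shift_def)
        have "?B k (shift (- h k) x) = y" by (simp add: translate_def inv x)
        moreover have "shift (- h k) x \<in> E" by (simp add: shift_in_E x)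
        ultimately show ?thesis by blast
      qed
      ultimately show "(\<forall>x\<in>E. \<delta> * nrm x \<le> nrm (?B k x)) \<and> (\<forall>y\<in>E. \<exists>x\<in>E. ?B k x = y)" by blast
    qed
    moreover have "S \<in> bounded_ops p E" using lim by (simp add: P_strong_limit_def)
    ultimately show ?thesis using P_strong_limitD(1)[OF lim] by blast
  qed
  then obtain B where B: "uniformly_local B" "S \<in> bounded_ops p E" "row_limit B S"
    and ev: "\<forall>\<^sub>F k in sequentially. (\<forall>x\<in>E. \<delta> * nrm x \<le> nrm (B k x)) \<and> (\<forall>y\<in>E. \<exists>x\<in>E. B k x = y)" by blast
  have ev12: "\<forall>\<^sub>F k in sequentially. \<forall>x\<in>E. \<delta> * nrm x \<le> nrm (B k x)"
    "\<forall>\<^sub>F k in sequentially. \<forall>y\<in>E. \<exists>x\<in>E. B k x = y"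
    using ev by (auto elim: eventually_mono)
  show "invertible_op p E S" "inv_norm p E S \<le> 1 / \<delta>"
    using limit_invertible[OF B \<delta>(1) ev12] by auto
qed

lemma inv_norm_ge_by_witnesses:
  assumes inv: "invertible_op p E S" and L: "0 < L"
    and wit: "\<And>\<epsilon>. 0 < \<epsilon> \<Longrightarrow> \<exists>y\<in>E. y \<noteq> (\<lambda>_. 0) \<and> nrm (S y) \<le> (1 / L + \<epsilon>) * nrm y"
  shows "L \<le> inv_norm p E S"
proof -
  let ?N = "inv_norm p E S"
  have N0: "0 \<le> ?N"
    unfolding inv_norm_def by (rule op_norm_nonneg[OF seq_subspace_E invertible_op_inverse(1)[OF seq_subspace_E inv]])
  have "1 \<le> ?N / L + e" if e: "0 < e" for e
  proof -
    have \<epsilon>: "0 < e / (?N + 1)" using e N0 by simp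
    obtain y where y: "y \<in> E" "y \<noteq> (\<lambda>_. 0)" "nrm (S y) \<le> (1 / L + e / (?N + 1)) * nrm y"
      using wit[OF \<epsilon>] by blast
    have ypos: "0 < nrm y" using nrm_eq_0_imp[OF y(1)] y(2) by fastforce
    have "nrm y \<le> ?N * nrm (S y)" by (rule inv_norm_lower_bound[OF seq_subspace_E inv y(1)])
    also have "\<dots> \<le> ?N * ((1 / L + e / (?N + 1)) * nrm y)" by (rule mult_left_mono[OF y(3) N0])
    finally have "1 * nrm y \<le> (?N * (1 / L + e / (?N + 1))) * nrm y" by (simp add: mult.assoc)
    then have "1 \<le> ?N * (1 / L + e / (?N + 1))" using ypos by (rule mult_right_le_imp_le)
    also have "\<dots> = ?N / L + e * (?N / (?N + 1))" by (simp add: distrib_left mult.commute)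
    also have "\<dots> \<le> ?N / L + e * 1" using N0 e by (intro add_left_mono mult_left_mono) auto
    finally show ?thesis by simp
  qed
  then have "1 \<le> ?N / L" by (rule field_le_epsilon)
  then show ?thesis using L by (simp add: field_simps)
qed

text \<open>The value \<open>\<nu>\<close> is at least the largest lower bound of the section, and this is witnessed within distance \<open>R\<close> of \<open>g\<close>.\<close>

definition localizes ::
    "('n::finite, 'a::complex_banach) seq_op \<Rightarrow> nat \<Rightarrow> int ^ 'n \<Rightarrow> nat \<Rightarrow> real \<Rightarrow> bool" where
  "localizes A n g R \<nu> \<longleftrightarrow> (\<exists>y\<in>im_P p n. y \<noteq> (\<lambda>_. 0) \<and>
     (\<forall>i. y i \<noteq> 0 \<longrightarrow> i - g \<in> cube R) \<and> nrm (fin_sec A n y) \<le> \<nu> * nrm y)"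

text \<open>The two cases of the existence argument: if the centres of the minimisers stay away from the
  boundaries of the cubes, the truncation is not felt and \<open>A\<close> itself attains the value; otherwise
  the translates of the sections by nearby boundary points have a limit which does.\<close>

lemma interior_witnesses:
  fixes A :: "('n::finite, 'a::complex_banach) seq_op"
  assumes A: "A \<in> band_dominated p" and far: "filterlim (\<lambda>k. int (n k) - sup_abs (g k)) at_top sequentially"
    and wit: "\<And>\<epsilon>. 0 < \<epsilon> \<Longrightarrow> \<exists>R. \<forall>\<^sub>F k in sequentially. localizes A (n k) (g k) R (\<nu> + \<epsilon>)"
    and \<epsilon>: "0 < \<epsilon>"
  shows "\<exists>y\<in>E. y \<noteq> (\<lambda>_. 0) \<and> nrm (A y) \<le> (\<nu> + \<epsilon>) * nrm y"
proof -
  note Ab = band_dominated_bounded[OF A]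
  have e2: "0 < \<epsilon> / 2" using \<epsilon> by simp
  obtain w where w: "\<And>U V x. (\<And>i k. i \<in> U \<Longrightarrow> k \<in> V \<Longrightarrow> i - k \<notin> cube w) \<Longrightarrow> x \<in> E \<Longrightarrow>
    nrm (restr U (A (restr V x))) \<le> \<epsilon> / 2 * nrm x"
    using band_dominated_off_diagonal[OF A e2] by blast
  obtain R where "\<forall>\<^sub>F k in sequentially. localizes A (n k) (g k) R (\<nu> + \<epsilon> / 2)"
    using wit[OF e2] by blast
  moreover have "\<forall>\<^sub>F k in sequentially. int (R + w) \<le> int (n k) - sup_abs (g k)"
    using far by (simp add: filterlim_at_top)
  ultimately have "\<forall>\<^sub>F k in sequentially. localizes A (n k) (g k) R (\<nu> + \<epsilon> / 2) \<and> int (R + w) \<le> int (n k) - sup_abs (g k)"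
    by (rule eventually_conj)
  then obtain k y where y: "y \<in> im_P p (n k)" "y \<noteq> (\<lambda>_. 0)" "\<forall>i. y i \<noteq> 0 \<longrightarrow> i - g k \<in> cube R"
      "nrm (fin_sec A (n k) y) \<le> (\<nu> + \<epsilon> / 2) * nrm y"
    and d: "int (R + w) \<le> int (n k) - sup_abs (g k)"
    unfolding eventually_sequentially localizes_def by blast
  note yE = im_P_subset_E[OF y(1)]
  let ?U = "cube (n k)" and ?V = "{i. i - g k \<in> cube R}"
  note AyE = bounded_opsD(1)[OF Ab yE]
  have ry: "restr ?U y = y" by (rule restr_id) (use y(1) in \<open>simp add: im_P_eq\<close>)
  have rV: "restr ?V y = y" by (rule restr_id) (use y(3) in auto)
  have "nrm (A y) \<le> nrm (restr ?U (A y)) + nrm (restr (- ?U) (A y))"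
    using nrm_triangle[OF restr_in_E[OF AyE, of ?U] restr_in_E[OF AyE, of "- ?U"]]
    by (simp add: restr_split[symmetric])
  also have "restr ?U (A y) = fin_sec A (n k) y" by (simp add: fin_sec_eq_compress compress_def ry)
  also have "nrm (restr (- ?U) (A y)) \<le> \<epsilon> / 2 * nrm y"
  proof -
    have "nrm (restr (- ?U) (A (restr ?V y))) \<le> \<epsilon> / 2 * nrm y"
    proof (rule w[OF _ yE], rule notI)
      fix i l assume i: "i \<in> - ?U" and l: "l \<in> ?V" and il: "i - l \<in> cube w"
      have "i - l + (l - g k) \<in> cube (w + R)" using cube_add[OF il, of "l - g k" R] l by simp
      then have "i - g k \<in> cube (w + R)" by simp
      from cube_add[OF this in_cube_sup_abs[of "g k"]]
      have "i \<in> cube (w + R + nat (sup_abs (g k)))" by simp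
      moreover have "w + R + nat (sup_abs (g k)) \<le> n k" using d sup_abs_nonneg[of "g k"] by linarith
      ultimately have "i \<in> ?U" using cube_mono by blast
      then show False using i by simp
    qed
    then show ?thesis by (simp add: rV)
  qed
  finally have "nrm (A y) \<le> (\<nu> + \<epsilon>) * nrm y" using y(4) by (simp add: algebra_simps)
  then show ?thesis using yE y(2) by blast
qed

lemma boundary_limit_with_witnesses:
  fixes A :: "('n::finite, 'a::complex_banach) seq_op"
  assumes A: "A \<in> band_dominated p" and rich: "rich p A"
    and n: "filterlim n at_top sequentially" and g: "\<And>k. g k \<in> cube (n k)"
    and near: "\<not> filterlim (\<lambda>k. int (n k) - sup_abs (g k)) at_top sequentially"
    and wit: "\<And>\<epsilon>. 0 < \<epsilon> \<Longrightarrow> \<exists>R. \<forall>\<^sub>F k in sequentially. localizes A (n k) (g k) R (\<nu> + \<epsilon>)"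
  obtains S where "S \<in> stab_spectrum p A c"
    "\<And>\<epsilon>. 0 < \<epsilon> \<Longrightarrow> \<exists>y\<in>E. y \<noteq> (\<lambda>_. 0) \<and> nrm (S y) \<le> (\<nu> + \<epsilon>) * nrm y"
proof -
  note Ab = band_dominated_bounded[OF A]
  note Tb = translate_bounded[OF Ab]
  obtain C where C: "0 \<le> C" "\<And>x. x \<in> E \<Longrightarrow> nrm (A x) \<le> C * nrm x"
    using bounded_ops_bound[OF seq_subspace_E Ab] by blast
  have TC: "nrm (translate h A x) \<le> C * nrm x" if "x \<in> E" for h x
    by (rule translate_bound[OF C(2) that])
  obtain Z where Z: "\<not> (\<forall>\<^sub>F k in sequentially. Z \<le> int (n k) - sup_abs (g k))"
    using near by (auto simp: filterlim_at_top)
  obtain r0 :: "nat \<Rightarrow> nat" where r0: "strict_mono r0" and r0': "\<forall>k. \<not> Z \<le> int (n (r0 k)) - sup_abs (g (r0 k))"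
    using not_eventually_sequentiallyD[OF Z] by blast
  define d where "d = nat Z"
  have "\<exists>h. sup_abs h = int (n (r0 k)) \<and> g (r0 k) - h \<in> cube d" for k
  proof -
    obtain h where h: "sup_abs h = int (n (r0 k))" "g (r0 k) - h \<in> cube (nat (int (n (r0 k)) - sup_abs (g (r0 k))))"
      using exists_boundary_point[OF g] by blast
    have "nat (int (n (r0 k)) - sup_abs (g (r0 k))) \<le> d"
      using r0'[rule_format, of k] by (simp add: d_def)
    then show ?thesis using h cube_mono by blast
  qed
  then obtain h where h: "\<And>k. sup_abs (h k) = int (n (r0 k))" "\<And>k. g (r0 k) - h k \<in> cube d"
    by metis
  have n0: "filterlim (\<lambda>k. n (r0 k)) at_top sequentially"
    by (rule filterlim_compose[OF n filterlim_subseq[OF r0]])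
  have "to_infinity h"
    unfolding to_infinity_def h(1) by (rule filterlim_compose[OF filterlim_int_sequentially n0])
  then obtain r1 L where r1: "strict_mono r1" "limit_op p A (h \<circ> r1) L"
    using rich unfolding rich_def by blast
  have limL: "P_strong_limit p (\<lambda>k. translate (h (r1 k)) A) L"
    using r1(2) by (simp add: limit_op_def translate_def)
  define W where "W k = {i. i + h (r1 k) \<in> cube (n (r0 (r1 k)))}" for k
  obtain r2 V where r2: "strict_mono r2" "\<And>i. \<forall>\<^sub>F k in sequentially. i \<in> W (r2 k) \<longleftrightarrow> i \<in> V"
    by (rule pointwise_stabilising_subsequence[of W]) blast
  define s where "s k = r1 (r2 k)" for k
  define m where "m k = n (r0 (s k))" for k
  have Lb: "L \<in> bounded_ops p E" using limL by (simp add: P_strong_limit_def)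
  have row: "row_limit (\<lambda>k. translate (h (s k)) A) L"
    unfolding s_def by (rule row_limit_subseq[OF P_strong_limitD(1)[OF limL] r2(1)])
  have col: "column_limit (\<lambda>k. translate (h (s k)) A) L"
    unfolding s_def by (rule column_limit_subseq[OF P_strong_limitD(2)[OF limL] r2(1)])
  define S where "S = section_ext V c L"
  let ?B = "\<lambda>k. translate (h (s k)) (fin_sec_ext A c (m k))"
  have B_eq: "?B = (\<lambda>k. section_ext (W (r2 k)) c (translate (h (s k)) A))"
    by (simp add: fin_sec_ext_eq_section_ext translate_section_ext W_def m_def s_def)
  note lims = section_limits[OF A Lb row col r2(2), of c]
  have Bb: "?B k \<in> bounded_ops p E" for k
    unfolding fun_cong[OF B_eq] by (rule section_ext_bounded[OF Tb TC C(1)])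
  have BC: "nrm (?B k x) \<le> (C + \<bar>c\<bar>) * nrm x" if "x \<in> E" for k x
    unfolding fun_cong[OF B_eq] by (rule section_ext_bound[OF Tb TC C(1) that])
  obtain CL where CL: "0 \<le> CL" "\<And>x. x \<in> E \<Longrightarrow> nrm (L x) \<le> CL * nrm x"
    using bounded_ops_bound[OF seq_subspace_E Lb] by blast
  have Sb: "S \<in> bounded_ops p E"
    unfolding S_def by (rule section_ext_bounded[OF Lb CL(2,1)])
  have colB: "column_limit ?B S" unfolding B_eq S_def by (rule lims(2))
  have "P_strong_limit p ?B S"
    by (rule P_strong_limitI[OF Bb Sb _ BC _ colB]) (use C(1) lims(1) in \<open>auto simp: B_eq S_def\<close>)
  moreover have s: "strict_mono s" using strict_mono_o[OF r1(1) r2(1)] by (simp add: s_def[abs_def] o_def)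
  moreover have "filterlim m at_top sequentially"
    unfolding m_def by (rule filterlim_compose[OF n0 filterlim_subseq[OF s]])
  moreover have "sup_abs (h (s k)) = int (m k)" for k by (simp add: h(1) m_def)
  ultimately have "S \<in> stab_spectrum p A c"
    unfolding stab_spectrum_def translate_def by (intro UnI2 CollectI exI[of _ m] exI[of _ "\<lambda>k. h (s k)"]) auto
  moreover have "\<exists>y\<in>E. y \<noteq> (\<lambda>_. 0) \<and> nrm (S y) \<le> (\<nu> + \<epsilon>) * nrm y" if \<epsilon>: "0 < \<epsilon>" for \<epsilon>
  proof -
    have e2: "0 < \<epsilon> / 2" using \<epsilon> by simp
    obtain R where R: "\<forall>\<^sub>F k in sequentially. localizes A (n k) (g k) R (\<nu> + \<epsilon> / 2)"
      using wit[OF e2] by blast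
    have "filterlim (\<lambda>k. r0 (s k)) at_top sequentially"
      using filterlim_subseq[OF strict_mono_o[OF r0 s]] by (simp add: o_def)
    from eventually_conj[OF eventually_compose_filterlim[OF R this] column_limitD[OF colB e2, of "R + d"]]
    obtain k where "localizes A (m k) (g (r0 (s k))) R (\<nu> + \<epsilon> / 2)"
      and close: "\<forall>x\<in>E. nrm (\<lambda>i. ?B k (restr (cube (R + d)) x) i - S (restr (cube (R + d)) x) i) \<le> \<epsilon> / 2 * nrm x"
      unfolding eventually_sequentially m_def by blast
    then obtain y where y: "y \<in> im_P p (m k)" "y \<noteq> (\<lambda>_. 0)" "\<forall>i. y i \<noteq> 0 \<longrightarrow> i - g (r0 (s k)) \<in> cube R"
        "nrm (fin_sec A (m k) y) \<le> (\<nu> + \<epsilon> / 2) * nrm y"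
      unfolding localizes_def by blast
    note yE = im_P_subset_E[OF y(1)]
    let ?h = "h (s k)"
    define z where "z = shift (- ?h) y"
    have z: "z \<in> E" "nrm z = nrm y" by (simp_all add: z_def shift_in_E nrm_shift yE)
    have z0: "z \<noteq> (\<lambda>_. 0)"
    proof
      assume "z = (\<lambda>_. 0)"
      then have "y (i + ?h) = 0" for i by (metis z_def shift_def diff_minus_eq_add)
      then have "y i = 0" for i by (metis diff_add_cancel)
      then show False using y(2) by blast
    qed
    have rz: "restr (cube (R + d)) z = z"
    proof (rule restr_id, rule ccontr)
      fix i assume i: "i \<notin> cube (R + d)" "z i \<noteq> 0"
      then have "i + ?h - g (r0 (s k)) \<in> cube R" using y(3) by (auto simp: z_def shift_def)
      from cube_add[OF this h(2)[of "s k"]] show False using i(1) by simp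
    qed
    have "?B k z = shift (- ?h) (fin_sec_ext A c (m k) y)"
    proof -
      have "shift ?h z = y" by (auto simp: z_def shift_def)
      then show ?thesis by (simp add: translate_def)
    qed
    moreover have "fin_sec_ext A c (m k) y = fin_sec A (m k) y"
      using y(1) by (auto simp: fin_sec_ext_def Q_proj_eq_restr restr_def im_P_eq)
    ultimately have Bz: "nrm (?B k z) = nrm (fin_sec A (m k) y)" by (simp add: nrm_shift)
    have "nrm (S z) \<le> nrm (?B k z) + nrm (\<lambda>i. S z i - ?B k z i)"
      by (rule nrm_le_diff[OF bounded_opsD(1)[OF Sb z(1)] bounded_opsD(1)[OF Bb z(1)]])
    also have "nrm (\<lambda>i. S z i - ?B k z i) \<le> \<epsilon> / 2 * nrm z"
      using close[rule_format, OF z(1)] by (simp add: rz nrm_minus_commute[of "S z"])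
    finally have "nrm (S z) \<le> (\<nu> + \<epsilon>) * nrm z"
      using y(4) by (simp add: Bz z(2) algebra_simps)
    then show ?thesis using z(1) z0 by blast
  qed
  ultimately show ?thesis by (rule that)
qed

end

section \<open>The limit superior of the norms of the inverses\<close>

context lp_exponent
begin

text \<open>Since \<open>c\<close> is at least the norm of \<open>A\<close>, the inverse of the summand \<open>c\<close> in the extended sections never
  dominates the inverse of the finite section.\<close>

lemma inv_norm_fin_sec_lower_bound:
  fixes A :: "('n::finite, 'a::complex_banach) seq_op"
  assumes X: "(UNIV :: 'a set) \<noteq> {0}" and A: "A \<in> bounded_ops p E"
    and c: "0 < c" "op_norm p E A \<le> c" and inv: "invertible_op p (im_P p n) (fin_sec A n)"
  shows "1 / c \<le> inv_norm p (im_P p n) (fin_sec A n)"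
proof -
  let ?f = "inv_norm p (im_P p n) (fin_sec A n)"
  obtain v :: 'a where v: "v \<noteq> 0" using X by auto
  define x where "x = (\<lambda>i::int ^ 'n. if i = 0 then v else 0)"
  have x: "x \<in> im_P p n" using zero_in_cube[of n] by (auto simp: im_P_eq x_def)
  note xE = im_P_subset_E[OF x]
  have "norm (x 0) \<le> nrm x" by (rule nrm_coord[OF xE])
  then have xpos: "0 < nrm x" using v by (simp add: x_def order_less_le_trans[of 0 "norm v"])
  have f0: "0 \<le> ?f"
    unfolding inv_norm_def
    by (rule op_norm_nonneg[OF seq_subspace_im_P invertible_op_inverse(1)[OF seq_subspace_im_P inv]])
  have Ac: "nrm (A y) \<le> c * nrm y" if y: "y \<in> E" for y
    using op_norm_bound[OF seq_subspace_E A y] mult_right_mono[OF c(2) nrm_nonneg[OF y]] by simp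
  have "nrm x \<le> ?f * nrm (fin_sec A n x)" by (rule inv_norm_lower_bound[OF seq_subspace_im_P inv x])
  also have "\<dots> \<le> ?f * (c * nrm x)"
    using compress_bound[OF A Ac _ xE, of "cube n"] c f0
    by (intro mult_left_mono) (auto simp: fin_sec_eq_compress)
  finally have "1 * nrm x \<le> (?f * c) * nrm x" by (simp add: mult.assoc)
  then have "1 \<le> ?f * c" using xpos by (rule mult_right_le_imp_le)
  then show ?thesis using c by (simp add: field_simps)
qed

text \<open>Along a sequence of sections whose inverses approach the limit superior, the nested localisation
  is carried out to the depth \<open>k\<close> in the section of index \<open>k\<close>, so that every fixed accuracy is
  eventually reached, at a radius that depends on the accuracy only.\<close>

lemma centred_witnesses:
  fixes A :: "('n::finite, 'a::complex_banach) seq_op"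
  assumes A: "A \<in> band_dominated p" and L: "0 < L"
    and freq: "\<And>L' N. L' < L \<Longrightarrow> \<exists>n\<ge>N. invertible_op p (im_P p n) (fin_sec A n) \<and>
       L' < inv_norm p (im_P p n) (fin_sec A n)"
  obtains n g where "filterlim n at_top sequentially" "\<And>k. g k \<in> cube (n k)"
    "\<And>\<epsilon>. 0 < \<epsilon> \<Longrightarrow> \<exists>R. \<forall>\<^sub>F k in sequentially. localizes A (n k) (g k) R (1 / L + \<epsilon>)"
proof -
  obtain \<rho> where \<rho>: "\<forall>k n x lam. x \<in> im_P p n \<longrightarrow> x \<noteq> (\<lambda>_. 0) \<longrightarrow> 0 \<le> lam \<longrightarrow>
    nrm (fin_sec A n x) \<le> lam * nrm x \<longrightarrow>
    (\<exists>g. x g \<noteq> 0 \<and> (\<forall>l\<le>k. \<exists>y. y \<noteq> (\<lambda>_. 0) \<and> (\<forall>i. y i \<noteq> 0 \<longrightarrow> x i \<noteq> 0 \<and> i - g \<in> cube (\<rho> l)) \<and>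
           nrm (fin_sec A n y) \<le> (lam + (\<Sum>i=l..k. (1/2)^i)) * nrm y))"
    using nested_localization[OF A] by blast
  define mu where "mu k = 1 / L + 1 / (real k + 1)" for k
  have mu: "0 < mu k" for k using L by (auto simp: mu_def intro!: add_pos_pos)
  have "\<exists>n g. k \<le> n \<and> g \<in> cube n \<and> (\<forall>l\<le>k. localizes A n g (\<rho> l) (mu k + 2 * (1/2)^l))" for k
  proof -
    have "1 / L < mu k" by (simp add: mu_def)
    then have "1 / mu k < L" using L mu[of k] by (simp add: field_simps)
    then obtain n where n: "k \<le> n" and inv: "invertible_op p (im_P p n) (fin_sec A n)"
      and big: "1 / mu k < op_norm p (im_P p n) (inv_into (im_P p n) (fin_sec A n))"
      using freq[of "1 / mu k" k] by (auto simp: inv_norm_def)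
    obtain z where z: "z \<in> im_P p n" "nrm z \<le> 1" "1 / mu k < nrm (inv_into (im_P p n) (fin_sec A n) z)"
      using op_norm_approx[OF seq_subspace_im_P big] by blast
    define x where "x = inv_into (im_P p n) (fin_sec A n) z"
    have x: "x \<in> im_P p n" "fin_sec A n x = z"
      unfolding x_def using invertible_op_inverse(3,4)[OF seq_subspace_im_P inv z(1)] by auto
    have "0 < 1 / mu k" using mu[of k] by simp
    then have "x \<noteq> (\<lambda>_. 0)" using z(3) by (auto simp: x_def[symmetric] nrm_zero)
    moreover have "nrm (fin_sec A n x) \<le> mu k * nrm x"
    proof -
      have "1 < mu k * nrm x" using z(3) mu[of k] by (simp add: x_def[symmetric] field_simps)
      then show ?thesis using x(2) z(2) by simp
    qed
    ultimately obtain g where g: "x g \<noteq> 0" and loc: "\<forall>l\<le>k. \<exists>y. y \<noteq> (\<lambda>_. 0) \<and>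
        (\<forall>i. y i \<noteq> 0 \<longrightarrow> x i \<noteq> 0 \<and> i - g \<in> cube (\<rho> l)) \<and>
        nrm (fin_sec A n y) \<le> (mu k + (\<Sum>i=l..k. (1/2)^i)) * nrm y"
      using \<rho> x(1) less_imp_le[OF mu[of k]] by blast
    have "localizes A n g (\<rho> l) (mu k + 2 * (1/2)^l)" if l: "l \<le> k" for l
    proof -
      obtain y where y: "y \<noteq> (\<lambda>_. 0)" "\<forall>i. y i \<noteq> 0 \<longrightarrow> x i \<noteq> 0 \<and> i - g \<in> cube (\<rho> l)"
        "nrm (fin_sec A n y) \<le> (mu k + (\<Sum>i=l..k. (1/2)^i)) * nrm y"
        using loc l by blast
      have yP: "y \<in> im_P p n" using y(2) x(1) by (auto simp: im_P_eq)
      have "nrm (fin_sec A n y) \<le> (mu k + 2 * (1/2)^l) * nrm y"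
        by (rule order_trans[OF y(3) mult_right_mono[OF _ nrm_nonneg[OF im_P_subset_E[OF yP]]]])
          (use sum_half_powers_le[of l k] in simp)
      then show ?thesis unfolding localizes_def using y yP by blast
    qed
    moreover have "g \<in> cube n" using g x(1) by (auto simp: im_P_eq)
    ultimately show ?thesis using n by blast
  qed
  then obtain n g where ng: "\<And>k. k \<le> n k" "\<And>k. g k \<in> cube (n k)"
    "\<And>k. \<forall>l\<le>k. localizes A (n k) (g k) (\<rho> l) (mu k + 2 * (1/2)^l)"
    by metis
  show ?thesis
  proof (rule that[of n g])
    show "filterlim n at_top sequentially"
      by (rule filterlim_at_top_mono[OF filterlim_ident]) (simp add: ng(1))
    show "g k \<in> cube (n k)" for k by (rule ng(2))
    fix \<epsilon> :: real assume \<epsilon>: "0 < \<epsilon>"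
    obtain l where l: "(1/2::real)^l < \<epsilon> / 4"
      using real_arch_pow_inv[of "\<epsilon> / 4" "1/2"] \<epsilon> by auto
    obtain K where K: "inverse (real (Suc K)) < \<epsilon> / 2" using reals_Archimedean[of "\<epsilon> / 2"] \<epsilon> by auto
    show "\<exists>R. \<forall>\<^sub>F k in sequentially. localizes A (n k) (g k) R (1 / L + \<epsilon>)"
    proof (intro exI[of _ "\<rho> l"] eventually_mono[OF eventually_ge_at_top[of "max l K"]])
      fix k assume k: "max l K \<le> k"
      then obtain y where y: "y \<in> im_P p (n k)" "y \<noteq> (\<lambda>_. 0)" "\<forall>i. y i \<noteq> 0 \<longrightarrow> i - g k \<in> cube (\<rho> l)"
        "nrm (fin_sec A (n k) y) \<le> (mu k + 2 * (1/2)^l) * nrm y"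
        using ng(3)[of k] unfolding localizes_def by (meson max.boundedE)
      have "1 / (real k + 1) \<le> inverse (real (Suc K))"
        using k by (simp add: field_simps)
      then have "mu k + 2 * (1/2)^l \<le> 1 / L + \<epsilon>" using l K by (simp add: mu_def)
      then have "nrm (fin_sec A (n k) y) \<le> (1 / L + \<epsilon>) * nrm y"
        using y(4) mult_right_mono[OF _ nrm_nonneg[OF im_P_subset_E[OF y(1)]]] order_trans by blast
      then show "localizes A (n k) (g k) (\<rho> l) (1 / L + \<epsilon>)"
        unfolding localizes_def using y by blast
    qed
  qed
qed

end

theorem theorem6p6:
  fixes p :: ereal and c :: real
    and A :: "('n::finite, 'a::complex_banach) seq_op"
  assumes p: "p = 0 \<or> 1 \<le> p"
    and X_nontrivial: "(UNIV :: 'a set) \<noteq> {0}"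
    and A: "A \<in> rich_band_dominated p"
    and c_pos: "c > 0"
    and c_norm: "c \<ge> op_norm p (lp_space p) A"
    and stab: "stable_seq p (fin_sec A)"
  shows "(\<forall>S\<in>stab_spectrum p A c. invertible_op p (lp_space p) S) \<and>
    (\<exists>S0\<in>stab_spectrum p A c.
       (\<forall>S\<in>stab_spectrum p A c.
          inv_norm p (lp_space p) S \<le> inv_norm p (lp_space p) S0) \<and>
       limsup (\<lambda>n. ereal (inv_norm p (im_P p n) (fin_sec A n)))
         = ereal (inv_norm p (lp_space p) S0))"
proof -
  interpret lp_exponent p by unfold_locales (rule p)
  have Abd: "A \<in> band_dominated p" and rich: "rich p A"
    using A by (auto simp: rich_band_dominated_def)
  note Ab = band_dominated_bounded[OF Abd]
  define f where "f n = inv_norm p (im_P p n) (fin_sec A n)" for n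
  obtain n0 where inv: "\<forall>n\<ge>n0. invertible_op p (im_P p n) (fin_sec A n)"
    and bdd: "bdd_above (f ` {n0..})"
    using stab unfolding stable_seq_def f_def by blast
  note inv = inv[rule_format]
  from bdd obtain M where M: "f n \<le> M" if "n0 \<le> n" for n
    unfolding bdd_above_def by auto
  have fc: "1 / c \<le> f n" if "n0 \<le> n" for n
    unfolding f_def by (rule inv_norm_fin_sec_lower_bound[OF X_nontrivial Ab c_pos c_norm inv[OF that]])
  let ?l = "limsup (\<lambda>n. ereal (f n))"
  have "?l \<le> ereal M"
    by (rule Limsup_bounded) (use M in \<open>auto simp: eventually_sequentially\<close>)
  moreover have "ereal (1 / c) \<le> ?l"
    by (rule le_Limsup) (use fc in \<open>auto simp: eventually_sequentially\<close>)
  ultimately obtain L where L: "?l = ereal L" "1 / c \<le> L"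
    by (cases ?l) auto
  have Lpos: "0 < L" using L(2) c_pos by (meson less_le_trans zero_less_divide_1_iff)

  have good: "\<forall>\<^sub>F n in sequentially. invertible_op p (im_P p n) (fin_sec A n) \<and>
      inv_norm p (im_P p n) (fin_sec A n) \<le> L'" if "L < L'" for L'
  proof -
    have "\<forall>\<^sub>F n in sequentially. ereal (f n) < ereal L'"
      by (rule Limsup_lessD) (use L(1) that in simp)
    then show ?thesis
      using eventually_ge_at_top[of n0] by eventually_elim (use inv in \<open>auto simp: f_def\<close>)
  qed
  have upper: "invertible_op p E S \<and> inv_norm p E S \<le> L'"
    if S: "S \<in> stab_spectrum p A c" and L': "L < L'" for S L'
  proof -
    have pos: "0 < L'" using Lpos L' by simp
    have "1 / c \<le> L'" using L(2) L' by simp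
    then have "1 / L' \<le> c" using c_pos pos by (simp add: field_simps)
    then show ?thesis
      using stab_spectrum_invertible[OF Abd, of "1 / L'" c S] good[OF L'] S pos by simp
  qed
  have inv_S: "invertible_op p E S" if "S \<in> stab_spectrum p A c" for S
    using upper[OF that, of "L + 1"] by simp
  have le_L: "inv_norm p E S \<le> L" if "S \<in> stab_spectrum p A c" for S
    by (rule dense_ge) (use upper[OF that] in blast)

  have freq: "\<exists>n\<ge>N. invertible_op p (im_P p n) (fin_sec A n) \<and> L' < inv_norm p (im_P p n) (fin_sec A n)"
    if "L' < L" for L' N
  proof (rule ccontr)
    assume neg: "\<not> ?thesis"
    have "?l \<le> ereal L'"
    proof (rule Limsup_bounded)
      show "\<forall>\<^sub>F n in sequentially. ereal (f n) \<le> ereal L'"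
        using eventually_ge_at_top[of "max n0 N"]
        by (rule eventually_mono) (use neg inv in \<open>auto simp: f_def not_less\<close>)
    qed
    then show False using L(1) that by simp
  qed
  obtain n g where n: "filterlim n at_top sequentially" and g: "\<And>k. g k \<in> cube (n k)"
    and wit: "\<And>\<epsilon>. 0 < \<epsilon> \<Longrightarrow> \<exists>R. \<forall>\<^sub>F k in sequentially. localizes A (n k) (g k) R (1 / L + \<epsilon>)"
    using centred_witnesses[OF Abd Lpos freq] by blast
  have "\<exists>S0\<in>stab_spectrum p A c. \<forall>\<epsilon>>0. \<exists>y\<in>E. y \<noteq> (\<lambda>_. 0) \<and> nrm (S0 y) \<le> (1 / L + \<epsilon>) * nrm y"
  proof (cases "filterlim (\<lambda>k. int (n k) - sup_abs (g k)) at_top sequentially")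
    case True
    have "A \<in> stab_spectrum p A c" by (simp add: stab_spectrum_def)
    then show ?thesis using interior_witnesses[OF Abd True wit] by blast
  next
    case False
    show ?thesis
      by (rule boundary_limit_with_witnesses[OF Abd rich n g False wit, where c = c]) blast+
  qed
  then obtain S0 where S0: "S0 \<in> stab_spectrum p A c"
    and wit0: "\<And>\<epsilon>. 0 < \<epsilon> \<Longrightarrow> \<exists>y\<in>E. y \<noteq> (\<lambda>_. 0) \<and> nrm (S0 y) \<le> (1 / L + \<epsilon>) * nrm y" by blast
  have "L \<le> inv_norm p E S0"
    by (rule inv_norm_ge_by_witnesses[OF inv_S[OF S0] Lpos wit0])
  then have "inv_norm p E S0 = L" using le_L[OF S0] by simp
  then show ?thesis
    using inv_S le_L S0 L(1) unfolding f_def by auto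
qed

end
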